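(* The following decision problem is NP-complete: given a planar graph $G$ with $\overrightarrow{\chi}_s(G)=2$, decide whether $G$ has an optimal semi-proper orientation $(D,w)$ such that $w(e)=1$ for every edge $e\in E(G)$.
   Context: All graphs are finite, simple and undirected. An orientation $D$ of $G$ replaces each edge $uv$ by exactly one of the arcs $u\to v$ or $v\to u$. A semi-proper orientation of $G$ is a pair $(D,w)$ where $D$ is an orientation of $G$ and $w:E(G)\to\mathbb{Z}_{>0}$ is a positive integer weight function, such that for every two adjacent vertices $u,v$ we have $S_{(D,w)}(u)\neq S_{(D,w)}(v)$, where $S_{(D,w)}(v)=\sum_{z\in N^-_D(v)} w(zv)$ is the sum of the weights of the edges whose head is $v$ in $D$. The semi-proper orientation number is $\overrightarrow{\chi}_s(G)=\min_{(D,w)}\max_{v\in V(G)} S_{(D,w)}(v)$, the minimum taken over all semi-proper orientations of $G$. An optimal semi-proper orientation is a semi-proper orientation $(D,w)$ with $\max_{v\in V(G)} S_{(D,w)}(v)=\overrightarrow{\chi}_s(G)$. *)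

theory Defs
  imports "HOL-Analysis.Analysis" "HOL-Computational_Algebra.Polynomial"
begin

section \<open>Graphs and semi-proper orientations\<close>

definition simple_graph :: "'a set \<Rightarrow> 'a set set \<Rightarrow> bool" where
  "simple_graph V E \<longleftrightarrow> finite V \<and> (\<forall>e\<in>E. e \<subseteq> V \<and> card e = 2)"

text \<open>An arc from \<open>u\<close> to \<open>v\<close> is the pair \<open>(u, v)\<close>; its head is \<open>v\<close>.\<close>

definition orientation :: "'a set set \<Rightarrow> ('a \<times> 'a) set \<Rightarrow> bool" where
  "orientation E D \<longleftrightarrow>
     (\<forall>(u, v)\<in>D. {u, v} \<in> E) \<and>
     (\<forall>u v. {u, v} \<in> E \<longrightarrow> ((u, v) \<in> D) \<noteq> ((v, u) \<in> D))"

definition in_weight :: "('a \<times> 'a) set \<Rightarrow> ('a set \<Rightarrow> nat) \<Rightarrow> 'a \<Rightarrow> nat" where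
  "in_weight D w v = (\<Sum>z | (z, v) \<in> D. w {z, v})"

definition semi_proper :: "'a set set \<Rightarrow> ('a \<times> 'a) set \<Rightarrow> ('a set \<Rightarrow> nat) \<Rightarrow> bool" where
  "semi_proper E D w \<longleftrightarrow>
     orientation E D \<and> (\<forall>e\<in>E. w e > 0) \<and>
     (\<forall>u v. {u, v} \<in> E \<longrightarrow> in_weight D w u \<noteq> in_weight D w v)"

text \<open>On \<^typ>\<open>nat\<close>, the supremum of a finite nonempty set is its maximum, the supremum
  of the empty set is 0, and the infimum of a nonempty set is its least element.\<close>

definition max_in_weight :: "'a set \<Rightarrow> ('a \<times> 'a) set \<Rightarrow> ('a set \<Rightarrow> nat) \<Rightarrow> nat" where
  "max_in_weight V D w = (SUP v\<in>V. in_weight D w v)"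

definition semi_proper_number :: "'a set \<Rightarrow> 'a set set \<Rightarrow> nat" where
  "semi_proper_number V E = (INF (D, w) \<in> {(D, w). semi_proper E D w}. max_in_weight V D w)"

definition optimal_semi_proper ::
    "'a set \<Rightarrow> 'a set set \<Rightarrow> ('a \<times> 'a) set \<Rightarrow> ('a set \<Rightarrow> nat) \<Rightarrow> bool" where
  "optimal_semi_proper V E D w \<longleftrightarrow>
     semi_proper E D w \<and> max_in_weight V D w = semi_proper_number V E"

text \<open>A drawing in the plane, here \<^typ>\<open>complex\<close>: vertices are distinct points, and
  edges are simple arcs joining their end points that meet vertices and each other only in
  common end points.\<close>

definition planar :: "'a set \<Rightarrow> 'a set set \<Rightarrow> bool" where
  "planar V E \<longleftrightarrow>
     (\<exists>(pos :: 'a \<Rightarrow> complex) (crv :: 'a set \<Rightarrow> real \<Rightarrow> complex).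
        inj_on pos V \<and>
        (\<forall>e\<in>E. arc (crv e) \<and>
                {pathstart (crv e), pathfinish (crv e)} = pos ` e \<and>
                path_image (crv e) \<inter> pos ` V = pos ` e) \<and>
        (\<forall>e\<in>E. \<forall>e'\<in>E. e \<noteq> e' \<longrightarrow>
                path_image (crv e) \<inter> path_image (crv e') \<subseteq> pos ` (e \<inter> e')))"


section \<open>Deterministic multi-tape Turing machines\<close>

text \<open>Tapes are infinite in both directions. States are numbered; state 0 is initial and
  the state with number \<open>num_states\<close> is the halting state, which has no outgoing
  transitions. Symbol 0 is the blank, symbols 1 and 2 stand for the two bits. The argument of
  \<open>trans\<close> and the actions in its result list one entry per tape.\<close>

datatype move = Go_Left | Stay | Go_Right

record tm =
  num_tapes :: nat
  num_symbols :: nat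
  num_states :: nat
  trans :: "nat \<Rightarrow> nat list \<Rightarrow> nat \<times> (nat \<times> move) list"

definition wf_tm :: "tm \<Rightarrow> bool" where
  "wf_tm M \<longleftrightarrow>
     num_tapes M \<ge> 1 \<and> num_symbols M \<ge> 3 \<and>
     (\<forall>s<num_states M. \<forall>xs. length xs = num_tapes M \<and> set xs \<subseteq> {..<num_symbols M} \<longrightarrow>
        (case trans M s xs of (s', acts) \<Rightarrow>
           s' \<le> num_states M \<and> length acts = num_tapes M \<and>
           (\<forall>(a, m)\<in>set acts. a < num_symbols M)))"

text \<open>A tape consists of its contents and the position of its head; a configuration of the
  current state and the list of tapes.\<close>

type_synonym tape = "(int \<Rightarrow> nat) \<times> int"
type_synonym config = "nat \<times> tape list"

fun shift :: "move \<Rightarrow> int" where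
  "shift Go_Left = -1"
| "shift Stay = 0"
| "shift Go_Right = 1"

fun act :: "tape \<Rightarrow> nat \<times> move \<Rightarrow> tape" where
  "act (c, h) (a, m) = (c(h := a), h + shift m)"

fun tm_step :: "tm \<Rightarrow> config \<Rightarrow> config" where
  "tm_step M (s, ts) =
     (if s = num_states M then (s, ts)
      else let (s', acts) = trans M s (map (\<lambda>(c, h). c h) ts) in (s', map2 act ts acts))"

definition bit_symbol :: "bool \<Rightarrow> nat" where
  "bit_symbol b = (if b then 2 else 1)"

definition word_tape :: "bool list \<Rightarrow> tape" where
  "word_tape x = (\<lambda>i. if 0 \<le> i \<and> i < int (length x) then bit_symbol (x ! nat i) else 0, 0)"

definition tape_holds :: "tape \<Rightarrow> bool list \<Rightarrow> bool" where
  "tape_holds t y \<longleftrightarrow>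
     (\<forall>i<length y. fst t (int i) = bit_symbol (y ! i)) \<and> fst t (int (length y)) = 0"

text \<open>The inputs are written on the first tapes, one input per tape; the output is read off
  the last tape, from cell 0 up to the first blank.\<close>

definition init_config :: "tm \<Rightarrow> bool list list \<Rightarrow> config" where
  "init_config M xs =
     (0, map (\<lambda>i. word_tape (if i < length xs then xs ! i else [])) [0..<num_tapes M])"

definition computes_within :: "tm \<Rightarrow> bool list list \<Rightarrow> nat \<Rightarrow> bool list \<Rightarrow> bool" where
  "computes_within M xs t y \<longleftrightarrow>
     (case (tm_step M ^^ t) (init_config M xs) of (s, ts) \<Rightarrow>
        s = num_states M \<and> tape_holds (last ts) y)"

definition poly_time :: "nat \<Rightarrow> (bool list list \<Rightarrow> bool list) \<Rightarrow> bool" where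
  "poly_time m f \<longleftrightarrow>
     (\<exists>M (p :: nat poly). wf_tm M \<and> m \<le> num_tapes M \<and>
        (\<forall>xs. length xs = m \<longrightarrow>
           computes_within M xs (poly p (sum_list (map length xs))) (f xs)))"

definition poly_time_function :: "(bool list \<Rightarrow> bool list) \<Rightarrow> bool" where
  "poly_time_function f \<longleftrightarrow> poly_time 1 (\<lambda>xs. f (xs ! 0))"

definition poly_time_relation :: "(bool list \<Rightarrow> bool list \<Rightarrow> bool) \<Rightarrow> bool" where
  "poly_time_relation R \<longleftrightarrow> poly_time 2 (\<lambda>xs. [R (xs ! 0) (xs ! 1)])"


section \<open>NP-completeness\<close>

text \<open>A decision problem whose inputs are restricted to a set of admissible instances is
  given by its set \<open>Y\<close> of yes-instances and its set \<open>N\<close> of no-instances; nothing is required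
  on words outside \<open>Y \<union> N\<close>. A language \<open>L\<close> is the problem with \<open>Y = L\<close> and \<open>N = - L\<close>.\<close>

definition in_NP :: "bool list set \<Rightarrow> bool list set \<Rightarrow> bool" where
  "in_NP Y N \<longleftrightarrow>
     (\<exists>R (p :: nat poly). poly_time_relation R \<and>
        (\<forall>x\<in>Y. \<exists>u. length u \<le> poly p (length x) \<and> R x u) \<and>
        (\<forall>x\<in>N. \<not> (\<exists>u. length u \<le> poly p (length x) \<and> R x u)))"

definition NP_hard :: "bool list set \<Rightarrow> bool list set \<Rightarrow> bool" where
  "NP_hard Y N \<longleftrightarrow>
     (\<forall>L. in_NP L (- L) \<longrightarrow>
        (\<exists>f. poly_time_function f \<and> (\<forall>x\<in>L. f x \<in> Y) \<and> (\<forall>x\<in>- L. f x \<in> N)))"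

definition NP_complete :: "bool list set \<Rightarrow> bool list set \<Rightarrow> bool" where
  "NP_complete Y N \<longleftrightarrow> Y \<inter> N = {} \<and> in_NP Y N \<and> NP_hard Y N"


section \<open>The decision problem\<close>

text \<open>A graph on the vertices \<open>0, \<dots>, n - 1\<close> is encoded by the rows of its adjacency matrix;
  the code has length \<open>n * n\<close> and so determines \<open>n\<close>.\<close>

definition encode_graph :: "nat \<Rightarrow> nat set set \<Rightarrow> bool list" where
  "encode_graph n E = map (\<lambda>k. {k div n, k mod n} \<in> E) [0..<n * n]"

definition admissible :: "'a set \<Rightarrow> 'a set set \<Rightarrow> bool" where
  "admissible V E \<longleftrightarrow> simple_graph V E \<and> planar V E \<and> semi_proper_number V E = 2"

definition has_unweighted_optimum :: "'a set \<Rightarrow> 'a set set \<Rightarrow> bool" where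
  "has_unweighted_optimum V E \<longleftrightarrow>
     (\<exists>D w. optimal_semi_proper V E D w \<and> (\<forall>e\<in>E. w e = 1))"

definition yes_instances :: "bool list set" where
  "yes_instances =
     {encode_graph n E | n E. admissible {..<n} E \<and> has_unweighted_optimum {..<n} E}"

definition no_instances :: "bool list set" where
  "no_instances =
     {encode_graph n E | n E. admissible {..<n} E \<and> \<not> has_unweighted_optimum {..<n} E}"

end

theory Submission
  imports Defs
begin

text \<open>A computation of a verifier with a polynomial clock is a tiling of a rectangle, and a
  tiling is an exact cover. An exact cover instance with \<open>R\<close> sets and \<open>C\<close> points is turned
  into a grid of cells cut out of the triangular lattice, so the graph is planar. If all weights
  are 1 and the maximum is 2, in-degrees are at most 2 and differ at adjacent vertices; hence the
  edge by which a triangle hangs on the graph always points away from the triangle, two adjacent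
  vertices fed by such triangles have in-degrees 1 and 2, and which of them has in-degree 2 is a
  bit. Along row \<open>r\<close> of the grid runs the bit \<open>a r\<close> telling whether set \<open>r\<close> is selected, down
  column \<open>c\<close> the bit telling whether point \<open>c\<close> has been covered. Where set \<open>r\<close> contains point
  \<open>c\<close> the two bits must not both be set and their disjunction is passed on, elsewhere they cross.
  A leaf at the end of each column forces its bit to be set; a weight 2 on the edge of this leaf
  removes that constraint, so the semi-proper orientation number is 2 in any case.

  The adjacency matrix of this graph is defined by a formula of bounded arithmetic over the input
  word, and such formulas are evaluated in polynomial time by machines that use head positions as
  counters. The same evaluation verifies an orientation that serves as certificate for
  membership in NP.\<close>

section \<open>Gadgets for orientations with in-degree at most two\<close>

text \<open>The labels on a triangle are 0, 1, 2 in some order, and its own three edges already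
  contribute a total of 3, so no arc can enter it from outside; the networks that carry bits rest on
  this count. Planarity is the obstacle that shapes the cells, since a row bit has to pass a column
  bit. A crossing holds an auxiliary bit in its centre; in each of the four corners between the
  wires a gate equates this bit or its negation with the row bit on that side, provided that the
  column bit on that side has a certain value. These conditions are compatible only if both bits
  leave as they entered, and the auxiliary bit is then their exclusive or. A second obstacle is that
  no-instances need number 2 as well: with all bits false every cell is consistent except for the
  leaves at the bottom, so weights have nothing else to repair. On the machine side, tiles and
  colours depend on the verifier alone.\<close>

locale proper2 =
  fixes E :: "'a set set" and D :: "('a \<times> 'a) set"
  assumes orient: "orientation E D"
    and card2: "e \<in> E \<Longrightarrow> card e = 2"
    and fin: "finite E"
    and le2: "card {z. (z, v) \<in> D} \<le> 2"
    and differ: "{u, v} \<in> E \<Longrightarrow> card {z. (z, u) \<in> D} \<noteq> card {z. (z, v) \<in> D}"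
begin

definition lab :: "'a \<Rightarrow> nat" where
  "lab v = card {z. (z, v) \<in> D}"

definition nbs :: "'a \<Rightarrow> 'a list \<Rightarrow> bool" where
  "nbs v zs \<longleftrightarrow> distinct zs \<and> {z. {z, v} \<in> E} = set zs"

text \<open>\<open>S\<close> collects the neighbours from which an arc into \<open>v\<close> is
  still conceivable; a gadget attached to \<open>v\<close> outside \<open>S\<close> can rely on the
  direction of its first edge.\<close>

definition emits :: "'a \<Rightarrow> 'a set \<Rightarrow> bool" where
  "emits v S \<longleftrightarrow> (\<forall>z. {v, z} \<in> E \<longrightarrow> z \<notin> S \<longrightarrow> (v, z) \<in> D)"

abbreviation arc' :: "'a \<Rightarrow> 'a \<Rightarrow> nat" where
  "arc' u v \<equiv> of_bool ((u, v) \<in> D)"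

lemma lab_le2: "lab v \<le> 2"
  using le2 by (simp add: lab_def)

lemma lab_differ: "{u, v} \<in> E \<Longrightarrow> lab u \<noteq> lab v"
  using differ by (simp add: lab_def)

lemma arc_edge: "(u, v) \<in> D \<Longrightarrow> {u, v} \<in> E"
  using orient by (auto simp: orientation_def)

lemma arc_asym: "(u, v) \<in> D \<Longrightarrow> (v, u) \<notin> D"
  using orient arc_edge by (auto simp: orientation_def)

lemma arc_total: "{u, v} \<in> E \<Longrightarrow> (u, v) \<in> D \<or> (v, u) \<in> D"
  using orient by (auto simp: orientation_def)

lemma arc_flip: "{u, v} \<in> E \<Longrightarrow> (v, u) \<in> D \<longleftrightarrow> (u, v) \<notin> D"
  using arc_total arc_asym by blast

lemma finite_nb: "finite {z. {z, v} \<in> E}"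
proof -
  have "{z. {z, v} \<in> E} \<subseteq> \<Union> E" by auto
  moreover have "finite (\<Union> E)"
    using fin by (intro finite_Union) (metis card2 card.infinite zero_neq_numeral)+
  ultimately show ?thesis by (rule finite_subset)
qed

lemma finite_in: "finite {z. (z, v) \<in> D}"
  by (rule finite_subset[OF _ finite_nb[of v]]) (auto dest: arc_edge)

lemma lab_ge: "set zs \<subseteq> {z. (z, v) \<in> D} \<Longrightarrow> distinct zs \<Longrightarrow> length zs \<le> lab v"
  unfolding lab_def by (metis card_mono distinct_card finite_in)

text \<open>Once the known in-neighbours exhaust the in-degree, every other edge has to leave
  \<open>v\<close>.\<close>

lemma full_emits:
  assumes "set zs \<subseteq> {z. (z, v) \<in> D}" "distinct zs" "lab v \<le> length zs" "set zs \<subseteq> S"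
  shows "emits v S"
proof -
  have "set zs = {z. (z, v) \<in> D}"
    using assms card_seteq[OF finite_in assms(1)] by (simp add: lab_def distinct_card)
  then show ?thesis
    unfolding emits_def using arc_total assms(4) by blast
qed

lemma lab_nbs:
  assumes "nbs v zs"
  shows "lab v = (\<Sum>z\<leftarrow>zs. arc' z v)"
proof -
  have "{z. (z, v) \<in> D} = {z \<in> set zs. (z, v) \<in> D}"
    using assms arc_edge by (auto simp: nbs_def)
  then show ?thesis
    using assms by (simp add: lab_def nbs_def sum_list_distinct_conv_sum_set sum_of_bool_eq Int_def)
qed

lemma nbs_edge: "nbs v zs \<Longrightarrow> z \<in> set zs \<Longrightarrow> {z, v} \<in> E"
  by (auto simp: nbs_def)

lemma nbs_edge': "nbs v zs \<Longrightarrow> z \<in> set zs \<Longrightarrow> {v, z} \<in> E"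
  using nbs_edge by (simp add: insert_commute)

text \<open>The labels of \<open>x\<close>, \<open>y\<close>, \<open>z\<close> are pairwise distinct
  and at most 2, so they sum to 3. The three edges among these vertices already account for 3, hence
  the edge to \<open>u\<close> adds nothing to the label of \<open>x\<close>.\<close>

lemma triangle:
  assumes nbs: "nbs x [u, y, z]" "nbs y [x, z]" "nbs z [x, y]"
  shows "(x, u) \<in> D"
proof -
  have e: "{x, y} \<in> E" "{x, z} \<in> E" "{y, z} \<in> E" "{x, u} \<in> E"
    using nbs by (auto intro: nbs_edge nbs_edge')
  note l = nbs[THEN lab_nbs, simplified, unfolded e[THEN arc_flip], simplified]
  show ?thesis
    using e(1-3)[THEN lab_differ, unfolded l] lab_le2[of x, unfolded l]
    by (cases "(x, y) \<in> D"; cases "(x, z) \<in> D"; cases "(y, z) \<in> D"; cases "(x, u) \<in> D"; auto)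
qed

text \<open>A vertex that carries a bit, with label 2 for a set bit and label 1 for an unset one.
  Whatever the bit is, gadgets outside \<open>S\<close> receive an arc from it.\<close>

definition net :: "'a \<Rightarrow> 'a set \<Rightarrow> bool" where
  "net v S \<longleftrightarrow> lab v \<in> {1, 2} \<and> emits v S"

text \<open>Both vertices are entered once, so their labels are 1 and 2 in some order. The one with
  label 1 emits everything but its feeding edge, and so provides the second arc of the other
  one.\<close>

lemma net_pair:
  assumes "{u, v} \<in> E" "(x, u) \<in> D" "(y, v) \<in> D" "x \<noteq> v" "y \<noteq> u"
  shows "net u {x, v}" "net v {y, u}" "lab u + lab v = 3"
proof -
  have 1: "1 \<le> lab u" "1 \<le> lab v"
    using lab_ge[of "[x]" u] lab_ge[of "[y]" v] assms by auto
  then have "lab u = 1 \<and> lab v = 2 \<or> lab u = 2 \<and> lab v = 1"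
    using lab_le2[of u] lab_le2[of v] lab_differ[OF assms(1)] by linarith
  moreover have "emits u {x, v}" "emits v {y, u}" if "lab u = 1" "lab v = 2"
  proof -
    show "emits u {x, v}" by (rule full_emits[of "[x]"]) (use assms that in auto)
    have "(u, v) \<in> D"
      using full_emits[of "[x]" u "{x}"] assms that by (auto simp: emits_def)
    then show "emits v {y, u}"
      by (intro full_emits[of "[y, u]"]) (use assms that in auto)
  qed
  moreover have "emits u {x, v}" "emits v {y, u}" if "lab v = 1" "lab u = 2"
  proof -
    show "emits v {y, u}" by (rule full_emits[of "[y]"]) (use assms that in auto)
    have "(v, u) \<in> D"
      using full_emits[of "[y]" v "{y}"] assms that by (auto simp: emits_def insert_commute)
    then show "emits u {x, v}"
      by (intro full_emits[of "[x, v]"]) (use assms that in auto)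
  qed
  ultimately show "net u {x, v}" "net v {y, u}" "lab u + lab v = 3"
    by (auto simp: net_def)
qed

text \<open>A wire negates: \<open>m\<close> is entered from \<open>u\<close>, so its label is 1 or
  2 and different from that of \<open>u\<close>. If it is 2, the second arc comes from the pendant
  path \<open>i\<close>, \<open>j\<close>: an arc from \<open>m\<close> to \<open>i\<close> would
  give \<open>i\<close> and \<open>j\<close> the common label 1, or give \<open>i\<close> the label
  2 of its neighbour \<open>m\<close>.\<close>

lemma net_wire:
  assumes "net u S" "m \<notin> S" "{u, m} \<in> E" "nbs i [m, j]" "nbs j [i]" "u \<noteq> i"
  shows "net m {u, i}" "lab u + lab m = 3"
proof -
  have um: "(u, m) \<in> D" using assms by (auto simp: net_def emits_def)
  have mi: "{m, i} \<in> E" "{i, j} \<in> E" using assms nbs_edge by auto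
  have 1: "1 \<le> lab m" using lab_ge[of "[u]" m] um by auto
  have "lab u = 1 \<and> lab m = 2 \<or> lab u = 2 \<and> lab m = 1"
    using 1 lab_le2[of m] lab_differ[OF assms(3)] assms(1) by (auto simp: net_def)
  moreover have "(i, m) \<in> D" if "lab m = 2"
  proof -
    note l = assms(4,5)[THEN lab_nbs, simplified, unfolded mi[THEN arc_flip], simplified]
    show ?thesis
      using mi[THEN lab_differ, unfolded l] that mi[THEN arc_flip]
      by (cases "(m, i) \<in> D"; cases "(i, j) \<in> D"; auto)
  qed
  ultimately show "net m {u, i}" "lab u + lab m = 3"
    using um full_emits[of "[u]" m "{u, i}"] full_emits[of "[u, i]" m "{u, i}"] \<open>u \<noteq> i\<close>
    by (auto simp: net_def)
qed

lemma net_arc: "net u S \<Longrightarrow> v \<notin> S \<Longrightarrow> nbs v zs \<Longrightarrow> u \<in> set zs \<Longrightarrow> arc' u v = 1"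
  by (auto simp: net_def emits_def dest: nbs_edge)

lemma net_lab: "net u S \<Longrightarrow> lab u = 1 \<or> lab u = 2"
  by (auto simp: net_def)

text \<open>The leaf is entered by its only edge and has label 1, which leaves label 2 for
  \<open>u\<close>.\<close>

lemma gate_leaf:
  assumes "net u S" "l \<notin> S" "nbs l [u]"
  shows "lab u = 2"
  using net_arc[OF assms] net_lab[OF assms(1)] lab_nbs[OF assms(3)]
    lab_differ[OF nbs_edge[OF assms(3), of u]] by auto

text \<open>If both ends had label 2, then \<open>i\<close> and \<open>l\<close> would have label 1
  and pass the arc on. Now \<open>j\<close> and \<open>k\<close>, entered from outside next to a
  label 1, would both need label 2, but only one of them can be entered by the edge between
  them.\<close>

lemma gate_path:
  assumes n: "net u S" "net v T" and "i \<notin> S" "l \<notin> T"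
    and nbs: "nbs i [u, j]" "nbs j [i, k]" "nbs k [j, l]" "nbs l [k, v]"
  shows "lab u = 1 \<or> lab v = 1"
proof -
  have e: "{i, j} \<in> E" "{j, k} \<in> E" "{k, l} \<in> E" "{u, i} \<in> E" "{v, l} \<in> E"
    using nbs by (auto intro: nbs_edge nbs_edge')
  have in1: "(u, i) \<in> D" "(v, l) \<in> D"
    using assms e by (auto simp: net_def emits_def)
  note l = nbs[THEN lab_nbs, simplified, unfolded in1[THEN eqTrueI] e(1-3)[THEN arc_flip], simplified]
  show ?thesis
    using e[THEN lab_differ, unfolded l] n[THEN net_lab]
    by (cases "(i, j) \<in> D"; cases "(j, k) \<in> D"; cases "(k, l) \<in> D"; auto)
qed

text \<open>Being entered from \<open>u\<close>, the vertex \<open>p\<close> has the label among 1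
  and 2 that \<open>u\<close> does not have. For \<open>lab u = 2\<close> the arc is passed on to
  \<open>p'\<close>, which needs label 2 and so a further arc from \<open>r\<close>; for
  \<open>lab u = 1\<close> the vertex \<open>p\<close> needs an arc from \<open>p'\<close>, and only
  \<open>r\<close> can still enter \<open>p'\<close>.\<close>

lemma arm_plain:
  assumes "net u S" "p \<notin> S" and nbs: "nbs p [u, p']" "nbs p' [p, r]"
  shows "lab u = 1 \<and> lab p' = of_bool ((r, p') \<in> D) \<or> lab u = 2 \<and> lab p' = 2 \<and> (r, p') \<in> D"
proof -
  have e: "{p, p'} \<in> E" "{u, p} \<in> E"
    using nbs by (auto intro: nbs_edge nbs_edge')
  have in1: "(u, p) \<in> D"
    using assms e by (auto simp: net_def emits_def)
  note l = nbs[THEN lab_nbs, simplified, unfolded in1[THEN eqTrueI] e(1)[THEN arc_flip], simplified]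
  show ?thesis
    using e[THEN lab_differ, unfolded l] l net_lab[OF assms(1)]
    by (cases "(p, p') \<in> D"; cases "(r, p') \<in> D"; auto)
qed

text \<open>With \<open>lab v = 1\<close> the vertex \<open>s\<close> has label 2, and the leaf
  leaves \<open>s'\<close> only the labels 0 and 1 without an arc from \<open>r\<close>; hence this
  arm always enters \<open>r\<close>. With \<open>lab v = 2\<close> the label of \<open>s'\<close>
  is 2 in any case, so \<open>r\<close> has to avoid 2.\<close>

lemma arm_leaf:
  assumes "net v T" "s \<notin> T" and nbs: "nbs s [v, s']" "nbs s' [s, l, r]" "nbs l [s']"
  shows "lab v = 1 \<and> lab s' \<le> 1 \<and> (r, s') \<notin> D \<or> lab v = 2 \<and> lab s' = 2"
proof -
  have e: "{s, s'} \<in> E" "{s', l} \<in> E" "{v, s} \<in> E"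
    using nbs by (auto intro: nbs_edge nbs_edge')
  have in1: "(v, s) \<in> D"
    using assms e by (auto simp: net_def emits_def)
  note l = nbs[THEN lab_nbs, simplified, unfolded in1[THEN eqTrueI] e(1,2)[THEN arc_flip], simplified]
  show ?thesis
    using e[THEN lab_differ, unfolded l] l lab_le2[of s', unfolded l] net_lab[OF assms(1)]
    by (cases "(s, s') \<in> D"; cases "(s', l) \<in> D"; cases "(r, s') \<in> D"; auto)
qed

text \<open>With label 2 read as true this is a NOR gate. If \<open>lab w = 2\<close>, then
  \<open>q\<close> has label 1 and enters \<open>r\<close>, so \<open>r\<close> has label 2, which
  is impossible next to a label 2 on \<open>p'\<close> or \<open>s'\<close>. If
  \<open>lab w = 1\<close>, then \<open>q\<close> has label 2 and is entered from \<open>r\<close>;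
  with two inputs of label 1, \<open>r\<close> would be entered from \<open>s'\<close> and confined
  to label 1, so that \<open>p'\<close> would be entered from \<open>r\<close> and get label 1 as
  well.\<close>

lemma gate_and:
  assumes n: "net u S" "net v T" "net w U" and out: "p \<notin> S" "s \<notin> T" "q \<notin> U"
    and nbs: "nbs p [u, p']" "nbs p' [p, r]" "nbs s [v, s']" "nbs s' [s, l, r]" "nbs l [s']"
    "nbs r [p', s', q]" "nbs q [r, w]"
  shows "lab w = 2 \<longleftrightarrow> lab u = 1 \<and> lab v = 1"
proof -
  have e: "{r, p'} \<in> E" "{r, s'} \<in> E" "{r, q} \<in> E" "{w, q} \<in> E"
    using nbs by (auto intro: nbs_edge nbs_edge')
  have in1: "(w, q) \<in> D"
    using assms e by (auto simp: net_def emits_def)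
  note l = nbs(6,7)[THEN lab_nbs, simplified, unfolded in1[THEN eqTrueI] e(1-3)[THEN arc_flip], simplified]
  show ?thesis
    using e[THEN lab_differ, unfolded l] lab_le2[of r, unfolded l] net_lab[OF n(3)]
      arm_plain[OF n(1) out(1) nbs(1,2)] arm_leaf[OF n(2) out(2) nbs(3-5)]
    by (cases "(r, p') \<in> D"; cases "(r, s') \<in> D"; cases "(r, q) \<in> D"; auto)
qed

text \<open>The longer output arm makes the gate symmetric in \<open>u\<close> and \<open>w\<close>,
  both of which now have a plain arm, while \<open>v\<close> acts as a control: for
  \<open>lab v = 1\<close> the vertex \<open>r\<close> is entered from \<open>s'\<close>. If, say,
  \<open>lab u = 2\<close> and \<open>lab w = 1\<close>, then \<open>p'\<close> has label 2, so
  \<open>r\<close> has label 1 and enters \<open>q\<close>, whose label becomes 1, too.\<close>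

lemma gate_if:
  assumes n: "net u S" "net v T" "net w U" and out: "p \<notin> S" "s \<notin> T" "t \<notin> U"
    and nbs: "nbs p [u, p']" "nbs p' [p, r]" "nbs s [v, s']" "nbs s' [s, l, r]" "nbs l [s']"
    "nbs r [p', s', q]" "nbs q [r, t]" "nbs t [q, w]"
  shows "lab v = 1 \<Longrightarrow> lab u = lab w"
proof -
  have e: "{r, p'} \<in> E" "{r, s'} \<in> E" "{r, q} \<in> E" "{q, t} \<in> E" "{w, t} \<in> E"
    using nbs by (auto intro: nbs_edge nbs_edge')
  have in1: "(w, t) \<in> D"
    using assms e by (auto simp: net_def emits_def)
  note l = nbs(6-8)[THEN lab_nbs, simplified, unfolded in1[THEN eqTrueI] e(1-4)[THEN arc_flip], simplified]
  show "lab v = 1 \<Longrightarrow> lab u = lab w"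
    using e[THEN lab_differ, unfolded l] lab_le2[of r, unfolded l] net_lab[OF n(3)]
      arm_plain[OF n(1) out(1) nbs(1,2)] arm_leaf[OF n(2) out(2) nbs(3-5)]
    by (cases "(r, p') \<in> D"; cases "(r, s') \<in> D"; cases "(r, q) \<in> D"; cases "(q, t) \<in> D"; auto)
qed

end

section \<open>The cells\<close>

text \<open>The code \<open>10 * i + j\<close> stands for row \<open>i\<close> and column \<open>j\<close> of a cell with 9 rows and
  9 columns; \<open>i = 9\<close> or \<open>j = 9\<close> points into the cell below or to the right.\<close>

type_synonym spot = int

text \<open>\<open>a_edges\<close> and \<open>b_edges\<close> carry the bits of the row and of the column; \<open>x_edges\<close>
  are the gates that let them cross, \<open>y_edges\<close> those that join them. A direction 1 means that the edge is
  oriented as listed. Layouts and directions were found by computer search.\<close>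

definition a_edges :: "(spot \<times> spot) list" where
  "a_edges =
   [(50,60), (50,51), (51,61), (61,62), (62,51), (60,71),
   (71,72), (72,82), (82,71), (70,60), (40,50), (70,81),
   (81,80), (40,30), (30,20)]"

definition b_edges :: "(spot \<times> spot) list" where
  "b_edges =
   [(6,5), (6,17), (17,28), (28,27), (27,17), (5,4),
   (4,3), (3,14), (14,4), (15,5), (7,6), (15,16),
   (16,26), (7,18), (18,8)]"

definition x_edges :: "(spot \<times> spot) list" where
  "x_edges =
   [(54,65), (54,44), (44,33), (33,34), (34,44), (65,55),
   (55,56), (56,45), (45,55), (31,21), (21,22), (23,12),
   (12,1), (12,22), (22,32), (32,43), (66,67), (67,57),
   (35,46), (46,47), (46,57), (57,58), (58,48), (68,78),
   (78,77), (86,87), (87,88), (87,77), (77,76), (76,75),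
   (64,74), (74,73), (85,84), (84,83), (84,73), (73,63),
   (63,52), (41,40), (25,15), (24,25), (23,24), (31,41),
   (43,54), (35,25), (66,65), (48,59), (86,96), (68,69),
   (75,65), (85,95), (64,65), (52,41), (41,42), (42,53),
   (25,36), (36,37), (24,13), (13,2)]"

definition y_edges :: "(spot \<times> spot) list" where
  "y_edges =
   [(85,75), (75,64), (44,54), (54,65), (54,64), (64,53),
   (86,76), (76,66), (68,67), (67,57), (67,66), (66,56),
   (78,88), (88,77), (77,87), (41,40), (42,41), (43,42),
   (25,15), (35,25), (34,35), (45,34), (53,43), (56,45),
   (85,95), (44,45), (86,97), (68,79), (78,79), (87,97),
   (41,31), (31,21), (42,52), (52,63), (43,32), (32,33),
   (25,36), (36,37), (35,24), (24,13), (34,23), (23,22),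
   (45,46), (46,47)]"

fun a_dirs :: "bool \<Rightarrow> nat list" where
  "a_dirs False = [1,0,0,0,1,0,0,1,0,0,0,1,0,0,0]"
| "a_dirs True = [0,0,1,1,0,0,0,0,1,0,0,0,0,1,0]"

fun b_dirs :: "bool \<Rightarrow> nat list" where
  "b_dirs False = [1,0,0,0,1,0,0,1,0,0,0,1,0,0,0]"
| "b_dirs True = [0,0,1,1,0,0,0,0,1,0,0,0,0,1,0]"

fun x_dirs :: "bool \<Rightarrow> bool \<Rightarrow> nat list" where
  "x_dirs False False =
    [1,0,0,0,1,0,1,0,1,0,1,0,1,1,1,1,1,0,1,1,0,1,1,1,0,0,1,1,1,0,1,0,1,1,0,1,1,0,0,0,0,0,0,0,0,0,0,0,0,0,0,0,1,0,0,0,1,0]"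
| "x_dirs False True =
    [0,0,0,1,0,0,0,0,1,0,0,1,1,0,1,0,0,0,0,1,1,0,1,1,0,1,1,0,0,1,0,0,0,1,1,0,1,0,0,0,0,0,0,0,0,0,0,0,0,0,0,0,1,0,1,0,0,0]"
| "x_dirs True False =
    [0,0,0,1,0,0,0,0,1,1,0,0,1,1,1,0,0,1,1,1,0,1,0,0,1,0,1,1,1,1,0,1,1,1,0,1,0,0,0,0,0,0,0,0,0,0,0,0,0,0,0,0,0,0,0,0,1,0]"
| "x_dirs True True =
    [1,0,0,0,1,0,1,0,1,1,0,1,1,0,0,1,1,0,0,1,1,1,0,0,0,1,1,0,1,0,1,0,0,1,1,1,0,0,0,0,0,0,0,0,0,0,0,0,0,0,0,0,0,0,1,0,0,0]"

text \<open>Two set bits are what a joining cell excludes, so there is no orientation to list; the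
  empty list is a placeholder.\<close>

fun y_dirs :: "bool \<Rightarrow> bool \<Rightarrow> nat list" where
  "y_dirs False False =
    [1,0,0,1,1,1,1,0,0,1,1,1,0,1,0,0,0,0,0,0,0,0,0,0,0,0,0,0,0,0,1,0,0,0,1,0,0,0,1,0,0,0,1,0]"
| "y_dirs False True =
    [0,0,1,1,0,1,0,0,0,1,1,0,0,0,1,0,0,0,0,0,0,0,0,0,0,0,0,0,0,0,1,0,0,0,1,0,1,0,0,0,1,0,0,0]"
| "y_dirs True False =
    [0,0,0,1,1,0,0,0,1,1,0,1,1,0,1,0,0,0,0,0,0,0,0,0,0,0,0,0,0,0,0,0,1,0,0,0,0,0,1,0,0,0,1,0]"
| "y_dirs True True = []"

text \<open>\<open>Cross\<close> and \<open>Join\<close> stand for the entries 0 and 1 of the cover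
  matrix. \<open>Top\<close>, \<open>Bottom\<close> and \<open>End\<close> close the columns and
  rows, and \<open>Void\<close> fills the two remaining corners.\<close>

datatype kind = Cross | Join | Top | Bottom | End | Void

fun cell_edges :: "kind \<Rightarrow> (spot \<times> spot) list" where
  "cell_edges Cross = a_edges @ b_edges @ x_edges"
| "cell_edges Join = a_edges @ b_edges @ y_edges"
| "cell_edges Top = [(97,86)]"
| "cell_edges Bottom = b_edges @ [(15,25)]"
| "cell_edges End = a_edges"
| "cell_edges Void = []"

fun cell_dirs :: "kind \<Rightarrow> bool \<Rightarrow> bool \<Rightarrow> nat list" where
  "cell_dirs Cross a b = a_dirs a @ b_dirs b @ x_dirs a b"
| "cell_dirs Join a b = a_dirs a @ b_dirs b @ y_dirs a b"
| "cell_dirs Top a b = [1]"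
| "cell_dirs Bottom a b = b_dirs b @ [1]"
| "cell_dirs End a b = a_dirs a"
| "cell_dirs Void a b = []"

definition turn :: "spot \<times> spot \<Rightarrow> nat \<Rightarrow> spot \<times> spot" where
  "turn e d = (if d = 1 then e else (snd e, fst e))"

definition cell_arcs :: "kind \<Rightarrow> bool \<Rightarrow> bool \<Rightarrow> (spot \<times> spot) list" where
  "cell_arcs k a b = map2 turn (cell_edges k) (cell_dirs k a b)"

text \<open>The leaf of a bottom cell hangs at a vertex of in-weight 1 when \<open>b\<close> is false; the weight
  of its edge is then 2.\<close>

definition arc_weight :: "kind \<Rightarrow> bool \<Rightarrow> spot \<times> spot \<Rightarrow> nat" where
  "arc_weight k b e = (if k = Bottom \<and> \<not> b \<and> e = (15, 25) then 2 else 1)"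

definition label_in :: "(spot \<times> spot \<Rightarrow> nat) \<Rightarrow> (spot \<times> spot) list \<Rightarrow> spot \<Rightarrow> nat" where
  "label_in f es p = sum_list (map f (filter (\<lambda>e. snd e = p) es))"

definition inbox :: "spot \<Rightarrow> bool" where
  "inbox p \<longleftrightarrow> p mod 10 < 9 \<and> p div 10 < 9 \<and> 0 \<le> p"

text \<open>Labels of the vertices of the networks for \<open>a\<close> (first column of a cell) and \<open>b\<close>
  (first row) at which gates of neighbouring cells are attached.\<close>

definition a_labels :: "bool \<Rightarrow> (spot \<times> nat) list" where
  "a_labels a = [(50, 1 + of_bool a), (60, 2 - of_bool a), (70, 1 + of_bool a)]"

definition b_labels :: "bool \<Rightarrow> (spot \<times> nat) list" where
  "b_labels b = [(5, 2 - of_bool b), (6, 1 + of_bool b), (7, 2 - of_bool b)]"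

definition outer_labels :: "bool \<Rightarrow> bool \<Rightarrow> (spot \<times> nat) list" where
  "outer_labels a b = map (\<lambda>(p, l). (p + 9, l)) (a_labels a) @ map (\<lambda>(p, l). (p + 90, l)) (b_labels b)"

text \<open>Every arc has to end inside the cell, also on the edges that leave it. In this way the
  label of a vertex depends on the arcs of its own cell only, and other cells matter just through
  the table \<open>ls\<close> of labels of tails outside.\<close>

definition good_arcs ::
    "(spot \<times> spot \<Rightarrow> nat) \<Rightarrow> (spot \<times> spot) list \<Rightarrow> (spot \<times> nat) list \<Rightarrow> bool" where
  "good_arcs f es ls \<longleftrightarrow>
     list_all (\<lambda>(p, q). inbox q \<and>
       (let l = label_in f es q in l \<le> 2 \<and>
         (if inbox p then label_in f es p \<noteq> l
          else map_of ls p \<noteq> None \<and> map_of ls p \<noteq> Some l))) es"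

definition net_labels :: "(spot \<times> spot \<Rightarrow> nat) \<Rightarrow> (spot \<times> spot) list \<Rightarrow> (spot \<times> nat) list \<Rightarrow> bool" where
  "net_labels f es ls \<longleftrightarrow> list_all (\<lambda>(p, l). label_in f es p = l) ls"

text \<open>\<open>a'\<close> is the row bit in the right neighbour and \<open>b'\<close> the column
  bit in the lower neighbour.\<close>

definition good_cell :: "kind \<Rightarrow> bool \<Rightarrow> bool \<Rightarrow> bool \<Rightarrow> bool \<Rightarrow> bool" where
  "good_cell k a b a' b' \<longleftrightarrow> good_arcs (arc_weight k b) (cell_arcs k a b) (outer_labels a' b')"

section \<open>Finite verification of the cells\<close>

abbreviation (input) bools :: "bool list" where
  "bools \<equiv> [False, True]"

lemma bool_all: "list_all P bools \<Longrightarrow> P a"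
  by (cases a) auto

lemma bool_all2: "list_all (\<lambda>a. list_all (P a) bools) bools \<Longrightarrow> P a b"
  using bool_all[of "P a" b] bool_all[of "\<lambda>a. list_all (P a) bools" a] by simp

lemma good_Cross: "good_cell Cross a b a b"
  by (rule bool_all2[where P = "\<lambda>a b. good_cell Cross a b a b"]) code_simp

lemma good_Join: "\<not> (a \<and> b) \<Longrightarrow> good_cell Join a b a (a \<or> b)"
proof -
  have "a \<and> b \<or> good_cell Join a b a (a \<or> b)"
    by (rule bool_all2[where P = "\<lambda>a b. a \<and> b \<or> good_cell Join a b a (a \<or> b)"]) code_simp
  then show "\<not> (a \<and> b) \<Longrightarrow> ?thesis" by blast
qed

text \<open>The leaf has label 1, and vertex 7 of the column network below has label 2 when its bit
  is unset.\<close>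

lemma good_Top: "good_cell Top a b a' False"
proof -
  have "cell_arcs Top a b = [(97, 86)]" "arc_weight Top b = (\<lambda>_. 1)"
    by (auto simp: cell_arcs_def turn_def arc_weight_def fun_eq_iff)
  then show ?thesis
    by (simp add: good_cell_def good_arcs_def inbox_def label_in_def outer_labels_def a_labels_def
        b_labels_def)
qed

text \<open>The unset bit is acceptable here because the leaf then has in-weight 2 next to a vertex
  of label 1.\<close>

lemma good_Bottom: "good_cell Bottom a b a' b'"
proof -
  \<comment> \<open>The empty table makes the check independent of \<open>a'\<close> and
    \<open>b'\<close>; it carries over since all tails lie inside the cell.\<close>
  have "good_arcs (arc_weight Bottom b) (map2 turn (cell_edges Bottom) (b_dirs b @ [1])) []"
    by (rule bool_all[where a = b]) code_simp
  then have *: "good_arcs (arc_weight Bottom b) (cell_arcs Bottom a b) []"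
    by (simp add: cell_arcs_def)
  have "list_all (\<lambda>(p, q). inbox p) (map2 turn (cell_edges Bottom) (b_dirs b @ [1]))"
    by (rule bool_all[where a = b]) code_simp
  with * show ?thesis
    by (auto simp: good_cell_def good_arcs_def cell_arcs_def list_all_iff Let_def split: prod.splits)
qed

lemma good_End: "good_cell End a b a' b'"
proof -
  have "good_arcs (\<lambda>_. 1) (map2 turn (cell_edges End) (a_dirs a)) []"
    by (rule bool_all[where a = a]) code_simp
  moreover have "arc_weight End b = (\<lambda>_. 1)" by (auto simp: arc_weight_def)
  ultimately have *: "good_arcs (arc_weight End b) (cell_arcs End a b) []"
    by (simp add: cell_arcs_def)
  have "list_all (\<lambda>(p, q). inbox p) (map2 turn (cell_edges End) (a_dirs a))"
    by (rule bool_all[where a = a]) code_simp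
  with * show ?thesis
    by (auto simp: good_cell_def good_arcs_def cell_arcs_def list_all_iff Let_def split: prod.splits)
qed

lemma good_Void: "good_cell Void a b a' b'"
  by (simp add: good_cell_def good_arcs_def cell_arcs_def)

lemma net_labels_Cross:
  "net_labels (arc_weight Cross b) (cell_arcs Cross a b) (a_labels a @ b_labels b)"
  by (rule bool_all2[where P = "\<lambda>a b. net_labels (arc_weight Cross b) (cell_arcs Cross a b)
    (a_labels a @ b_labels b)"]) code_simp

lemma net_labels_Join:
  "\<not> (a \<and> b) \<Longrightarrow> net_labels (arc_weight Join b) (cell_arcs Join a b) (a_labels a @ b_labels b)"
proof -
  have "a \<and> b \<or> net_labels (arc_weight Join b) (cell_arcs Join a b) (a_labels a @ b_labels b)"
    by (rule bool_all2[where P = "\<lambda>a b. a \<and> b \<or> net_labels (arc_weight Join b)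
      (cell_arcs Join a b) (a_labels a @ b_labels b)"]) code_simp
  then show "\<not> (a \<and> b) \<Longrightarrow> ?thesis" by blast
qed

lemma net_labels_Bottom: "net_labels (arc_weight Bottom b) (cell_arcs Bottom a b) (b_labels b)"
  by (rule bool_all2[where P = "\<lambda>a b. net_labels (arc_weight Bottom b) (cell_arcs Bottom a b)
    (b_labels b)"]) code_simp

lemma net_labels_End: "net_labels (arc_weight End b) (cell_arcs End a b) (a_labels a)"
  by (rule bool_all2[where P = "\<lambda>a b. net_labels (arc_weight End b) (cell_arcs End a b)
    (a_labels a)"]) code_simp

definition simple_edges :: "(spot \<times> spot) list \<Rightarrow> bool" where
  "simple_edges es \<longleftrightarrow> distinct es \<and> list_all (\<lambda>(p, q). (q, p) \<notin> set es \<and> p \<noteq> q) es"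

text \<open>Differences 1, 10 and 11 of codes are the three directions of the triangular lattice.
  The six codes outside the box denote network vertices of the right and the lower
  neighbour.\<close>

definition lattice_edge :: "spot \<times> spot \<Rightarrow> bool" where
  "lattice_edge e \<longleftrightarrow> (let (p, q) = e in abs (q - p) \<in> {1, 10, 11} \<and>
     (inbox p \<and> (inbox q \<or> q \<in> {59, 69, 79, 95, 96, 97}) \<or>
      inbox q \<and> p \<in> {59, 69, 79, 95, 96, 97}))"

abbreviation (input) kinds :: "kind list" where
  "kinds \<equiv> [Cross, Join, Top, Bottom, End, Void]"

lemma kind_all: "list_all P kinds \<Longrightarrow> P k"
  by (cases k) auto

lemma simple_cell: "simple_edges (cell_edges k)"
  by (rule kind_all[where P = "\<lambda>k. simple_edges (cell_edges k)"]) code_simp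

lemma lattice_cell: "list_all lattice_edge (cell_edges k)"
  by (rule kind_all[where P = "\<lambda>k. list_all lattice_edge (cell_edges k)"]) code_simp

lemma inner_cells: "k \<in> {Bottom, End} \<Longrightarrow> list_all (\<lambda>(p, q). inbox p \<and> inbox q) (cell_edges k)"
proof -
  have "k \<notin> set [Bottom, End] \<or> list_all (\<lambda>(p, q). inbox p \<and> inbox q) (cell_edges k)"
    by (rule kind_all[where P = "\<lambda>k. k \<notin> set [Bottom, End] \<or>
      list_all (\<lambda>(p, q). inbox p \<and> inbox q) (cell_edges k)"]) code_simp
  then show "k \<in> {Bottom, End} \<Longrightarrow> ?thesis" by auto
qed

lemma length_dirs: "\<not> (k = Join \<and> a \<and> b) \<Longrightarrow> length (cell_dirs k a b) = length (cell_edges k)"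
  by (cases k; cases a; cases b) (simp_all add: a_edges_def b_edges_def x_edges_def y_edges_def)

section \<open>Subgraphs of the triangular lattice are planar\<close>

text \<open>The square lattice with one family of diagonals, an affine image of the triangular
  lattice.\<close>

definition lattice_point :: "int \<times> int \<Rightarrow> complex" where
  "lattice_point x = Complex (of_int (fst x)) (of_int (snd x))"

text \<open>An inner point of a lattice edge determines this edge: rounding down gives the lower
  left end, and the set of non-integral coordinates gives the direction.\<close>

lemma lattice_segment:
  assumes "z \<in> closed_segment (lattice_point x) (lattice_point y)"
    and "y - x \<in> {(1, 0), (0, 1), (1, 1)}"
    and "z \<noteq> lattice_point x" "z \<noteq> lattice_point y"
  shows "x = (\<lfloor>Re z\<rfloor>, \<lfloor>Im z\<rfloor>)"
    and "y - x = (of_bool (Re z \<notin> \<int>), of_bool (Im z \<notin> \<int>))"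
    and "z \<notin> range lattice_point"
proof -
  obtain u where u: "0 \<le> u" "u \<le> 1" "z = (1 - u) *\<^sub>R lattice_point x + u *\<^sub>R lattice_point y"
    using assms(1) by (auto simp: in_segment)
  obtain a b where x: "x = (a, b)" by (cases x)
  obtain d e where y: "y = (a + d, b + e)" "(d, e) = y - x"
    using x by (cases y) (metis add_diff_cancel_left' diff_Pair diff_add_cancel add.commute)
  have re: "Re z = of_int a + u * of_int d" and im: "Im z = of_int b + u * of_int e"
    by (auto simp: u(3) lattice_point_def x y(1) algebra_simps)
  have u01: "0 < u" "u < 1"
    using assms(3,4) u by (auto simp: order.order_iff_strict)
  have int: "of_int k + u \<notin> \<int>" for k
  proof
    assume "of_int k + u \<in> \<int>"
    then have "u \<in> \<int>" by (metis Ints_diff Ints_of_int add_diff_cancel_left')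
    then show False using u01 by (auto elim!: Ints_cases)
  qed
  have fl: "\<lfloor>of_int k + u\<rfloor> = k" for k using u01 by linarith
  have "(d, e) \<in> {(1, 0), (0, 1), (1, 1)}" using assms(2) y(2) by simp
  then have "x = (\<lfloor>Re z\<rfloor>, \<lfloor>Im z\<rfloor>) \<and> (d, e) = (of_bool (Re z \<notin> \<int>), of_bool (Im z \<notin> \<int>))"
    using int[of a] int[of b] fl[of a] fl[of b] unfolding re im x by (elim insertE emptyE) simp_all
  then show "x = (\<lfloor>Re z\<rfloor>, \<lfloor>Im z\<rfloor>)"
    and 2: "y - x = (of_bool (Re z \<notin> \<int>), of_bool (Im z \<notin> \<int>))"
    unfolding y(2)[symmetric] by blast+
  show "z \<notin> range lattice_point"
  proof
    assume "z \<in> range lattice_point"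
    then have "Re z \<in> \<int>" "Im z \<in> \<int>" by (auto simp: lattice_point_def)
    then show False using 2 assms(2) by auto
  qed
qed

lemma inj_lattice_point: "inj lattice_point"
  by (auto simp: inj_on_def lattice_point_def)

text \<open>Straight segments are a drawing: two edges with a common point that is not a lattice
  point coincide, and a lattice point on an edge is one of its ends.\<close>

lemma planar_lattice:
  fixes f :: "'a \<Rightarrow> int \<times> int"
  assumes inj: "inj_on f V"
    and edges: "\<And>e. e \<in> E \<Longrightarrow> \<exists>u\<in>V. \<exists>v\<in>V. e = {u, v} \<and> f v - f u \<in> {(1, 0), (0, 1), (1, 1)}"
  shows "planar V E"
proof -
  \<comment> \<open>Each edge is listed from its lower left end, as the choice of three directions
    out of six requires.\<close>
  define ends where "ends e = (SOME uv. fst uv \<in> V \<and> snd uv \<in> V \<and> e = {fst uv, snd uv} \<and>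
    f (snd uv) - f (fst uv) \<in> {(1, 0), (0, 1), (1, 1)})" for e
  have ends: "fst (ends e) \<in> V \<and> snd (ends e) \<in> V \<and> e = {fst (ends e), snd (ends e)} \<and>
    f (snd (ends e)) - f (fst (ends e)) \<in> {(1, 0), (0, 1), (1, 1)}" if "e \<in> E" for e
    unfolding ends_def by (rule someI_ex) (use edges[OF that] in auto)
  define g where "g v = lattice_point (f v)" for v
  define crv where "crv e = linepath (g (fst (ends e))) (g (snd (ends e)))" for e
  have injg: "inj_on g V"
    by (intro inj_onI) (simp add: g_def inj_eq[OF inj_lattice_point] inj_on_eq_iff[OF inj])
  have img: "path_image (crv e) = closed_segment (g (fst (ends e))) (g (snd (ends e)))" for e
    by (simp add: crv_def)
  have eV: "fst (ends e) \<in> V" "snd (ends e) \<in> V"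
    and ed: "f (snd (ends e)) - f (fst (ends e)) \<in> {(1, 0), (0, 1), (1, 1)}" if "e \<in> E" for e
    using ends[OF that] by blast+
  have eq: "{fst (ends e), snd (ends e)} = e" if "e \<in> E" for e
    using ends[OF that] by blast
  have ge: "g ` e = {g (fst (ends e)), g (snd (ends e))}" if "e \<in> E" for e
    using arg_cong[OF eq[OF that], of "image g"] by simp
  have sub: "e \<subseteq> V" if "e \<in> E" for e
  proof -
    have "{fst (ends e), snd (ends e)} \<subseteq> V" using eV[OF that] by simp
    then show ?thesis unfolding eq[OF that] .
  qed
  have inner: "z \<in> g ` e" if "e \<in> E" "z \<in> path_image (crv e)" "z \<in> range lattice_point" for e z
    using lattice_segment(3)[of z "f (fst (ends e))" "f (snd (ends e))"] that ed[OF that(1)]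
    unfolding img ge[OF that(1)] g_def by blast
  have 1: "arc (crv e) \<and> {pathstart (crv e), pathfinish (crv e)} = g ` e \<and>
      path_image (crv e) \<inter> g ` V = g ` e" if e: "e \<in> E" for e
  proof (intro conjI)
    have "f (fst (ends e)) \<noteq> f (snd (ends e))" using ed[OF e] by (auto simp: zero_prod_def)
    then have "g (fst (ends e)) \<noteq> g (snd (ends e))"
      by (simp add: g_def inj_eq[OF inj_lattice_point])
    then show "arc (crv e)" by (simp add: crv_def)
    show "{pathstart (crv e), pathfinish (crv e)} = g ` e"
      by (simp add: crv_def ge[OF e])
    show "path_image (crv e) \<inter> g ` V = g ` e"
    proof
      show "path_image (crv e) \<inter> g ` V \<subseteq> g ` e" using inner[OF e] by (auto simp: g_def)
      have "g ` e \<subseteq> path_image (crv e)" by (simp add: img ge[OF e])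
      then show "g ` e \<subseteq> path_image (crv e) \<inter> g ` V" using sub[OF e] by blast
    qed
  qed
  have 2: "path_image (crv e) \<inter> path_image (crv e') \<subseteq> g ` (e \<inter> e')"
    if e: "e \<in> E" "e' \<in> E" "e \<noteq> e'" for e e'
  proof
    fix z assume z: "z \<in> path_image (crv e) \<inter> path_image (crv e')"
    have "z \<in> range lattice_point"
    proof (rule ccontr)
      assume n: "z \<notin> range lattice_point"
      have *: "f (fst (ends e)) = (\<lfloor>Re z\<rfloor>, \<lfloor>Im z\<rfloor>) \<and> f (snd (ends e)) =
          (\<lfloor>Re z\<rfloor>, \<lfloor>Im z\<rfloor>) + (of_bool (Re z \<notin> \<int>), of_bool (Im z \<notin> \<int>))"
        if "e \<in> E" "z \<in> path_image (crv e)" for e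
      proof -
        have "z \<noteq> lattice_point (f (fst (ends e)))" "z \<noteq> lattice_point (f (snd (ends e)))"
          using n by auto
        note ls = lattice_segment(1,2)[of z "f (fst (ends e))" "f (snd (ends e))", OF _ _ this]
        have z: "z \<in> closed_segment (lattice_point (f (fst (ends e)))) (lattice_point (f (snd (ends e))))"
          using that(2) by (simp add: img g_def)
        have d: "f (snd (ends e)) - f (fst (ends e)) \<in> {(1, 0), (0, 1), (1, 1)}"
          using ed[OF that(1)] .
        show ?thesis
          unfolding ls(1)[OF z d, symmetric] ls(2)[OF z d, symmetric] by simp
      qed
      have "f (fst (ends e)) = f (fst (ends e'))" "f (snd (ends e)) = f (snd (ends e'))"
        using *[OF e(1)] *[OF e(2)] z by simp_all
      then have "fst (ends e) = fst (ends e')" "snd (ends e) = snd (ends e')"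
        using inj_onD[OF inj] eV[OF e(1)] eV[OF e(2)] by blast+
      moreover have "e = {fst (ends e), snd (ends e)}" "e' = {fst (ends e'), snd (ends e')}"
        using eq[OF e(1)] eq[OF e(2)] by auto
      ultimately show False using e(3) by metis
    qed
    then have "z \<in> g ` e" "z \<in> g ` e'" using inner e z by auto
    then show "z \<in> g ` (e \<inter> e')"
      using inj_on_image_Int[OF injg sub[OF e(1)] sub[OF e(2)]] by auto
  qed
  show ?thesis unfolding planar_def using injg 1 2 by blast
qed

section \<open>The grid of cells\<close>

lemma inbox_ports: "p \<in> {50, 60, 70, 5, 6, 7} \<Longrightarrow> inbox p"
  by (auto simp: inbox_def)

lemma row_col_eq:
  assumes "y < w" "y' < w"
  shows "x * w + y = x' * w + y' \<longleftrightarrow> x = x' \<and> y = (y' :: nat)"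
proof
  assume *: "x * w + y = x' * w + y'"
  have "(x * w + y) div w = x" "(x' * w + y') div w = x'" using assms by auto
  then have "x = x'" using * by metis
  then show "x = x' \<and> y = y'" using * by simp
qed simp

definition outer :: "spot set" where
  "outer = {59, 69, 79, 95, 96, 97}"

locale grid =
  fixes R C :: nat and M :: "nat \<Rightarrow> nat \<Rightarrow> bool"
begin

definition width :: nat where "width = 9 * (C + 1)"

definition height :: nat where "height = 9 * (R + 2)"

text \<open>The points of a \<open>height\<close> by \<open>width\<close> rectangle are numbered row
  by row. A digit 9 in a code leads to the first row or column of the next cell, and this is how
  neighbouring cells share vertices.\<close>

definition pos :: "nat \<Rightarrow> nat \<Rightarrow> spot \<Rightarrow> nat" where
  "pos r c p = (9 * r + nat (p div 10)) * width + (9 * c + nat (p mod 10))"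

text \<open>Row 0 of the grid is taken by the \<open>Top\<close> cells, so row \<open>r - 1\<close>
  of the matrix lies in row \<open>r\<close> of the grid.\<close>

definition kd :: "nat \<Rightarrow> nat \<Rightarrow> kind" where
  "kd r c = (if c < C then
       (if r = 0 then Top else if r \<le> R then (if M (r - 1) c then Join else Cross)
        else if r = Suc R then Bottom else Void)
     else if c = C \<and> 0 < r \<and> r \<le> R then End else Void)"

definition edges :: "nat set set" where
  "edges = {{pos r c p, pos r c q} | r c p q.
     r < R + 2 \<and> c < C + 1 \<and> (p, q) \<in> set (cell_edges (kd r c))}"

lemma pos_eq:
  assumes "inbox p" "inbox q" "c \<le> C" "c' \<le> C"
  shows "pos r c p = pos r' c' q \<longleftrightarrow> r = r' \<and> c = c' \<and> p = q"
proof -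
  have b: "nat (p mod 10) < 9" "nat (q mod 10) < 9" "nat (p div 10) < 9" "nat (q div 10) < 9"
    using assms by (auto simp: inbox_def)
  have w: "9 * c + x < width" if "c \<le> C" "x < 9" for c x
    using that by (simp add: width_def)
  note w[OF assms(3) b(1)] w[OF assms(4) b(2)]
  then have "pos r c p = pos r' c' q \<longleftrightarrow> r * 9 + nat (p div 10) = r' * 9 + nat (q div 10) \<and>
      c * 9 + nat (p mod 10) = c' * 9 + nat (q mod 10)"
    unfolding pos_def by (simp add: row_col_eq mult.commute[of 9])
  also have "\<dots> \<longleftrightarrow> (r = r' \<and> c = c') \<and> nat (p div 10) = nat (q div 10) \<and> nat (p mod 10) = nat (q mod 10)"
    unfolding row_col_eq[OF b(1,2)] row_col_eq[OF b(3,4)] by blast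
  also have "nat (p div 10) = nat (q div 10) \<and> nat (p mod 10) = nat (q mod 10) \<longleftrightarrow> p = q"
  proof
    assume "nat (p div 10) = nat (q div 10) \<and> nat (p mod 10) = nat (q mod 10)"
    moreover have "0 \<le> p div 10" "0 \<le> q div 10"
      using assms(1,2) by (simp_all add: inbox_def pos_imp_zdiv_nonneg_iff)
    ultimately have "p div 10 = q div 10" "p mod 10 = q mod 10"
      by (simp_all only: eq_nat_nat_iff pos_mod_sign[of 10] zero_less_numeral)
    then show "p = q" by (metis div_mult_mod_eq)
  qed simp
  also have "(r = r' \<and> c = c') \<and> p = q \<longleftrightarrow> r = r' \<and> c = c' \<and> p = q" by blast
  finally show ?thesis .
qed

lemma pos_right: "p \<in> {59, 69, 79} \<Longrightarrow> pos r c p = pos r (Suc c) (p - 9)"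
  by (auto simp: pos_def)

lemma pos_below: "p \<in> {95, 96, 97} \<Longrightarrow> pos r c p = pos (Suc r) c (p - 90)"
  by (auto simp: pos_def)

lemma pos_less: "inbox p \<Longrightarrow> r < R + 2 \<Longrightarrow> c < C + 1 \<Longrightarrow> pos r c p < height * width"
proof -
  assume a: "inbox p" "r < R + 2" "c < C + 1"
  let ?x = "9 * r + nat (p div 10)" and ?y = "9 * c + nat (p mod 10)"
  have b: "nat (p mod 10) < 9" "nat (p div 10) < 9" using a(1) by (auto simp: inbox_def)
  have w: "9 * c + x < 9 * C'" if "c < C'" "x < 9" for c x C' :: nat
    using that by simp
  have "?x < height" unfolding height_def by (rule w[OF a(2) b(2)])
  have "?y < width" unfolding width_def by (rule w[OF a(3) b(1)])
  then have "?x * width + ?y < Suc ?x * width" by simp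
  also have "\<dots> \<le> height * width" using \<open>?x < height\<close> by (intro mult_right_mono) auto
  finally show ?thesis by (simp add: pos_def)
qed

lemma edge_spots:
  assumes "(p, q) \<in> set (cell_edges k)"
  shows "p \<noteq> q" "inbox p \<or> inbox q" "inbox p \<or> p \<in> outer" "inbox q \<or> q \<in> outer"
    "\<bar>q - p\<bar> \<in> {1, 10, 11}"
proof -
  have "lattice_edge (p, q)"
    using lattice_cell[of k] assms by (auto simp: list_all_iff)
  then show "p \<noteq> q" "inbox p \<or> inbox q" "inbox p \<or> p \<in> outer" "inbox q \<or> q \<in> outer"
    "\<bar>q - p\<bar> \<in> {1, 10, 11}"
    unfolding lattice_edge_def outer_def Let_def prod.case by auto
qed

lemma outer_not_inbox: "p \<in> outer \<Longrightarrow> \<not> inbox p"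
  by (auto simp: outer_def inbox_def)

lemma outer_edge:
  assumes "(p, q) \<in> set (cell_edges (kd r c))" "p \<in> outer \<or> q \<in> outer"
  shows "c < C" "r \<le> R"
proof -
  have "inbox p \<and> inbox q" if "kd r c \<in> {Bottom, End}"
    using inner_cells[OF that] assms(1) by (auto simp: list_all_iff)
  then have "kd r c \<notin> {Bottom, End}" using outer_not_inbox assms(2) by blast
  moreover have "kd r c \<noteq> Void" using assms(1) by auto
  ultimately show "c < C" "r \<le> R" by (auto simp: kd_def split: if_splits)
qed

text \<open>In the last column of cells a final digit 9 would wrap around to the next lattice row,
  which the last hypothesis excludes.\<close>

lemma pos_inj:
  assumes "pos r c p = pos r c q" "0 \<le> p" "0 \<le> q" "c \<le> C" "c < C \<or> p mod 10 < 9 \<and> q mod 10 < 9"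
  shows "p = q"
proof -
  have w: "9 * c + nat x < width" if "x < 10" "c < C \<or> x < 9" for x
  proof -
    have "nat x \<le> 9" "c < C \<or> nat x \<le> 8" using that by auto
    then show ?thesis using assms(4) unfolding width_def by auto
  qed
  have "9 * c + nat (p mod 10) < width" "9 * c + nat (q mod 10) < width"
    by (rule w; use assms(5) in auto)+
  from assms(1)[unfolded pos_def row_col_eq[OF this]]
  have "nat (p div 10) = nat (q div 10)" "nat (p mod 10) = nat (q mod 10)" by auto
  moreover have "0 \<le> p div 10" "0 \<le> q div 10"
    using assms(2,3) by (simp_all add: pos_imp_zdiv_nonneg_iff)
  ultimately have "p div 10 = q div 10" "p mod 10 = q mod 10"
    by (simp_all only: eq_nat_nat_iff pos_mod_sign[of 10] zero_less_numeral)
  then show "p = q" by (metis div_mult_mod_eq)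
qed

lemma outer_pos:
  assumes "p \<in> outer" "c < C" "r \<le> R"
  obtains r' c' p' where "pos r c p = pos r' c' p'" "r' < R + 2" "c' < C + 1"
    "p' \<in> {50, 60, 70, 5, 6, 7}"
proof (cases "p \<in> {59, 69, 79}")
  case True
  then show ?thesis using that[of r "Suc c" "p - 9"] pos_right[OF True, of r c] assms by auto
next
  case False
  then show ?thesis
    using that[of "Suc r" c "p - 90"] pos_below[of p r c] assms by (auto simp: outer_def)
qed

lemma spot_pos:
  assumes "(p, q) \<in> set (cell_edges (kd r c))" "r < R + 2" "c < C + 1" "x \<in> {p, q}"
  obtains r' c' p' where "pos r c x = pos r' c' p'" "r' < R + 2" "c' < C + 1" "inbox p'"
proof (cases "inbox x")
  case True
  then show ?thesis using that assms by blast
next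
  case False
  then have "x \<in> outer" using edge_spots[OF assms(1)] assms(4) by auto
  with outer_edge[OF assms(1)] assms(4) have "c < C" "r \<le> R" by auto
  from outer_pos[OF \<open>x \<in> outer\<close> this] show ?thesis
    using that by (metis (no_types, lifting) inbox_ports)
qed

end

section \<open>Orientations of the grid determine exact covers\<close>

definition nbl :: "(spot \<times> spot) list \<Rightarrow> spot \<Rightarrow> spot list" where
  "nbl es p = map snd (filter (\<lambda>e. fst e = p) es) @ map fst (filter (\<lambda>e. snd e = p) es)"

definition ports :: "spot list" where
  "ports = [50, 60, 70, 5, 6, 7]"

text \<open>Ports are excluded because they may have further neighbours in the cell to the left or
  above; for all other vertices the list of the cell shows the whole neighbourhood.\<close>

definition lnb :: "(spot \<times> spot) list \<Rightarrow> spot \<Rightarrow> spot list \<Rightarrow> bool" where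
  "lnb es p zs \<longleftrightarrow> inbox p \<and> p \<notin> set ports \<and> distinct zs \<and>
     list_all (\<lambda>z. z \<in> set zs) (nbl es p) \<and> list_all (\<lambda>z. z \<in> set (nbl es p)) zs"

definition adj :: "(spot \<times> spot) list \<Rightarrow> spot \<Rightarrow> spot \<Rightarrow> bool" where
  "adj es p q \<longleftrightarrow> (p, q) \<in> set es \<or> (q, p) \<in> set es"

lemma set_nbl: "set (nbl es p) = {q. adj es p q}"
  by (auto simp: nbl_def adj_def intro: rev_image_eqI)

lemma lnb_set: "lnb es p zs \<Longrightarrow> set zs = {q. adj es p q}"
  unfolding set_nbl[symmetric] by (auto simp: lnb_def list_all_iff)

section \<open>Gadget patterns inside a cell\<close>

definition pair_at where
  "pair_at es u v x y z x' y' z' \<longleftrightarrow> adj es u v \<and> inbox u \<and> inbox v \<and> distinct [u, v, x, x'] \<and>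
     lnb es x [u, y, z] \<and> lnb es y [x, z] \<and> lnb es z [x, y] \<and>
     lnb es x' [v, y', z'] \<and> lnb es y' [x', z'] \<and> lnb es z' [x', y']"

definition wire_at where
  "wire_at es u v i j \<longleftrightarrow> adj es u v \<and> inbox u \<and> inbox v \<and> u \<noteq> i \<and> lnb es i [v, j] \<and> lnb es j [i]"

definition if_at where
  "if_at es u v w p p' s s' l r q t \<longleftrightarrow>
     lnb es p [u, p'] \<and> lnb es p' [p, r] \<and> lnb es s [v, s'] \<and> lnb es s' [s, l, r] \<and> lnb es l [s'] \<and>
     lnb es r [p', s', q] \<and> lnb es q [r, t] \<and> lnb es t [q, w]"

definition and_at where
  "and_at es u v w p p' s s' l r q \<longleftrightarrow>
     lnb es p [u, p'] \<and> lnb es p' [p, r] \<and> lnb es s [v, s'] \<and> lnb es s' [s, l, r] \<and> lnb es l [s'] \<and>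
     lnb es r [p', s', q] \<and> lnb es q [r, w]"

definition path_at where
  "path_at es u i j k l v \<longleftrightarrow>
     lnb es i [u, j] \<and> lnb es j [i, k] \<and> lnb es k [j, l] \<and> lnb es l [k, v]"

text \<open>Vertex 50 carries the row bit, 60 and 40 its negation, and 70 the bit again.\<close>

definition a_net_at where
  "a_net_at es \<longleftrightarrow> pair_at es 50 60 51 61 62 71 72 82 \<and> wire_at es 60 70 81 80 \<and> wire_at es 50 40 30 20"

definition b_net_at where
  "b_net_at es \<longleftrightarrow> pair_at es 6 5 17 28 27 4 3 14 \<and> wire_at es 5 15 16 26 \<and> wire_at es 6 7 18 8"

lemma net_checks:
  "list_all a_net_at (map cell_edges [Cross, Join, End])"
  "list_all b_net_at (map cell_edges [Cross, Join, Bottom])"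
  by code_simp+

text \<open>The pair 54, 65 holds the auxiliary bit and its negation. The four gates occupy the
  upper left, upper right, lower right and lower left corner, in this order.\<close>

lemma Cross_checks:
  "let es = cell_edges Cross in pair_at es 54 65 44 33 34 55 56 45 \<and> wire_at es 40 41 42 53 \<and>
     wire_at es 15 25 36 37 \<and> wire_at es 25 24 13 2"
  "let es = cell_edges Cross in if_at es 41 24 54 31 21 23 12 1 22 32 43 \<and>
     if_at es 65 25 59 66 67 35 46 47 57 58 48 \<and> if_at es 69 96 65 68 78 86 87 88 77 76 75 \<and>
     if_at es 65 95 41 64 74 85 84 83 73 63 52"
  by code_simp+

text \<open>Wires lead the row bit to 43 and the column bit to 45. Two NOR gates and a path relate
  them to the bits of the right and the lower neighbour.\<close>

lemma Join_checks:
  "let es = cell_edges Join in wire_at es 40 41 31 21 \<and> wire_at es 41 42 52 63 \<and>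
     wire_at es 42 43 32 33 \<and> wire_at es 15 25 36 37 \<and> wire_at es 25 35 24 13 \<and>
     wire_at es 35 34 23 22 \<and> wire_at es 34 45 46 47"
  "let es = cell_edges Join in and_at es 95 45 43 85 75 44 54 65 64 53 \<and>
     and_at es 97 79 45 86 76 68 67 57 66 56 \<and> path_at es 79 78 88 77 87 97"
  by code_simp+

lemma leaf_checks: "lnb (cell_edges Top) 86 [97]" "lnb (cell_edges Bottom) 25 [15]"
  by code_simp+

section \<open>Neighbourhoods in the grid\<close>

context grid
begin

text \<open>A code outside its cell denotes a port of a neighbour, so a vertex that is no port has
  only one name.\<close>

lemma pos_unique:
  assumes "pos r c p = pos r' c' q" "inbox p" "p \<notin> set ports" "c < C + 1"
    and "(x, y) \<in> set (cell_edges (kd r' c'))" "q = x \<or> q = y" "c' < C + 1"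
  shows "r = r'" "c = c'" "p = q"
proof -
  have "inbox q"
  proof (rule ccontr)
    assume "\<not> inbox q"
    then have "q \<in> outer" using edge_spots[OF assms(5)] assms(6) by auto
    with outer_edge[OF assms(5)] assms(6) have "c' < C" "r' \<le> R" by auto
    from outer_pos[OF \<open>q \<in> outer\<close> this] obtain r'' c'' p''
      where *: "pos r' c' q = pos r'' c'' p''" "c'' < C + 1" "p'' \<in> {50, 60, 70, 5, 6, 7}"
      by metis
    then have "p = p''"
      using pos_eq[of p p'' c c'' r r''] assms(1,2,4) inbox_ports by auto
    then show False using assms(3) *(3) by (auto simp: ports_def)
  qed
  then show "r = r'" "c = c'" "p = q"
    using pos_eq[of p q c c' r r'] assms by auto
qed

lemma edgesI: "adj (cell_edges (kd r c)) p q \<Longrightarrow> r < R + 2 \<Longrightarrow> c < C + 1 \<Longrightarrow> {pos r c p, pos r c q} \<in> edges"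
  unfolding adj_def edges_def by (auto simp: insert_commute)

lemma edgesI': "adj (cell_edges (kd r c)) p q \<Longrightarrow> r < R + 2 \<Longrightarrow> c < C + 1 \<Longrightarrow> {pos r c q, pos r c p} \<in> edges"
  using edgesI[of r c p q] by (simp add: insert_commute)

lemma nb_set:
  assumes "inbox p" "p \<notin> set ports" "r < R + 2" "c < C + 1"
  shows "{z. {z, pos r c p} \<in> edges} = pos r c ` {q. adj (cell_edges (kd r c)) p q}"
proof
  show "pos r c ` {q. adj (cell_edges (kd r c)) p q} \<subseteq> {z. {z, pos r c p} \<in> edges}"
    using edgesI'[OF _ assms(3,4)] by blast
  show "{z. {z, pos r c p} \<in> edges} \<subseteq> pos r c ` {q. adj (cell_edges (kd r c)) p q}"
  proof
    fix z assume "z \<in> {z. {z, pos r c p} \<in> edges}"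
    then obtain r' c' x y where xy: "{z, pos r c p} = {pos r' c' x, pos r' c' y}"
      "(x, y) \<in> set (cell_edges (kd r' c'))" "c' < C + 1"
      by (auto simp: edges_def)
    then consider "z = pos r' c' x" "pos r c p = pos r' c' y" | "z = pos r' c' y" "pos r c p = pos r' c' x"
      by (auto simp: doubleton_eq_iff)
    then show "z \<in> pos r c ` {q. adj (cell_edges (kd r c)) p q}"
    proof cases
      case 1
      from pos_unique[OF 1(2) assms(1,2,4) xy(2) _ xy(3)] 1(1) xy(2)
      show ?thesis by (auto simp: adj_def)
    next
      case 2
      from pos_unique[OF 2(2) assms(1,2,4) xy(2) _ xy(3)] 2(1) xy(2)
      show ?thesis by (auto simp: adj_def)
    qed
  qed
qed

lemma adj_spot:
  assumes "adj (cell_edges (kd r c)) p q"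
  shows "0 \<le> q" "c < C \<or> inbox q"
proof -
  have "inbox q \<or> q \<in> outer" using assms edge_spots unfolding adj_def by blast
  moreover have "q \<in> outer \<Longrightarrow> c < C" using assms outer_edge unfolding adj_def by blast
  ultimately show "0 \<le> q" "c < C \<or> inbox q" by (auto simp: inbox_def outer_def)
qed

lemma inj_adj:
  assumes "c < C + 1"
  shows "inj_on (pos r c) {q. adj (cell_edges (kd r c)) p q}"
proof (rule inj_onI)
  fix q q' assume *: "q \<in> {q. adj (cell_edges (kd r c)) p q}" "q' \<in> {q. adj (cell_edges (kd r c)) p q}"
    "pos r c q = pos r c q'"
  show "q = q'"
    by (rule pos_inj[OF *(3)]) (use adj_spot[of r c p q] adj_spot[of r c p q'] * assms in \<open>auto simp: inbox_def\<close>)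
qed

end

section \<open>Propagation of bits through the cells\<close>

locale grid_solution = grid R C M + proper2 "grid.edges R C M" D
  for R C :: nat and M :: "nat \<Rightarrow> nat \<Rightarrow> bool" and D :: "(nat \<times> nat) set"
begin

lemma nbs_cell:
  assumes "lnb (cell_edges (kd r c)) p zs" "r < R + 2" "c < C + 1"
  shows "nbs (pos r c p) (map (pos r c) zs)"
proof -
  have "inbox p" "p \<notin> set ports" "distinct zs" using assms(1) by (auto simp: lnb_def)
  then show ?thesis
    unfolding nbs_def using nb_set[of p r c] lnb_set[OF assms(1)] inj_adj[of c r p] assms(2,3)
    by (simp add: distinct_map)
qed

lemma pos_neq: "inbox p \<Longrightarrow> inbox q \<Longrightarrow> c < C + 1 \<Longrightarrow> p \<noteq> q \<Longrightarrow> pos r c p \<noteq> pos r c q"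
  using pos_eq[of p q c c r r] by auto

lemma pair_cell:
  assumes "pair_at (cell_edges (kd r c)) u v x y z x' y' z'" "r < R + 2" "c < C + 1"
  shows "net (pos r c u) {pos r c x, pos r c v}" "net (pos r c v) {pos r c x', pos r c u}"
    "lab (pos r c u) + lab (pos r c v) = 3"
proof -
  note a = assms(1)[unfolded pair_at_def]
  have 1: "(pos r c x, pos r c u) \<in> D"
    by (rule triangle[of _ _ "pos r c y" "pos r c z"])
      (use a nbs_cell[OF _ assms(2,3), of x "[u, y, z]"] nbs_cell[OF _ assms(2,3), of y "[x, z]"]
        nbs_cell[OF _ assms(2,3), of z "[x, y]"] in auto)
  have 2: "(pos r c x', pos r c v) \<in> D"
    by (rule triangle[of _ _ "pos r c y'" "pos r c z'"])
      (use a nbs_cell[OF _ assms(2,3), of x' "[v, y', z']"] nbs_cell[OF _ assms(2,3), of y' "[x', z']"]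
        nbs_cell[OF _ assms(2,3), of z' "[x', y']"] in auto)
  have 3: "{pos r c u, pos r c v} \<in> edges" using a edgesI assms(2,3) by auto
  have 4: "pos r c x \<noteq> pos r c v" "pos r c x' \<noteq> pos r c u"
    using a pos_neq assms(3) by (auto simp: lnb_def)
  show "net (pos r c u) {pos r c x, pos r c v}" "net (pos r c v) {pos r c x', pos r c u}"
    "lab (pos r c u) + lab (pos r c v) = 3"
    using net_pair[OF 3 1 2 4] by auto
qed

lemma wire_cell:
  assumes "wire_at (cell_edges (kd r c)) u v i j" "r < R + 2" "c < C + 1"
    "net (pos r c u) S" "pos r c v \<notin> S"
  shows "net (pos r c v) {pos r c u, pos r c i}" "lab (pos r c u) + lab (pos r c v) = 3"
proof -
  note a = assms(1)[unfolded wire_at_def]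
  have "{pos r c u, pos r c v} \<in> edges" using a edgesI assms(2,3) by auto
  moreover have "nbs (pos r c i) [pos r c v, pos r c j]" "nbs (pos r c j) [pos r c i]"
    using a nbs_cell[OF _ assms(2,3), of i "[v, j]"] nbs_cell[OF _ assms(2,3), of j "[i]"] by auto
  moreover have "pos r c u \<noteq> pos r c i" using a pos_neq assms(3) by (auto simp: lnb_def)
  ultimately show "net (pos r c v) {pos r c u, pos r c i}" "lab (pos r c u) + lab (pos r c v) = 3"
    using net_wire[OF assms(4,5)] by auto
qed

lemma if_cell:
  assumes "if_at (cell_edges (kd r c)) u v w p p' s s' l r' q t" "r < R + 2" "c < C + 1"
    "net (pos r c u) S" "net (pos r c v) T" "net (pos r c w) U"
    "pos r c p \<notin> S" "pos r c s \<notin> T" "pos r c t \<notin> U"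
  shows "lab (pos r c v) = 1 \<Longrightarrow> lab (pos r c u) = lab (pos r c w)"
proof -
  note a = assms(1)[unfolded if_at_def]
  have "nbs (pos r c p) [pos r c u, pos r c p']" "nbs (pos r c p') [pos r c p, pos r c r']"
    "nbs (pos r c s) [pos r c v, pos r c s']" "nbs (pos r c s') [pos r c s, pos r c l, pos r c r']"
    "nbs (pos r c l) [pos r c s']" "nbs (pos r c r') [pos r c p', pos r c s', pos r c q]"
    "nbs (pos r c q) [pos r c r', pos r c t]" "nbs (pos r c t) [pos r c q, pos r c w]"
    using a by (auto dest!: nbs_cell[OF _ assms(2,3)])
  then show "lab (pos r c v) = 1 \<Longrightarrow> lab (pos r c u) = lab (pos r c w)"
    using gate_if[OF assms(4-9)] by blast
qed

lemma and_cell: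
  assumes "and_at (cell_edges (kd r c)) u v w p p' s s' l r' q" "r < R + 2" "c < C + 1"
    "net (pos r c u) S" "net (pos r c v) T" "net (pos r c w) U"
    "pos r c p \<notin> S" "pos r c s \<notin> T" "pos r c q \<notin> U"
  shows "lab (pos r c w) = 2 \<longleftrightarrow> lab (pos r c u) = 1 \<and> lab (pos r c v) = 1"
proof -
  note a = assms(1)[unfolded and_at_def]
  have "nbs (pos r c p) [pos r c u, pos r c p']" "nbs (pos r c p') [pos r c p, pos r c r']"
    "nbs (pos r c s) [pos r c v, pos r c s']" "nbs (pos r c s') [pos r c s, pos r c l, pos r c r']"
    "nbs (pos r c l) [pos r c s']" "nbs (pos r c r') [pos r c p', pos r c s', pos r c q]"
    "nbs (pos r c q) [pos r c r', pos r c w]"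
    using a by (auto dest!: nbs_cell[OF _ assms(2,3)])
  then show ?thesis
    using gate_and[OF assms(4-9)] by blast
qed

lemma path_cell:
  assumes "path_at (cell_edges (kd r c)) u i j k l v" "r < R + 2" "c < C + 1"
    "net (pos r c u) S" "net (pos r c v) T" "pos r c i \<notin> S" "pos r c l \<notin> T"
  shows "lab (pos r c u) = 1 \<or> lab (pos r c v) = 1"
proof -
  note a = assms(1)[unfolded path_at_def]
  have "nbs (pos r c i) [pos r c u, pos r c j]" "nbs (pos r c j) [pos r c i, pos r c k]"
    "nbs (pos r c k) [pos r c j, pos r c l]" "nbs (pos r c l) [pos r c k, pos r c v]"
    using a by (auto dest!: nbs_cell[OF _ assms(2,3)])
  then show ?thesis
    using gate_path[OF assms(4-7)] by blast
qed

lemma pos_simp: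
  "inbox p \<Longrightarrow> inbox q \<Longrightarrow> c < C + 1 \<Longrightarrow> c' < C + 1 \<Longrightarrow>
     pos r c p = pos r' c' q \<longleftrightarrow> r = r' \<and> c = c' \<and> p = q"
  by (rule pos_eq) auto

lemma a_net:
  assumes "kd r c \<in> {Cross, Join, End}" "r < R + 2" "c < C + 1"
  shows "net (pos r c 50) {pos r c 51, pos r c 60}" "net (pos r c 60) {pos r c 71, pos r c 50}"
    "net (pos r c 70) {pos r c 60, pos r c 81}" "net (pos r c 40) {pos r c 50, pos r c 30}"
    "lab (pos r c 60) = 3 - lab (pos r c 50)" "lab (pos r c 70) = lab (pos r c 50)"
    "lab (pos r c 40) = 3 - lab (pos r c 50)"
proof -
  have a: "a_net_at (cell_edges (kd r c))" using assms(1) net_checks(1) by auto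
  note p = pair_cell[OF a[unfolded a_net_at_def, THEN conjunct1] assms(2,3)]
  note w = wire_cell[OF a[unfolded a_net_at_def, THEN conjunct2, THEN conjunct1] assms(2,3) p(2)]
    wire_cell[OF a[unfolded a_net_at_def, THEN conjunct2, THEN conjunct2] assms(2,3) p(1)]
  have "pos r c 70 \<notin> {pos r c 71, pos r c 50}" "pos r c 40 \<notin> {pos r c 51, pos r c 60}"
    using assms(3) by (simp_all add: pos_simp inbox_def)
  note w' = w(1,2)[OF this(1)] w(3,4)[OF this(2)]
  show "net (pos r c 50) {pos r c 51, pos r c 60}" "net (pos r c 60) {pos r c 71, pos r c 50}"
    "net (pos r c 70) {pos r c 60, pos r c 81}" "net (pos r c 40) {pos r c 50, pos r c 30}"
    "lab (pos r c 60) = 3 - lab (pos r c 50)" "lab (pos r c 70) = lab (pos r c 50)"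
    "lab (pos r c 40) = 3 - lab (pos r c 50)"
    using p w' by auto
qed

lemma b_net:
  assumes "kd r c \<in> {Cross, Join, Bottom}" "r < R + 2" "c < C + 1"
  shows "net (pos r c 6) {pos r c 17, pos r c 5}" "net (pos r c 5) {pos r c 4, pos r c 6}"
    "net (pos r c 15) {pos r c 5, pos r c 16}" "net (pos r c 7) {pos r c 6, pos r c 18}"
    "lab (pos r c 5) = 3 - lab (pos r c 6)" "lab (pos r c 15) = lab (pos r c 6)"
    "lab (pos r c 7) = 3 - lab (pos r c 6)"
proof -
  have a: "b_net_at (cell_edges (kd r c))" using assms(1) net_checks(2) by auto
  note p = pair_cell[OF a[unfolded b_net_at_def, THEN conjunct1] assms(2,3)]
  note w = wire_cell[OF a[unfolded b_net_at_def, THEN conjunct2, THEN conjunct1] assms(2,3) p(2)]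
    wire_cell[OF a[unfolded b_net_at_def, THEN conjunct2, THEN conjunct2] assms(2,3) p(1)]
  have "pos r c 15 \<notin> {pos r c 4, pos r c 6}" "pos r c 7 \<notin> {pos r c 17, pos r c 5}"
    using assms(3) by (simp_all add: pos_simp inbox_def)
  note w' = w(1,2)[OF this(1)] w(3,4)[OF this(2)]
  show "net (pos r c 6) {pos r c 17, pos r c 5}" "net (pos r c 5) {pos r c 4, pos r c 6}"
    "net (pos r c 15) {pos r c 5, pos r c 16}" "net (pos r c 7) {pos r c 6, pos r c 18}"
    "lab (pos r c 5) = 3 - lab (pos r c 6)" "lab (pos r c 15) = lab (pos r c 6)"
    "lab (pos r c 7) = 3 - lab (pos r c 6)"
    using p w' by auto
qed

definition A :: "nat \<Rightarrow> nat \<Rightarrow> bool" where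
  "A r c \<longleftrightarrow> lab (pos r c 50) = 2"

definition B :: "nat \<Rightarrow> nat \<Rightarrow> bool" where
  "B r c \<longleftrightarrow> lab (pos r c 6) = 2"

text \<open>Let d be the bit of 54, and write a, b for the bits that enter and a', b' for those that
  leave. The gates say: a = d unless b; a' = not d if b; a' = d unless b'; a = not d if b'. If b and
  b' differ, two of these conditions contradict each other; if they agree, the two that apply give a
  = a'.\<close>

lemma Cross_cell:
  assumes k: "kd r c = Cross" and rc: "r < R + 1" "c < C"
    and k': "kd r (Suc c) \<in> {Cross, Join, End}" "kd (Suc r) c \<in> {Cross, Join, Bottom}"
  shows "A r (Suc c) = A r c" "B (Suc r) c = B r c"
proof -
  have l: "r < R + 2" "c < C + 1" "Suc c < C + 1" "Suc r < R + 2" using rc by auto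
  have "kd r c \<in> {Cross, Join, End}" "kd r c \<in> {Cross, Join, Bottom}" using k by auto
  note a = a_net[OF this(1) l(1,2)] and b = b_net[OF this(2) l(1,2)]
    and a' = a_net[OF k'(1) l(1,3)] and b' = b_net[OF k'(2) l(4,2)]
  note chk = Cross_checks[unfolded Let_def k[symmetric]]
  note d = pair_cell[OF chk(1)[THEN conjunct1] l(1,2)]
  have w41: "net (pos r c 41) {pos r c 40, pos r c 42}" "lab (pos r c 40) + lab (pos r c 41) = 3"
    using wire_cell[of r c 40 41 42 53, OF _ l(1,2) a(4)] chk(1) l by (simp_all add: pos_simp inbox_def)
  have w25: "net (pos r c 25) {pos r c 15, pos r c 36}" "lab (pos r c 15) + lab (pos r c 25) = 3"
    using wire_cell[of r c 15 25 36 37, OF _ l(1,2) b(3)] chk(1) l by (simp_all add: pos_simp inbox_def)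
  have w24: "net (pos r c 24) {pos r c 25, pos r c 13}" "lab (pos r c 25) + lab (pos r c 24) = 3"
    using wire_cell[of r c 25 24 13 2, OF _ l(1,2) w25(1)] chk(1) l by (simp_all add: pos_simp inbox_def)
  have o: "pos r c 59 = pos r (Suc c) 50" "pos r c 69 = pos r (Suc c) 60"
    "pos r c 96 = pos (Suc r) c 6" "pos r c 95 = pos (Suc r) c 5"
    by (simp_all add: pos_right pos_below)
  have K: "lab (pos r c 24) = 1 \<Longrightarrow> lab (pos r c 41) = lab (pos r c 54)"
    by (rule if_cell[OF chk(2)[THEN conjunct1] l(1,2) w41(1) w24(1) d(1)]) (use l in \<open>simp_all add: pos_simp inbox_def o\<close>)
  have L: "lab (pos r c 25) = 1 \<Longrightarrow> lab (pos r c 65) = lab (pos r c 59)"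
    by (rule if_cell[OF chk(2)[THEN conjunct2, THEN conjunct1] l(1,2) d(2) w25(1) a'(1)[folded o]])
      (use l in \<open>simp_all add: pos_simp inbox_def o\<close>)
  have M: "lab (pos r c 96) = 1 \<Longrightarrow> lab (pos r c 69) = lab (pos r c 65)"
    by (rule if_cell[OF chk(2)[THEN conjunct2, THEN conjunct2, THEN conjunct1] l(1,2)
          a'(2)[folded o] b'(1)[folded o] d(2)]) (use l in \<open>simp_all add: pos_simp inbox_def o\<close>)
  have N: "lab (pos r c 95) = 1 \<Longrightarrow> lab (pos r c 65) = lab (pos r c 41)"
    by (rule if_cell[OF chk(2)[THEN conjunct2, THEN conjunct2, THEN conjunct2] l(1,2)
          d(2) b'(2)[folded o] w41(1)]) (use l in \<open>simp_all add: pos_simp inbox_def o\<close>)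
  note n = a(1)[THEN net_lab] b(1)[THEN net_lab] a'(1)[THEN net_lab] b'(1)[THEN net_lab] d(1)[THEN net_lab]
  show "A r (Suc c) = A r c" "B (Suc r) c = B r c"
    unfolding A_def B_def
    using K L M N n a(5-7) b(5-7) a'(5-7) b'(5-7) w41(2) w24(2) w25(2) d(3) unfolding o by auto
qed

text \<open>With a, b entering and a', b' leaving, the gates say: a = (b' and not b), b = (b' and
  not a'), and a' implies b'. If b' is false, all bits are false; otherwise exactly one of a and b
  is true, and a' = not b = a.\<close>

lemma Join_cell:
  assumes k: "kd r c = Join" and rc: "r < R + 1" "c < C"
    and k': "kd r (Suc c) \<in> {Cross, Join, End}" "kd (Suc r) c \<in> {Cross, Join, Bottom}"
  shows "A r (Suc c) = A r c" "B (Suc r) c \<longleftrightarrow> A r c \<or> B r c" "\<not> (A r c \<and> B r c)"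
proof -
  have l: "r < R + 2" "c < C + 1" "Suc c < C + 1" "Suc r < R + 2" using rc by auto
  have "kd r c \<in> {Cross, Join, End}" "kd r c \<in> {Cross, Join, Bottom}" using k by auto
  note a = a_net[OF this(1) l(1,2)] and b = b_net[OF this(2) l(1,2)]
    and a' = a_net[OF k'(1) l(1,3)] and b' = b_net[OF k'(2) l(4,2)]
  note chk = Join_checks[unfolded Let_def k[symmetric]]
  have w41: "net (pos r c 41) {pos r c 40, pos r c 31}" "lab (pos r c 40) + lab (pos r c 41) = 3"
    using wire_cell[of r c 40 41 31 21, OF _ l(1,2) a(4)] chk(1) l by (simp_all add: pos_simp inbox_def)
  have w42: "net (pos r c 42) {pos r c 41, pos r c 52}" "lab (pos r c 41) + lab (pos r c 42) = 3"
    using wire_cell[of r c 41 42 52 63, OF _ l(1,2) w41(1)] chk(1) l by (simp_all add: pos_simp inbox_def)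
  have w43: "net (pos r c 43) {pos r c 42, pos r c 32}" "lab (pos r c 42) + lab (pos r c 43) = 3"
    using wire_cell[of r c 42 43 32 33, OF _ l(1,2) w42(1)] chk(1) l by (simp_all add: pos_simp inbox_def)
  have w25: "net (pos r c 25) {pos r c 15, pos r c 36}" "lab (pos r c 15) + lab (pos r c 25) = 3"
    using wire_cell[of r c 15 25 36 37, OF _ l(1,2) b(3)] chk(1) l by (simp_all add: pos_simp inbox_def)
  have w35: "net (pos r c 35) {pos r c 25, pos r c 24}" "lab (pos r c 25) + lab (pos r c 35) = 3"
    using wire_cell[of r c 25 35 24 13, OF _ l(1,2) w25(1)] chk(1) l by (simp_all add: pos_simp inbox_def)
  have w34: "net (pos r c 34) {pos r c 35, pos r c 23}" "lab (pos r c 35) + lab (pos r c 34) = 3"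
    using wire_cell[of r c 35 34 23 22, OF _ l(1,2) w35(1)] chk(1) l by (simp_all add: pos_simp inbox_def)
  have w45: "net (pos r c 45) {pos r c 34, pos r c 46}" "lab (pos r c 34) + lab (pos r c 45) = 3"
    using wire_cell[of r c 34 45 46 47, OF _ l(1,2) w34(1)] chk(1) l by (simp_all add: pos_simp inbox_def)
  have o: "pos r c 79 = pos r (Suc c) 70" "pos r c 97 = pos (Suc r) c 7" "pos r c 95 = pos (Suc r) c 5"
    by (simp_all add: pos_right pos_below)
  have G: "lab (pos r c 43) = 2 \<longleftrightarrow> lab (pos r c 95) = 1 \<and> lab (pos r c 45) = 1"
    by (rule and_cell[OF chk(2)[THEN conjunct1] l(1,2) b'(2)[folded o] w45(1) w43(1)])
      (use l in \<open>simp_all add: pos_simp inbox_def o\<close>)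
  have H: "lab (pos r c 45) = 2 \<longleftrightarrow> lab (pos r c 97) = 1 \<and> lab (pos r c 79) = 1"
    by (rule and_cell[OF chk(2)[THEN conjunct2, THEN conjunct1] l(1,2) b'(4)[folded o]
          a'(3)[folded o] w45(1)]) (use l in \<open>simp_all add: pos_simp inbox_def o\<close>)
  have I: "lab (pos r c 79) = 1 \<or> lab (pos r c 97) = 1"
    by (rule path_cell[OF chk(2)[THEN conjunct2, THEN conjunct2] l(1,2) a'(3)[folded o]
          b'(4)[folded o]]) (use l in \<open>simp_all add: pos_simp inbox_def o\<close>)
  note n = a(1)[THEN net_lab] b(1)[THEN net_lab] a'(1)[THEN net_lab] b'(1)[THEN net_lab]
  \<comment> \<open>An even number of negations separates 43 from 50, and 45 from 6.\<close>
  have e: "lab (pos r c 43) = lab (pos r c 50)" "lab (pos r c 45) = lab (pos r c 6)"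
    using n(1) a(7) w41(2) w42(2) w43(2) apply linarith
    using n(2) b(6) w25(2) w35(2) w34(2) w45(2) by linarith
  show "A r (Suc c) = A r c" "B (Suc r) c \<longleftrightarrow> A r c \<or> B r c" "\<not> (A r c \<and> B r c)"
    unfolding A_def B_def
    using G H I n b'(5,7) a'(6) unfolding o e by auto
qed

lemma Top_cell:
  assumes "kd 0 c = Top" "c < C" "kd 1 c \<in> {Cross, Join, Bottom}"
  shows "\<not> B 1 c"
proof -
  have l: "0 < R + 2" "c < C + 1" "1 < R + 2" using assms by auto
  note b = b_net[OF assms(3) l(3,2)]
  have o: "pos 0 c 97 = pos 1 c 7" by (simp add: pos_below)
  have "nbs (pos 0 c 86) [pos 1 c 7]"
    using nbs_cell[of 0 c 86 "[97]"] leaf_checks(1) assms(1) l o by simp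
  then have "lab (pos 1 c 7) = 2"
    by (intro gate_leaf[OF b(4)]) (use l in \<open>simp_all add: pos_simp inbox_def\<close>)
  then show ?thesis using b net_lab[OF b(1)] by (auto simp: B_def)
qed

lemma Bottom_cell:
  assumes "kd r c = Bottom" "c < C" "r < R + 2"
  shows "B r c"
proof -
  have l: "c < C + 1" using assms by auto
  note b = b_net[of r c, OF _ assms(3) l]
  have "nbs (pos r c 25) [pos r c 15]"
    using nbs_cell[of r c 25 "[15]"] leaf_checks(2) assms l by simp
  then have "lab (pos r c 15) = 2"
    by (intro gate_leaf[OF b(3)]) (use l assms in \<open>simp_all add: pos_simp inbox_def\<close>)
  then show ?thesis using b assms(1) by (auto simp: B_def)
qed

text \<open>Down a column the bit \<open>B\<close> counts the selected sets that contain the point.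
  It starts at 0, a \<open>Join\<close> cell adds the row bit and does not admit the sum 2, and at
  the bottom it has to be 1.\<close>

theorem exact_cover:
  assumes "c < C"
  shows "\<exists>!r. r < R \<and> M r c \<and> A (Suc r) 0"
proof -
  have A0: "A (Suc r) c = A (Suc r) 0" if "c \<le> C" "r < R" for r c
    using that
  proof (induction c)
    case (Suc c)
    have k: "kd (Suc r) (Suc c) \<in> {Cross, Join, End}" "kd (Suc (Suc r)) c \<in> {Cross, Join, Bottom}"
      "kd (Suc r) c \<in> {Cross, Join}"
      using Suc.prems by (auto simp: kd_def)
    then show ?case
      using Cross_cell[of "Suc r" c] Join_cell[of "Suc r" c] Suc by auto
  qed simp
  define S where "S n = {r. r < n \<and> M r c \<and> A (Suc r) 0}" for n
  have S_Suc: "S (Suc n) = (if M n c \<and> A (Suc n) 0 then insert n (S n) else S n)" for n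
    by (auto simp: S_def less_Suc_eq)
  have fin: "finite (S n)" "n \<notin> S n" for n by (auto simp: S_def)
  have "card (S n) = of_bool (B (Suc n) c)" if "n \<le> R" for n
    using that
  proof (induction n)
    case 0
    have "kd 0 c = Top" "kd 1 c \<in> {Cross, Join, Bottom}" using assms by (auto simp: kd_def)
    then show ?case using Top_cell[of c] assms by (simp add: S_def)
  next
    case (Suc n)
    have n: "n < R" "n \<le> R" "Suc n < R + 1" using Suc.prems by auto
    have k: "kd (Suc n) (Suc c) \<in> {Cross, Join, End}" "kd (Suc (Suc n)) c \<in> {Cross, Join, Bottom}"
      "kd (Suc n) c = (if M n c then Join else Cross)"
      using Suc.prems assms by (auto simp: kd_def)
    have A: "A (Suc n) c = A (Suc n) 0" by (rule A0) (use assms n in auto)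
    show ?case
    proof (cases "M n c")
      case True
      then show ?thesis
        using Join_cell(2,3)[of "Suc n" c] k n(3) assms Suc.IH[OF n(2)] fin[of n] A
        by (auto simp: S_Suc)
    next
      case False
      then show ?thesis
        using Cross_cell(2)[of "Suc n" c] k n(3) assms Suc.IH[OF n(2)] by (simp add: S_Suc)
    qed
  qed
  moreover have "B (Suc R) c"
    by (rule Bottom_cell) (use assms in \<open>auto simp: kd_def\<close>)
  ultimately have "card (S R) = 1" by simp
  then obtain r where "S R = {r}" by (rule card_1_singletonE)
  then have "x < R \<and> M x c \<and> A (Suc x) 0 \<longleftrightarrow> x = r" for x
    unfolding S_def set_eq_iff by simp
  then show ?thesis by simp
qed

end

section \<open>Orientations from exact covers\<close>

text \<open>A simple list contains no edge twice in either direction, so the arcs chosen for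
  different entries never collide.\<close>

lemma turn_arcs:
  assumes "length ds = length es" "simple_edges es"
  shows "distinct (map2 turn es ds)"
    and "(p, q) \<in> set (map2 turn es ds) \<Longrightarrow> adj es p q"
    and "adj es p q \<Longrightarrow> ((p, q) \<in> set (map2 turn es ds)) \<noteq> ((q, p) \<in> set (map2 turn es ds))"
proof -
  have "distinct (map2 turn es ds) \<and> (\<forall>p q. (p, q) \<in> set (map2 turn es ds) \<longrightarrow> adj es p q) \<and>
     (\<forall>p q. adj es p q \<longrightarrow> ((p, q) \<in> set (map2 turn es ds)) \<noteq> ((q, p) \<in> set (map2 turn es ds)))"
    using assms
  proof (induction ds es rule: list_induct2)
    case Nil
    then show ?case by (simp add: adj_def)
  next
    case (Cons d ds e es)
    obtain x y where e: "e = (x, y)" by (cases e)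
    have s: "simple_edges es" "\<not> adj es x y" "\<not> adj es y x" "x \<noteq> y"
      using Cons.prems e by (auto simp: simple_edges_def adj_def list_all_iff)
    define S where "S = set (map2 turn es ds)"
    note IH = Cons.IH[OF s(1), folded S_def]
    have t: "turn e d = (x, y) \<or> turn e d = (y, x)" by (auto simp: turn_def e)
    have n: "(x, y) \<notin> S" "(y, x) \<notin> S"
      using IH s by blast+
    have a: "adj (e # es) p q \<longleftrightarrow> (p, q) = (x, y) \<or> (p, q) = (y, x) \<or> adj es p q" for p q
      by (auto simp: adj_def e)
    have m: "set (map2 turn (e # es) (d # ds)) = insert (turn e d) S"
      by (simp add: S_def)
    show ?case
    proof (intro conjI allI impI)
      have "turn e d \<notin> S" using t n by auto
      then show "distinct (map2 turn (e # es) (d # ds))" using IH by (simp add: S_def)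
      show "adj (e # es) p q" if "(p, q) \<in> set (map2 turn (e # es) (d # ds))" for p q
        using that IH t unfolding m a by auto
      show "((p, q) \<in> set (map2 turn (e # es) (d # ds))) \<noteq> ((q, p) \<in> set (map2 turn (e # es) (d # ds)))"
        if "adj (e # es) p q" for p q
      proof (cases "adj es p q")
        case True
        then have "(p, q) \<noteq> turn e d" "(q, p) \<noteq> turn e d" using t s by auto
        then show ?thesis using IH True unfolding m by auto
      next
        case False
        then have "(p, q) = (x, y) \<or> (p, q) = (y, x)" using that a by simp
        then show ?thesis using t n s(4) unfolding m by (elim disjE) auto
      qed
    qed
  qed
  then show "distinct (map2 turn es ds)"
    and "(p, q) \<in> set (map2 turn es ds) \<Longrightarrow> adj es p q"
    and "adj es p q \<Longrightarrow> ((p, q) \<in> set (map2 turn es ds)) \<noteq> ((q, p) \<in> set (map2 turn es ds))"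
    by blast+
qed

lemma cell_arcs_props:
  assumes "\<not> (k = Join \<and> a \<and> b)"
  shows "distinct (cell_arcs k a b)"
    and "(p, q) \<in> set (cell_arcs k a b) \<Longrightarrow> adj (cell_edges k) p q"
    and "adj (cell_edges k) p q \<Longrightarrow>
      ((p, q) \<in> set (cell_arcs k a b)) \<noteq> ((q, p) \<in> set (cell_arcs k a b))"
  using turn_arcs[OF length_dirs[OF assms] simple_cell] unfolding cell_arcs_def by blast+

lemma label_in_sum:
  assumes "distinct es"
  shows "label_in f es q = (\<Sum>p | (p, q) \<in> set es. f (p, q))"
proof -
  have "label_in f es q = sum f (set (filter (\<lambda>e. snd e = q) es))"
    using assms unfolding label_in_def by (intro sum_list_distinct_conv_sum_set) simp
  also have "set (filter (\<lambda>e. snd e = q) es) = (\<lambda>p. (p, q)) ` {p. (p, q) \<in> set es}"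
    by (auto simp: image_iff)
  also have "sum f \<dots> = (\<Sum>p | (p, q) \<in> set es. f (p, q))"
    by (subst sum.reindex) (auto simp: inj_on_def)
  finally show ?thesis .
qed

lemma Bottom_leaf: "(15, 25) \<in> set (cell_arcs Bottom a b)"
  by (cases b) (simp_all add: cell_arcs_def b_edges_def turn_def)

lemma Top_arcs: "cell_arcs Top a b = [(97, 86)]"
  by (simp add: cell_arcs_def turn_def)

context grid
begin

text \<open>The value \<open>b (Suc R) c\<close> at the bottom is left open: a point may stay
  uncovered at the price of a weight 2 on one edge.\<close>

definition cover_state :: "(nat \<Rightarrow> bool) \<Rightarrow> (nat \<Rightarrow> nat \<Rightarrow> bool) \<Rightarrow> bool" where
  "cover_state a b \<longleftrightarrow> (\<forall>c<C. \<not> b 1 c \<and> (\<forall>r. 1 \<le> r \<and> r \<le> R \<longrightarrow>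
     (if M (r - 1) c then \<not> (a r \<and> b r c) \<and> b (Suc r) c = (a r \<or> b r c) else b (Suc r) c = b r c)))"

definition arcs_at :: "(nat \<Rightarrow> bool) \<Rightarrow> (nat \<Rightarrow> nat \<Rightarrow> bool) \<Rightarrow> nat \<Rightarrow> nat \<Rightarrow> (spot \<times> spot) list" where
  "arcs_at a b r c = cell_arcs (kd r c) (a r) (b r c)"

definition arcs :: "(nat \<Rightarrow> bool) \<Rightarrow> (nat \<Rightarrow> nat \<Rightarrow> bool) \<Rightarrow> (nat \<times> nat) set" where
  "arcs a b = {(pos r c p, pos r c q) | r c p q. r < R + 2 \<and> c < C + 1 \<and> (p, q) \<in> set (arcs_at a b r c)}"

definition weight :: "(nat \<Rightarrow> nat \<Rightarrow> bool) \<Rightarrow> nat set \<Rightarrow> nat" where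
  "weight b e = (if \<exists>c<C. \<not> b (Suc R) c \<and> e = {pos (Suc R) c 15, pos (Suc R) c 25} then 2 else 1)"

lemma kd_Bottom: "kd r c = Bottom \<longleftrightarrow> c < C \<and> r = Suc R"
  by (auto simp: kd_def)

section \<open>The orientation belonging to a consistent state\<close>

context
  fixes a :: "nat \<Rightarrow> bool" and b :: "nat \<Rightarrow> nat \<Rightarrow> bool"
  assumes st: "cover_state a b"
begin

lemma state:
  "kd r c = Cross \<Longrightarrow> b (Suc r) c = b r c"
  "kd r c = Join \<Longrightarrow> \<not> (a r \<and> b r c) \<and> b (Suc r) c = (a r \<or> b r c)"
  "kd r c = Top \<Longrightarrow> \<not> b (Suc r) c"
proof -
  have *: "if M (r - 1) c then \<not> (a r \<and> b r c) \<and> b (Suc r) c = (a r \<or> b r c) else b (Suc r) c = b r c"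
    if "c < C" "1 \<le> r" "r \<le> R"
    using st that unfolding cover_state_def by blast
  show "kd r c = Cross \<Longrightarrow> b (Suc r) c = b r c"
    "kd r c = Join \<Longrightarrow> \<not> (a r \<and> b r c) \<and> b (Suc r) c = (a r \<or> b r c)"
    using * by (auto simp: kd_def split: if_splits)
  show "kd r c = Top \<Longrightarrow> \<not> b (Suc r) c"
    using st by (auto simp: kd_def cover_state_def split: if_splits)
qed

lemma Join_state: "\<not> (kd r c = Join \<and> a r \<and> b r c)"
  using state(2) by blast

lemmas arcs_at_props = cell_arcs_props[OF Join_state, folded arcs_at_def]

lemma good_state:
  "good_arcs (arc_weight (kd r c) (b r c)) (arcs_at a b r c) (outer_labels (a r) (b (Suc r) c))"
proof -
  have "good_cell (kd r c) (a r) (b r c) (a r) (b (Suc r) c)"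
  proof (cases "kd r c")
    case Cross
    then have "b (Suc r) c = b r c" by (rule state)
    then show ?thesis using good_Cross Cross by simp
  next
    case Join
    then have "b (Suc r) c = (a r \<or> b r c)" using state(2) by blast
    then show ?thesis using good_Join[of "a r" "b r c"] Join Join_state[of r c] by simp
  next
    case Top
    then have "\<not> b (Suc r) c" by (rule state)
    then show ?thesis using good_Top Top by simp
  qed (simp_all add: good_Bottom good_End good_Void)
  then show ?thesis by (simp add: good_cell_def arcs_at_def)
qed

lemma arc_at:
  assumes "(p, q) \<in> set (arcs_at a b r c)"
  shows "inbox q" "label_in (arc_weight (kd r c) (b r c)) (arcs_at a b r c) q \<le> 2"
    "inbox p \<Longrightarrow> label_in (arc_weight (kd r c) (b r c)) (arcs_at a b r c) p \<noteq>
       label_in (arc_weight (kd r c) (b r c)) (arcs_at a b r c) q"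
    "\<not> inbox p \<Longrightarrow> \<exists>x. map_of (outer_labels (a r) (b (Suc r) c)) p = Some x \<and>
       x \<noteq> label_in (arc_weight (kd r c) (b r c)) (arcs_at a b r c) q"
  using good_state[of r c] assms
  by (auto simp: good_arcs_def list_all_iff Let_def dest!: bspec[of _ _ "(p, q)"])

text \<open>Arcs end inside the cell that lists them. Hence also at a port, where edges of other
  cells meet, all entering arcs come from the cell of the port itself.\<close>

lemma in_nbs:
  assumes "inbox q" "r < R + 2" "c < C + 1"
  shows "{z. (z, pos r c q) \<in> arcs a b} = pos r c ` {p. (p, q) \<in> set (arcs_at a b r c)}"
proof
  show "{z. (z, pos r c q) \<in> arcs a b} \<subseteq> pos r c ` {p. (p, q) \<in> set (arcs_at a b r c)}"
  proof
    fix z assume "z \<in> {z. (z, pos r c q) \<in> arcs a b}"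
    then obtain r' c' p' q' where *: "z = pos r' c' p'" "pos r c q = pos r' c' q'" "c' < C + 1"
      "(p', q') \<in> set (arcs_at a b r' c')"
      by (auto simp: arcs_def)
    from pos_eq[of q q' c c' r r'] arc_at(1)[OF *(4)] assms *(2,3)
    have "r = r'" "c = c'" "q = q'" by auto
    then show "z \<in> pos r c ` {p. (p, q) \<in> set (arcs_at a b r c)}" using * by blast
  qed
  show "pos r c ` {p. (p, q) \<in> set (arcs_at a b r c)} \<subseteq> {z. (z, pos r c q) \<in> arcs a b}"
    using assms by (auto simp: arcs_def)
qed

lemma weight_at:
  assumes "(p, q) \<in> set (arcs_at a b r c)" "r < R + 2" "c < C + 1"
  shows "weight b {pos r c p, pos r c q} = arc_weight (kd r c) (b r c) (p, q)"
proof -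
  have q: "inbox q" by (rule arc_at(1)[OF assms(1)])
  have pq: "adj (cell_edges (kd r c)) p q" by (rule arcs_at_props(2)[OF assms(1)])
  have spot: "inbox 15" "inbox 25" by (auto simp: inbox_def)
  have "(\<exists>c'<C. \<not> b (Suc R) c' \<and> {pos r c p, pos r c q} = {pos (Suc R) c' 15, pos (Suc R) c' 25}) \<longleftrightarrow>
    kd r c = Bottom \<and> \<not> b r c \<and> (p, q) = (15, 25)"
  proof
    assume "\<exists>c'<C. \<not> b (Suc R) c' \<and> {pos r c p, pos r c q} = {pos (Suc R) c' 15, pos (Suc R) c' 25}"
    then obtain c' where c': "c' < C" "\<not> b (Suc R) c'"
      "{pos r c p, pos r c q} = {pos (Suc R) c' 15, pos (Suc R) c' 25}" by blast
    then have "pos r c q = pos (Suc R) c' 15 \<or> pos r c q = pos (Suc R) c' 25" by (auto simp: doubleton_eq_iff)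
    then have rc: "r = Suc R" "c = c'" "q = 15 \<or> q = 25"
      using pos_eq[OF q spot(1)] pos_eq[OF q spot(2)] c'(1) assms(3) by auto
    have B: "kd r c = Bottom" using rc c' by (simp add: kd_Bottom)
    have p: "inbox p"
      using inner_cells[of "kd r c"] B pq by (auto simp: adj_def list_all_iff)
    have "p = 15 \<and> q = 25 \<or> p = 25 \<and> q = 15"
      using c'(3) rc pos_eq[OF p spot(1)] pos_eq[OF p spot(2)] pos_eq[OF q spot(1)] pos_eq[OF q spot(2)]
        assms(3) by (auto simp: doubleton_eq_iff)
    \<comment> \<open>The leaf edge of a bottom cell is directed towards the leaf, so it does not
      occur the other way round.\<close>
    moreover have "(25, 15) \<notin> set (arcs_at a b r c)"
      using Bottom_leaf[of "a r" "b r c"] arcs_at_props(3)[of r c 15 25] arcs_at_props(2)[of 15 25 r c] B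
      by (auto simp: arcs_at_def)
    ultimately show "kd r c = Bottom \<and> \<not> b r c \<and> (p, q) = (15, 25)"
      using B rc c' assms(1) by auto
  next
    assume *: "kd r c = Bottom \<and> \<not> b r c \<and> (p, q) = (15, 25)"
    then show "\<exists>c'<C. \<not> b (Suc R) c' \<and> {pos r c p, pos r c q} = {pos (Suc R) c' 15, pos (Suc R) c' 25}"
      using kd_Bottom[of r c] by auto
  qed
  then show ?thesis by (simp add: weight_def arc_weight_def)
qed

lemma in_weight_at:
  assumes "inbox q" "r < R + 2" "c < C + 1"
  shows "in_weight (arcs a b) (weight b) (pos r c q) =
    label_in (arc_weight (kd r c) (b r c)) (arcs_at a b r c) q"
proof -
  have "in_weight (arcs a b) (weight b) (pos r c q) =
    (\<Sum>z\<in>pos r c ` {p. (p, q) \<in> set (arcs_at a b r c)}. weight b {z, pos r c q})"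
    unfolding in_weight_def in_nbs[OF assms] ..
  also have "\<dots> = (\<Sum>p | (p, q) \<in> set (arcs_at a b r c). weight b {pos r c p, pos r c q})"
  proof (subst sum.reindex)
    show "inj_on (pos r c) {p. (p, q) \<in> set (arcs_at a b r c)}"
      by (rule inj_on_subset[OF inj_adj[OF assms(3), of r q]])
        (use arcs_at_props(2) in \<open>auto simp: adj_def\<close>)
  qed simp
  also have "\<dots> = (\<Sum>p | (p, q) \<in> set (arcs_at a b r c). arc_weight (kd r c) (b r c) (p, q))"
    by (intro sum.cong) (use weight_at assms in auto)
  finally show ?thesis using label_in_sum[OF arcs_at_props(1)] by simp
qed

lemma a_weights:
  assumes "kd r c \<in> {Cross, Join, End}" "r < R + 2" "c < C + 1" "(p, l) \<in> set (a_labels (a r))"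
  shows "in_weight (arcs a b) (weight b) (pos r c p) = l"
proof -
  have p: "inbox p" using assms(4) by (auto simp: a_labels_def inbox_def)
  have "net_labels (arc_weight (kd r c) (b r c)) (arcs_at a b r c) (a_labels (a r))"
    unfolding arcs_at_def
    using assms(1) net_labels_Cross[of "b r c" "a r"] net_labels_Join[of "a r" "b r c"]
      net_labels_End[of "b r c" "a r"] Join_state[of r c] by (auto simp: net_labels_def)
  then show ?thesis
    using assms(4) in_weight_at[OF p assms(2,3)] by (auto simp: net_labels_def list_all_iff)
qed

lemma b_weights:
  assumes "kd r c \<in> {Cross, Join, Bottom}" "r < R + 2" "c < C + 1" "(p, l) \<in> set (b_labels (b r c))"
  shows "in_weight (arcs a b) (weight b) (pos r c p) = l"
proof -
  have p: "inbox p" using assms(4) by (auto simp: b_labels_def inbox_def)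
  have "net_labels (arc_weight (kd r c) (b r c)) (arcs_at a b r c) (b_labels (b r c))"
    unfolding arcs_at_def
    using assms(1) net_labels_Cross[of "b r c" "a r"] net_labels_Join[of "a r" "b r c"]
      net_labels_Bottom[of "b r c" "a r"] Join_state[of r c] by (auto simp: net_labels_def)
  then show ?thesis
    using assms(4) in_weight_at[OF p assms(2,3)] by (auto simp: net_labels_def list_all_iff)
qed

text \<open>The table assumed for the vertices outside a cell is realized by the networks of the
  neighbours: the one on the right has the same row bit, and the one below has the column bit
  \<open>b (Suc r) c\<close>.\<close>

lemma outer_weight:
  assumes "(p, q) \<in> set (arcs_at a b r c)" "\<not> inbox p" "map_of (outer_labels (a r) (b (Suc r) c)) p = Some x"
  shows "in_weight (arcs a b) (weight b) (pos r c p) = x"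
proof -
  have pq: "adj (cell_edges (kd r c)) p q" by (rule arcs_at_props(2)[OF assms(1)])
  then have po: "p \<in> outer" using edge_spots assms(2) unfolding adj_def by blast
  then have l: "c < C" "r \<le> R" using pq outer_edge unfolding adj_def by blast+
  have x: "(p, x) \<in> set (outer_labels (a r) (b (Suc r) c))" by (rule map_of_SomeD[OF assms(3)])
  show ?thesis
  proof (cases "p \<in> {59, 69, 79}")
    case True
    then have "kd r c \<noteq> Top" using assms(1) by (auto simp: arcs_at_def Top_arcs)
    then have "kd r (Suc c) \<in> {Cross, Join, End}" using l by (auto simp: kd_def split: if_splits)
    moreover have "(p - 9, x) \<in> set (a_labels (a r))"
      using x True by (auto simp: outer_labels_def a_labels_def b_labels_def)
    ultimately show ?thesis
      using a_weights[of r "Suc c" "p - 9" x] pos_right[OF True] l by simp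
  next
    case False
    then have p: "p \<in> {95, 96, 97}" using po by (auto simp: outer_def)
    have "kd (Suc r) c \<in> {Cross, Join, Bottom}" using l by (auto simp: kd_def)
    moreover have "(p - 90, x) \<in> set (b_labels (b (Suc r) c))"
      using x p by (auto simp: outer_labels_def a_labels_def b_labels_def)
    ultimately show ?thesis
      using b_weights[of "Suc r" c "p - 90" x] pos_below[OF p] l by simp
  qed
qed

text \<open>An arc across a border comes from the right or from below, so the sum of the cell
  indices drops by one along it. This prevents an edge from being directed both ways.\<close>

lemma arc_cases:
  assumes "(u, v) \<in> arcs a b"
  obtains r c q r' c' p where "v = pos r c q" "inbox q" "c < C + 1" "u = pos r' c' p" "inbox p" "c' < C + 1"
    "r' = r \<and> c' = c \<and> (p, q) \<in> set (arcs_at a b r c) \<or> r' + c' = Suc (r + c)"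
proof -
  obtain r c p q where *: "u = pos r c p" "v = pos r c q" "r < R + 2" "c < C + 1"
    "(p, q) \<in> set (arcs_at a b r c)" using assms by (auto simp: arcs_def)
  have q: "inbox q" by (rule arc_at(1)[OF *(5)])
  have pq: "adj (cell_edges (kd r c)) p q" by (rule arcs_at_props(2)[OF *(5)])
  show ?thesis
  proof (cases "inbox p")
    case True
    then show ?thesis using that[of r c q r c p] * q by blast
  next
    case False
    then have po: "p \<in> outer" using pq edge_spots unfolding adj_def by blast
    then have l: "c < C" "r \<le> R" using pq outer_edge unfolding adj_def by blast+
    show ?thesis
    proof (cases "p \<in> {59, 69, 79}")
      case True
      then show ?thesis
        using that[of r c q r "Suc c" "p - 9"] * q l pos_right[OF True, of r c] by (auto simp: inbox_def)
    next
      case False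
      then have p: "p \<in> {95, 96, 97}" using po by (auto simp: outer_def)
      then show ?thesis
        using that[of r c q "Suc r" c "p - 90"] * q l pos_below[OF p, of r c] by (auto simp: inbox_def)
    qed
  qed
qed

lemma arcs_asym: "(u, v) \<in> arcs a b \<Longrightarrow> (v, u) \<notin> arcs a b"
proof
  assume 1: "(u, v) \<in> arcs a b" and 2: "(v, u) \<in> arcs a b"
  obtain r c q r' c' p where *: "v = pos r c q" "inbox q" "c < C + 1" "u = pos r' c' p" "inbox p" "c' < C + 1"
    "r' = r \<and> c' = c \<and> (p, q) \<in> set (arcs_at a b r c) \<or> r' + c' = Suc (r + c)"
    by (rule arc_cases[OF 1])
  obtain s d y s' d' x where **: "u = pos s d y" "inbox y" "d < C + 1" "v = pos s' d' x" "inbox x" "d' < C + 1"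
    "s' = s \<and> d' = d \<and> (x, y) \<in> set (arcs_at a b s d) \<or> s' + d' = Suc (s + d)"
    by (rule arc_cases[OF 2])
  have "r' = s" "c' = d" "p = y" "r = s'" "c = d'" "q = x"
    using pos_eq[of p y c' d r' s] pos_eq[of q x c d' r s'] * ** by auto
  then have "(p, q) \<in> set (arcs_at a b r c)" "(q, p) \<in> set (arcs_at a b r c)" using * ** by auto
  then show False using arcs_at_props(2,3) by blast
qed

text \<open>Incomplete covers are included. The all-false state yields the upper bound 2 for the
  graph, and a state in which every point is covered yields unit weights.\<close>

theorem realize:
  shows "semi_proper edges (arcs a b) (weight b)" "in_weight (arcs a b) (weight b) v \<le> 2"
proof -
  have "orientation edges (arcs a b)"
    unfolding orientation_def
  proof (intro conjI allI impI ballI)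
    fix uv assume "uv \<in> arcs a b"
    then obtain r c p q where *: "uv = (pos r c p, pos r c q)" "r < R + 2" "c < C + 1"
      "(p, q) \<in> set (arcs_at a b r c)" by (auto simp: arcs_def)
    then show "case uv of (u, v) \<Rightarrow> {u, v} \<in> edges"
      using edgesI[OF arcs_at_props(2)] by simp
  next
    fix u v assume "{u, v} \<in> edges"
    then obtain r c p q where *: "{u, v} = {pos r c p, pos r c q}" "r < R + 2" "c < C + 1"
      "(p, q) \<in> set (cell_edges (kd r c))" by (auto simp: edges_def)
    then have "(pos r c p, pos r c q) \<in> arcs a b \<or> (pos r c q, pos r c p) \<in> arcs a b"
      using arcs_at_props(3)[of r c p q] by (auto simp: arcs_def adj_def)
    then show "((u, v) \<in> arcs a b) \<noteq> ((v, u) \<in> arcs a b)"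
      using *(1) arcs_asym by (auto simp: doubleton_eq_iff)
  qed
  moreover have differ: "in_weight (arcs a b) (weight b) u \<noteq> in_weight (arcs a b) (weight b) v"
    if uv: "(u, v) \<in> arcs a b" for u v
  proof -
    obtain r c p q where *: "u = pos r c p" "v = pos r c q" "r < R + 2" "c < C + 1"
      "(p, q) \<in> set (arcs_at a b r c)" using uv by (auto simp: arcs_def)
    show ?thesis
    proof (cases "inbox p")
      case True
      then show ?thesis
        using * arc_at(1,3)[OF *(5)] in_weight_at[of _ r c] by auto
    next
      case False
      then show ?thesis
        using * arc_at(1)[OF *(5)] arc_at(4)[OF *(5) False] in_weight_at[of q r c]
          outer_weight[OF *(5) False] by auto
    qed
  qed
  ultimately show "semi_proper edges (arcs a b) (weight b)"
    unfolding semi_proper_def orientation_def by (auto simp: weight_def) (metis differ)+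
  show "in_weight (arcs a b) (weight b) v \<le> 2"
  proof (cases "\<exists>u. (u, v) \<in> arcs a b")
    case True
    then obtain r c p q where *: "v = pos r c q" "r < R + 2" "c < C + 1"
      "(p, q) \<in> set (arcs_at a b r c)" by (auto simp: arcs_def)
    then show ?thesis using arc_at(1,2)[OF *(4)] in_weight_at[of q r c] by simp
  next
    case False
    then show ?thesis by (simp add: in_weight_def)
  qed
qed

end

end

section \<open>The graph of an exact cover instance\<close>

definition has_cover :: "nat \<Rightarrow> nat \<Rightarrow> (nat \<Rightarrow> nat \<Rightarrow> bool) \<Rightarrow> bool" where
  "has_cover R C M \<longleftrightarrow> (\<exists>sel. \<forall>c<C. \<exists>!r. r < R \<and> M r c \<and> sel r)"

definition unit_step :: "spot \<times> spot \<Rightarrow> bool" where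
  "unit_step e \<longleftrightarrow> (let (p, q) = e in
     (q mod 10 - p mod 10, q div 10 - p div 10) \<in> set [(1, 0), (0, 1), (1, 1)] \<or>
     (p mod 10 - q mod 10, p div 10 - q div 10) \<in> set [(1, 0), (0, 1), (1, 1)])"

lemma unit_steps: "list_all unit_step (cell_edges k)"
  by (rule kind_all[where P = "\<lambda>k. list_all unit_step (cell_edges k)"]) code_simp

section \<open>Planarity, the number 2, and correctness of the graph\<close>

context grid
begin

abbreviation verts :: "nat set" where
  "verts \<equiv> {..<height * width}"

lemma edge_cases:
  assumes "e \<in> edges"
  obtains r c p q where "e = {pos r c p, pos r c q}" "r < R + 2" "c < C + 1"
    "(p, q) \<in> set (cell_edges (kd r c))" "pos r c p \<in> verts" "pos r c q \<in> verts" "pos r c p \<noteq> pos r c q"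
    "0 \<le> p" "0 \<le> q" "c < C \<or> p mod 10 < 9" "c < C \<or> q mod 10 < 9"
proof -
  obtain r c p q where *: "e = {pos r c p, pos r c q}" "r < R + 2" "c < C + 1"
    "(p, q) \<in> set (cell_edges (kd r c))" using assms by (auto simp: edges_def)
  have v: "pos r c x \<in> verts" if "x \<in> {p, q}" for x
    using spot_pos[OF *(4,2,3) that] pos_less by (metis lessThan_iff)
  have s: "0 \<le> p" "0 \<le> q" "c < C \<or> inbox p" "c < C \<or> inbox q"
    using adj_spot[of r c p q] adj_spot[of r c q p] *(4) by (auto simp: adj_def)
  then have m: "c < C \<or> p mod 10 < 9" "c < C \<or> q mod 10 < 9" by (auto simp: inbox_def)
  have "p \<noteq> q" by (rule edge_spots(1)[OF *(4)])
  then have "pos r c p \<noteq> pos r c q" using pos_inj[of r c p q] s m *(3) by auto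
  then show ?thesis using that[OF *] v s m by blast
qed

lemma finite_edges: "finite edges"
proof (rule finite_subset)
  show "edges \<subseteq> Pow verts" by (auto elim!: edge_cases)
qed simp

lemma simple_edges: "simple_graph verts edges"
  unfolding simple_graph_def by (auto elim!: edge_cases)

lemma div_mod_row: "y < w \<Longrightarrow> (x * w + y) div w = x" "y < w \<Longrightarrow> (x * w + y) mod w = (y :: nat)"
  by auto

lemma pos_coords:
  assumes "0 \<le> p" "c < C \<or> p mod 10 < 9" "c < C + 1"
  shows "int (pos r c p mod width) = 9 * int c + p mod 10" "int (pos r c p div width) = 9 * int r + p div 10"
proof -
  have "nat (p mod 10) < 10" by simp
  then have "c < C \<and> nat (p mod 10) < 10 \<or> nat (p mod 10) < 9" using assms(2) by auto
  then have w: "9 * c + nat (p mod 10) < width" using assms(3) unfolding width_def by auto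
  have "pos r c p mod width = 9 * c + nat (p mod 10)" "pos r c p div width = 9 * r + nat (p div 10)"
    unfolding pos_def using div_mod_row[OF w] by blast+
  then show "int (pos r c p mod width) = 9 * int c + p mod 10"
    "int (pos r c p div width) = 9 * int r + p div 10"
    using assms(1) by (simp_all add: pos_imp_zdiv_nonneg_iff)
qed

lemma planar_edges: "planar verts edges"
proof (rule planar_lattice)
  let ?f = "\<lambda>n. (int (n mod width), int (n div width))"
  show "inj_on ?f verts"
    by (rule inj_onI) (metis div_mult_mod_eq of_nat_eq_iff prod.inject)
  fix e assume "e \<in> edges"
  then obtain r c p q where *: "e = {pos r c p, pos r c q}" "c < C + 1"
    "(p, q) \<in> set (cell_edges (kd r c))" "pos r c p \<in> verts" "pos r c q \<in> verts"
    "0 \<le> p" "0 \<le> q" "c < C \<or> p mod 10 < 9" "c < C \<or> q mod 10 < 9"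
    by (auto elim!: edge_cases)
  have "unit_step (p, q)" using unit_steps[of "kd r c"] *(3) by (auto simp: list_all_iff)
  moreover have "?f (pos r c q) - ?f (pos r c p) = (q mod 10 - p mod 10, q div 10 - p div 10)"
    "?f (pos r c p) - ?f (pos r c q) = (p mod 10 - q mod 10, p div 10 - q div 10)"
    using pos_coords[of p c r] pos_coords[of q c r] * by simp_all
  ultimately have "?f (pos r c q) - ?f (pos r c p) \<in> {(1, 0), (0, 1), (1, 1)} \<or>
      ?f (pos r c p) - ?f (pos r c q) \<in> {(1, 0), (0, 1), (1, 1)}"
    unfolding unit_step_def Let_def prod.case by (metis list.simps(15) list.set(1))
  moreover have "e = {pos r c q, pos r c p}" using *(1) by (simp only: insert_commute)
  ultimately show "\<exists>u\<in>verts. \<exists>v\<in>verts. e = {u, v} \<and> ?f v - ?f u \<in> {(1, 0), (0, 1), (1, 1)}"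
    using *(1,4,5) by blast
qed

lemma width_pos: "0 < width" "0 < height"
  by (simp_all add: width_def height_def)

lemma max_le: "(\<And>v. in_weight D w v \<le> k) \<Longrightarrow> max_in_weight verts D w \<le> k"
proof -
  have "0 \<in> verts" using width_pos by simp
  then have "verts \<noteq> {}" by blast
  then show "(\<And>v. in_weight D w v \<le> k) \<Longrightarrow> ?thesis"
    unfolding max_in_weight_def by (rule cSUP_least)
qed

lemma le_max: "v \<in> verts \<Longrightarrow> in_weight D w v \<le> max_in_weight verts D w"
  unfolding max_in_weight_def by (rule cSUP_upper) auto

text \<open>Three distinct in-weights on a triangle cannot all be below 2, whatever the weights are.
  Cell (1, 0) contains a triangle of the row network as soon as the matrix has a row, even for
  \<open>C = 0\<close>.\<close>

lemma max_ge:
  assumes "0 < R" "semi_proper edges D w"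
  shows "2 \<le> max_in_weight verts D w"
proof -
  have k: "kd 1 0 \<in> {Cross, Join, End}" using assms(1) by (auto simp: kd_def)
  have "a_net_at (cell_edges (kd 1 0))" using k net_checks(1) by auto
  then have "lnb (cell_edges (kd 1 0)) 61 [51, 62]" "lnb (cell_edges (kd 1 0)) 62 [51, 61]"
    unfolding a_net_at_def pair_at_def by blast+
  then have "adj (cell_edges (kd 1 0)) 61 51" "adj (cell_edges (kd 1 0)) 61 62" "adj (cell_edges (kd 1 0)) 62 51"
    using lnb_set by (metis list.set_intros mem_Collect_eq)+
  from this[THEN edgesI[of 1 0]] have e: "{pos 1 0 61, pos 1 0 51} \<in> edges"
    "{pos 1 0 61, pos 1 0 62} \<in> edges" "{pos 1 0 62, pos 1 0 51} \<in> edges" by auto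
  let ?l = "in_weight D w"
  have "?l (pos 1 0 61) \<noteq> ?l (pos 1 0 51)" "?l (pos 1 0 61) \<noteq> ?l (pos 1 0 62)" "?l (pos 1 0 62) \<noteq> ?l (pos 1 0 51)"
    using assms(2) e unfolding semi_proper_def by blast+
  then have "2 \<le> ?l (pos 1 0 61) \<or> 2 \<le> ?l (pos 1 0 51) \<or> 2 \<le> ?l (pos 1 0 62)" by arith
  moreover have "pos 1 0 61 \<in> verts" "pos 1 0 51 \<in> verts" "pos 1 0 62 \<in> verts"
    using pos_less[of _ 1 0] by (auto simp: inbox_def)
  ultimately show ?thesis using le_max[of _ D w] by (meson order_trans)
qed

text \<open>If nothing is selected, every column bit stays false without violating a joining cell,
  so this state exists for every matrix.\<close>

lemma semi_proper_number_2:
  assumes "0 < R"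
  shows "semi_proper_number verts edges = 2"
proof (rule antisym)
  define a :: "nat \<Rightarrow> bool" where "a = (\<lambda>_. False)"
  define b :: "nat \<Rightarrow> nat \<Rightarrow> bool" where "b = (\<lambda>_ _. False)"
  have st: "cover_state a b" by (simp add: cover_state_def a_def b_def)
  have "semi_proper_number verts edges \<le> (case (arcs a b, weight b) of (D, w) \<Rightarrow> max_in_weight verts D w)"
    unfolding semi_proper_number_def by (rule cINF_lower) (use realize(1)[OF st] in auto)
  also have "\<dots> \<le> 2" using max_le realize(2)[OF st] by simp
  finally show "semi_proper_number verts edges \<le> 2" .
  show "2 \<le> semi_proper_number verts edges"
    unfolding semi_proper_number_def
    by (rule cINF_greatest) (use realize(1)[OF st] max_ge[OF assms] in auto)
qed

lemma admissible: "0 < R \<Longrightarrow> admissible verts edges"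
  by (simp add: admissible_def simple_edges planar_edges semi_proper_number_2)

theorem unweighted_iff_cover:
  assumes "0 < R"
  shows "has_unweighted_optimum verts edges \<longleftrightarrow> has_cover R C M"
proof
  assume "has_unweighted_optimum verts edges"
  then obtain D w where *: "semi_proper edges D w" "max_in_weight verts D w = 2" "\<forall>e\<in>edges. w e = 1"
    using semi_proper_number_2[OF assms] by (auto simp: has_unweighted_optimum_def optimal_semi_proper_def)
  have o: "orientation edges D" using *(1) by (simp add: semi_proper_def)
  then have E: "{u, v} \<in> edges" if "(u, v) \<in> D" for u v using that by (auto simp: orientation_def)
  have l: "in_weight D w v = card {z. (z, v) \<in> D}" for v
    unfolding in_weight_def using E *(3) by (subst card_eq_sum) (auto intro!: sum.cong)
  interpret grid_solution R C M D
  proof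
    show "orientation edges D" by (rule o)
    show "card e = 2" if "e \<in> edges" for e using that simple_edges by (auto simp: simple_graph_def)
    show "finite edges" by (rule finite_edges)
    show "card {z. (z, v) \<in> D} \<le> 2" for v
    proof (cases "v \<in> verts")
      case True
      then show ?thesis using le_max[of v D w] *(2) by (simp add: l)
    next
      case False
      have "{z. (z, v) \<in> D} = {}"
        using False E simple_edges unfolding simple_graph_def by blast
      then show ?thesis by simp
    qed
    show "card {z. (z, u) \<in> D} \<noteq> card {z. (z, v) \<in> D}" if "{u, v} \<in> edges" for u v
      using *(1) that unfolding semi_proper_def l by blast
  qed
  show "has_cover R C M"
    unfolding has_cover_def using exact_cover by (intro exI[of _ "\<lambda>r. A (Suc r) 0"]) blast
next
  assume "has_cover R C M"
  then obtain sel where sel: "\<And>c. c < C \<Longrightarrow> \<exists>!r. r < R \<and> M r c \<and> sel r" by (auto simp: has_cover_def)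
  define a where "a r = sel (r - 1)" for r :: nat
  \<comment> \<open>On its way to grid row \<open>r\<close> a column has passed the grid rows
    \<open>Suc r'\<close> with \<open>Suc r' < r\<close>, each of which holds the set
    \<open>r'\<close>.\<close>
  define b where "b r c = (\<exists>r'. Suc r' < r \<and> M r' c \<and> sel r')" for r c :: nat
  have st: "cover_state a b"
    unfolding cover_state_def
  proof (intro allI impI conjI)
    fix c assume c: "c < C"
    show "\<not> b 1 c" by (simp add: b_def)
    fix r assume "1 \<le> r \<and> r \<le> R"
    then obtain s where s: "r = Suc s" "s < R" by (cases r) auto
    have 1: "b (Suc r) c \<longleftrightarrow> M s c \<and> sel s \<or> b r c"
      unfolding b_def s(1) by (auto simp: less_Suc_eq)
    have 2: "\<not> (M s c \<and> sel s \<and> b r c)"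
    proof
      assume "M s c \<and> sel s \<and> b r c"
      then obtain r' where "r' < s" "M r' c" "sel r'" "M s c" "sel s" by (auto simp: b_def s(1))
      then show False using sel[OF c] s(2) by (metis less_irrefl less_trans)
    qed
    show "if M (r - 1) c then \<not> (a r \<and> b r c) \<and> b (Suc r) c = (a r \<or> b r c) else b (Suc r) c = b r c"
      using 1 2 by (auto simp: a_def s(1))
  qed
  have full: "b (Suc R) c" if "c < C" for c
    using sel[OF that] by (auto simp: b_def)
  have "semi_proper edges (arcs a b) (weight b)" by (rule realize(1)[OF st])
  moreover have "max_in_weight verts (arcs a b) (weight b) = 2"
    using max_le[OF realize(2)[OF st]] max_ge[OF assms realize(1)[OF st]] by (rule antisym)
  moreover have "\<forall>e\<in>edges. weight b e = 1" using full by (simp add: weight_def)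
  ultimately show "has_unweighted_optimum verts edges"
    unfolding has_unweighted_optimum_def optimal_semi_proper_def semi_proper_number_2[OF assms]
    by (intro exI[of _ "arcs a b"] exI[of _ "weight b"] conjI)
qed

end

section \<open>Tilings as exact covers\<close>

text \<open>Tiles are numbered; \<open>hE\<close> and \<open>hW\<close> are the colours of the right and left side of a tile,
  \<open>vN\<close> and \<open>vS\<close> those of the side towards the next and the previous row.\<close>

locale tiling =
  fixes T W nd nh nv :: nat and al :: "nat \<Rightarrow> nat \<Rightarrow> nat \<Rightarrow> bool" and hE hW vN vS :: "nat \<Rightarrow> nat"
  assumes colours: "d < nd \<Longrightarrow> hE d < nh" "d < nd \<Longrightarrow> vN d < nv"
begin

definition tiles :: "(nat \<Rightarrow> nat \<Rightarrow> nat) \<Rightarrow> bool" where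
  "tiles \<tau> \<longleftrightarrow> (\<forall>t<T. \<forall>i<W. \<tau> t i < nd \<and> al t i (\<tau> t i) \<and>
     (Suc i < W \<longrightarrow> hE (\<tau> t i) = hW (\<tau> t (Suc i))) \<and>
     (Suc t < T \<longrightarrow> vN (\<tau> t i) = vS (\<tau> (Suc t) i)))"

definition nk :: nat where
  "nk = Suc (nh + nv)"

text \<open>At the right and the upper border no neighbour exists, so there the tile covers all
  colour columns of that side by itself.\<close>

definition own :: "nat \<Rightarrow> nat \<Rightarrow> nat \<Rightarrow> nat \<Rightarrow> bool" where
  "own t i k d \<longleftrightarrow> k = 0 \<or> (0 < k \<and> k \<le> nh \<and> (Suc i = W \<or> k = Suc (hE d))) \<or>
     (nh < k \<and> (Suc t = T \<or> k = Suc (nh + vN d)))"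

definition right :: "nat \<Rightarrow> nat \<Rightarrow> bool" where
  "right k d \<longleftrightarrow> 0 < k \<and> k \<le> nh \<and> k \<noteq> Suc (hW d)"

definition up :: "nat \<Rightarrow> nat \<Rightarrow> bool" where
  "up k d \<longleftrightarrow> nh < k \<and> k \<noteq> Suc (nh + vS d)"

text \<open>For every place there is one column for the place, one for every colour of its right side
  and one for every colour of its upper side; a column of a colour \<open>\<chi>\<close> is covered once iff either both
  tiles or none of the two tiles at this side have colour \<open>\<chi>\<close> there.\<close>

definition inc :: "nat \<Rightarrow> nat \<Rightarrow> nat \<Rightarrow> nat \<Rightarrow> nat \<Rightarrow> nat \<Rightarrow> bool" where
  "inc t i d t' i' k \<longleftrightarrow> al t i d \<and>
     (t = t' \<and> i = i' \<and> own t' i' k d \<or> t = t' \<and> i = Suc i' \<and> right k d \<or> t = Suc t' \<and> i = i' \<and> up k d)"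

definition row :: "nat \<Rightarrow> nat \<Rightarrow> nat \<Rightarrow> nat" where
  "row t i d = (t * W + i) * nd + d"

definition column :: "nat \<Rightarrow> nat \<Rightarrow> nat \<Rightarrow> nat" where
  "column t i k = (t * W + i) * nk + k"

definition mat :: "nat \<Rightarrow> nat \<Rightarrow> bool" where
  "mat r c \<longleftrightarrow> (\<exists>t<T. \<exists>i<W. \<exists>d<nd. \<exists>t'<T. \<exists>i'<W. \<exists>k<nk.
     r = row t i d \<and> c = column t' i' k \<and> inc t i d t' i' k)"

lemma row_eq: "i < W \<Longrightarrow> i' < W \<Longrightarrow> d < nd \<Longrightarrow> d' < nd \<Longrightarrow>
    row t i d = row t' i' d' \<longleftrightarrow> t = t' \<and> i = i' \<and> d = d'"
  by (simp add: row_def row_col_eq)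

lemma column_eq: "i < W \<Longrightarrow> i' < W \<Longrightarrow> d < nk \<Longrightarrow> d' < nk \<Longrightarrow>
    column t i d = column t' i' d' \<longleftrightarrow> t = t' \<and> i = i' \<and> d = d'"
  by (simp add: column_def row_col_eq)

lemma index_less: "t < T \<Longrightarrow> i < W \<Longrightarrow> d < n \<Longrightarrow> (t * W + i) * n + d < T * W * n"
proof -
  assume a: "t < T" "i < W" "d < n"
  have "t * W + i < Suc t * W" using a by simp
  also have "\<dots> \<le> T * W" using a by (intro mult_right_mono) auto
  finally have "Suc (t * W + i) * n \<le> T * W * n" by (intro mult_right_mono) auto
  then show ?thesis using a by simp
qed

lemma index_split:
  assumes "c < T * W * n"
  obtains t i d where "t < T" "i < W" "d < n" "c = (t * W + i) * n + d"
proof -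
  have n: "0 < n" "0 < W" using assms by (auto intro: gr0I)
  have 1: "c div n < T * W" using assms n by (simp add: less_mult_imp_div_less)
  have 2: "c div n div W < T" using 1 by (simp add: less_mult_imp_div_less)
  show ?thesis
    by (rule that[of "c div n div W" "c div n mod W" "c mod n"]) (use n 2 in auto)
qed

lemma mat_row_column:
  assumes "i < W" "d < nd" "t' < T" "i' < W" "k < nk" "t < T"
  shows "mat (row t i d) (column t' i' k) \<longleftrightarrow> inc t i d t' i' k"
proof
  assume "mat (row t i d) (column t' i' k)"
  then obtain t2 i2 d2 t3 i3 k3 where *: "i2 < W" "d2 < nd" "i3 < W" "k3 < nk"
    and e: "row t i d = row t2 i2 d2" "column t' i' k = column t3 i3 k3" and c: "inc t2 i2 d2 t3 i3 k3"
    unfolding mat_def by blast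
  have "t = t2 \<and> i = i2 \<and> d = d2" "t' = t3 \<and> i' = i3 \<and> k = k3"
    using e by (simp_all only: row_eq[OF assms(1) *(1) assms(2) *(2)] column_eq[OF assms(4) *(3) assms(5) *(4)])
  then show "inc t i d t' i' k" using c by (elim conjE) (simp only:)
next
  assume "inc t i d t' i' k"
  then show "mat (row t i d) (column t' i' k)"
    unfolding mat_def using assms by (intro exI conjI) (assumption | rule refl)+
qed

text \<open>The column with \<open>k = 0\<close> selects one tile per place. If two sides disagree,
  consider the colour of the left or lower tile: its column is covered by this tile and also by the
  neighbour, which covers all colours that its own side lacks.\<close>

theorem cover_iff_tiling: "has_cover (T * W * nd) (T * W * nk) mat \<longleftrightarrow> (\<exists>\<tau>. tiles \<tau>)"
proof
  assume "has_cover (T * W * nd) (T * W * nk) mat"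
  then obtain sel where sel: "\<And>c. c < T * W * nk \<Longrightarrow> \<exists>!r. r < T * W * nd \<and> mat r c \<and> sel r"
    by (auto simp: has_cover_def)
  have ex: "\<exists>t i d. t < T \<and> i < W \<and> d < nd \<and> inc t i d t' i' k \<and> sel (row t i d)"
    if a: "t' < T" "i' < W" "k < nk" for t' i' k
  proof -
    have "column t' i' k < T * W * nk" using index_less[OF a] by (simp add: column_def)
    from ex1_implies_ex[OF sel[OF this]]
    obtain r where r: "r < T * W * nd" "mat r (column t' i' k)" "sel r" by (elim exE conjE)
    obtain t i d where *: "t < T" "i < W" "d < nd" "r = (t * W + i) * nd + d"
      by (rule index_split[OF r(1)])
    have "r = row t i d" using *(4) by (simp add: row_def)
    then have "inc t i d t' i' k" "sel (row t i d)"
      using r(2,3) mat_row_column[OF *(2,3) a *(1)] by simp_all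
    then show ?thesis using *(1-3) by (intro exI conjI)
  qed
  have un: "t1 = t2 \<and> i1 = i2 \<and> d1 = d2"
    if a: "t' < T" "i' < W" "k < nk" and b: "t1 < T" "i1 < W" "d1 < nd" and c: "inc t1 i1 d1 t' i' k" "sel (row t1 i1 d1)"
      and d: "t2 < T" "i2 < W" "d2 < nd" and e: "inc t2 i2 d2 t' i' k" "sel (row t2 i2 d2)" for t' i' k t1 t2 i1 i2 d1 d2
  proof -
    let ?P = "\<lambda>r. r < T * W * nd \<and> mat r (column t' i' k) \<and> sel r"
    have "column t' i' k < T * W * nk" using index_less[OF a] by (simp add: column_def)
    from sel[OF this] have ex1: "\<exists>!r. ?P r" .
    have 1: "?P (row t1 i1 d1)"
      using index_less[OF b] c mat_row_column[OF b(2,3) a b(1)] by (simp add: row_def)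
    have 2: "?P (row t2 i2 d2)"
      using index_less[OF d] e mat_row_column[OF d(2,3) a d(1)] by (simp add: row_def)
    have "row t1 i1 d1 = row t2 i2 d2" by (rule ex1E[OF ex1]) (use 1 2 in blast)
    then show ?thesis by (simp only: row_eq[OF b(2) d(2) b(3) d(3)])
  qed
  have "\<exists>d. d < nd \<and> al t i d \<and> sel (row t i d)" if "t < T" "i < W" for t i
    using ex[OF that, of 0] by (auto simp: inc_def own_def right_def up_def nk_def)
  then obtain \<tau> where \<tau>: "\<And>t i. t < T \<Longrightarrow> i < W \<Longrightarrow> \<tau> t i < nd \<and> al t i (\<tau> t i) \<and> sel (row t i (\<tau> t i))"
    by metis
  have "hE (\<tau> t i) = hW (\<tau> t (Suc i))" if "t < T" "Suc i < W" for t i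
  proof (rule ccontr)
    assume n: "hE (\<tau> t i) \<noteq> hW (\<tau> t (Suc i))"
    let ?k = "Suc (hE (\<tau> t i))"
    have k: "?k \<le> nh" using colours(1)[of "\<tau> t i"] \<tau>[of t i] that by auto
    have "inc t i (\<tau> t i) t i ?k" "inc t (Suc i) (\<tau> t (Suc i)) t i ?k"
      using \<tau>[of t i] \<tau>[of t "Suc i"] that k n by (auto simp: inc_def own_def right_def)
    then show False
      using un[of t i ?k t i "\<tau> t i" t "Suc i" "\<tau> t (Suc i)"] \<tau>[of t i] \<tau>[of t "Suc i"] that k
      by (auto simp: nk_def)
  qed
  moreover have "vN (\<tau> t i) = vS (\<tau> (Suc t) i)" if "Suc t < T" "i < W" for t i
  proof (rule ccontr)
    assume n: "vN (\<tau> t i) \<noteq> vS (\<tau> (Suc t) i)"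
    let ?k = "Suc (nh + vN (\<tau> t i))"
    have k: "?k < nk" using colours(2)[of "\<tau> t i"] \<tau>[of t i] that by (auto simp: nk_def)
    have "inc t i (\<tau> t i) t i ?k" "inc (Suc t) i (\<tau> (Suc t) i) t i ?k"
      using \<tau>[of t i] \<tau>[of "Suc t" i] that k n by (auto simp: inc_def own_def up_def)
    then show False
      using un[of t i ?k t i "\<tau> t i" "Suc t" i "\<tau> (Suc t) i"] \<tau>[of t i] \<tau>[of "Suc t" i] that k
      by auto
  qed
  ultimately show "\<exists>\<tau>. tiles \<tau>" unfolding tiles_def using \<tau> by blast
next
  assume "\<exists>\<tau>. tiles \<tau>"
  then obtain \<tau> where \<tau>: "\<And>t i. t < T \<Longrightarrow> i < W \<Longrightarrow> \<tau> t i < nd \<and> al t i (\<tau> t i)"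
    "\<And>t i. t < T \<Longrightarrow> Suc i < W \<Longrightarrow> hE (\<tau> t i) = hW (\<tau> t (Suc i))"
    "\<And>t i. Suc t < T \<Longrightarrow> i < W \<Longrightarrow> vN (\<tau> t i) = vS (\<tau> (Suc t) i)"
    unfolding tiles_def by (metis Suc_lessD)
  define sel where "sel r \<longleftrightarrow> (\<exists>t<T. \<exists>i<W. r = row t i (\<tau> t i))" for r
  have "\<exists>!r. r < T * W * nd \<and> mat r c \<and> sel r" if cl: "c < T * W * nk" for c
  proof -
    obtain t' i' k where c: "t' < T" "i' < W" "k < nk" "c = column t' i' k"
      by (rule index_split[OF cl]) (auto simp: column_def)
    have m: "r < T * W * nd \<and> mat r c \<and> sel r \<longleftrightarrow>
      (\<exists>t<T. \<exists>i<W. r = row t i (\<tau> t i) \<and> inc t i (\<tau> t i) t' i' k)" for r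
    proof
      assume r: "r < T * W * nd \<and> mat r c \<and> sel r"
      then obtain t i where *: "t < T" "i < W" "r = row t i (\<tau> t i)" by (auto simp: sel_def)
      have "inc t i (\<tau> t i) t' i' k"
        using r mat_row_column[OF *(2) _ c(1-3) *(1), of "\<tau> t i"] \<tau>(1)[OF *(1,2)] *(3) c(4) by simp
      then show "\<exists>t<T. \<exists>i<W. r = row t i (\<tau> t i) \<and> inc t i (\<tau> t i) t' i' k"
        using * by (intro exI conjI)
    next
      assume "\<exists>t<T. \<exists>i<W. r = row t i (\<tau> t i) \<and> inc t i (\<tau> t i) t' i' k"
      then obtain t i where *: "t < T" "i < W" "r = row t i (\<tau> t i)" "inc t i (\<tau> t i) t' i' k"
        by (elim exE conjE)
      have "mat r c"
        using mat_row_column[OF *(2) _ c(1-3) *(1), of "\<tau> t i"] \<tau>(1)[OF *(1,2)] *(3,4) c(4) by simp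
      moreover have "r < T * W * nd"
        using index_less[OF *(1,2), of "\<tau> t i" nd] \<tau>(1)[OF *(1,2)] *(3) by (simp add: row_def)
      moreover have "sel r" unfolding sel_def using *(1-3) by (intro exI conjI)
      ultimately show "r < T * W * nd \<and> mat r c \<and> sel r" by (intro conjI)
    qed
    have k: "k = 0 \<or> 0 < k \<and> k \<le> nh \<or> nh < k" by auto
    \<comment> \<open>If the tile at the place does not cover the column, then a neighbour exists on
      that side and the colour differs from that of the common side, so the neighbour covers
      it.\<close>
    have "\<exists>t i. t < T \<and> i < W \<and> inc t i (\<tau> t i) t' i' k \<and>
      (\<forall>s j. s < T \<longrightarrow> j < W \<longrightarrow> inc s j (\<tau> s j) t' i' k \<longrightarrow> s = t \<and> j = i)"
    proof (cases "own t' i' k (\<tau> t' i')")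
      case True
      have "s = t' \<and> j = i'" if "s < T" "j < W" "inc s j (\<tau> s j) t' i' k" for s j
        using that \<tau>(2)[of t' i'] \<tau>(3)[of t' i'] True c
        by (auto simp: inc_def own_def right_def up_def)
      then show ?thesis using True \<tau>(1) c unfolding inc_def by blast
    next
      case False
      then consider "0 < k" "k \<le> nh" "Suc i' \<noteq> W" "k \<noteq> Suc (hE (\<tau> t' i'))" |
        "nh < k" "Suc t' \<noteq> T" "k \<noteq> Suc (nh + vN (\<tau> t' i'))"
        using k by (auto simp: own_def)
      then show ?thesis
      proof cases
        case 1
        have "inc t' (Suc i') (\<tau> t' (Suc i')) t' i' k"
          using 1 c \<tau>(1)[of t' "Suc i'"] \<tau>(2)[of t' i'] by (auto simp: inc_def right_def)
        moreover have "s = t' \<and> j = Suc i'" if "inc s j (\<tau> s j) t' i' k" for s j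
          using that 1 False by (auto simp: inc_def up_def)
        ultimately show ?thesis using 1 c by (metis Suc_lessI)
      next
        case 2
        have "inc (Suc t') i' (\<tau> (Suc t') i') t' i' k"
          using 2 c \<tau>(1)[of "Suc t'" i'] \<tau>(3)[of t' i'] by (auto simp: inc_def up_def)
        moreover have "s = Suc t' \<and> j = i'" if "inc s j (\<tau> s j) t' i' k" for s j
          using that 2 False by (auto simp: inc_def right_def)
        ultimately show ?thesis using 2 c by (metis Suc_lessI)
      qed
    qed
    then obtain t i where ti: "t < T" "i < W" "inc t i (\<tau> t i) t' i' k"
      and q: "\<And>s j. s < T \<Longrightarrow> j < W \<Longrightarrow> inc s j (\<tau> s j) t' i' k \<Longrightarrow> s = t \<and> j = i" by blast
    show ?thesis unfolding m
    proof (rule ex1I)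
      show "\<exists>ta<T. \<exists>ia<W. row t i (\<tau> t i) = row ta ia (\<tau> ta ia) \<and> inc ta ia (\<tau> ta ia) t' i' k"
        using ti by (intro exI conjI) (assumption | rule refl)+
      fix r assume "\<exists>t<T. \<exists>i<W. r = row t i (\<tau> t i) \<and> inc t i (\<tau> t i) t' i' k"
      then obtain s j where *: "s < T" "j < W" "r = row s j (\<tau> s j)" "inc s j (\<tau> s j) t' i' k"
        by (elim exE conjE)
      show "r = row t i (\<tau> t i)" using q[OF *(1,2,4)] *(3) by simp
    qed
  qed
  then show "has_cover (T * W * nd) (T * W * nk) mat" unfolding has_cover_def by blast
qed

end

section \<open>Runs of a Turing machine as tilings\<close>

type_synonym cell = "nat \<times> bool"
type_synonym tile = "(nat \<times> nat list) \<times> cell list \<times> cell list \<times> cell list"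

text \<open>A tile consists of the state, the symbols under the heads, and the cells of all tapes at
  three neighbouring positions, the middle one being the position of the tile.\<close>

definition cells :: "tape list \<Rightarrow> int \<Rightarrow> cell list" where
  "cells ts p = map (\<lambda>tp. (fst tp p, snd tp = p)) ts"

definition reads :: "tape list \<Rightarrow> nat list" where
  "reads ts = map (\<lambda>(c, h). c h) ts"

abbreviation tG :: "tile \<Rightarrow> nat \<times> nat list" where "tG \<equiv> fst"
abbreviation tL :: "tile \<Rightarrow> cell list" where "tL d \<equiv> fst (snd d)"
abbreviation tC :: "tile \<Rightarrow> cell list" where "tC d \<equiv> fst (snd (snd d))"
abbreviation tR :: "tile \<Rightarrow> cell list" where "tR d \<equiv> snd (snd (snd d))"

locale verifier =
  fixes M :: tm
  assumes wf: "wf_tm M" and two_tapes: "2 \<le> num_tapes M"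
begin

abbreviation "K \<equiv> num_tapes M"
abbreviation "S \<equiv> num_symbols M"
abbreviation "N \<equiv> num_states M"

text \<open>The halting state is given a step that changes nothing, so that runs can be padded to
  any number of rows.\<close>

definition nxt :: "nat \<times> nat list \<Rightarrow> nat \<times> (nat \<times> move) list" where
  "nxt g = (if fst g = N then (fst g, map (\<lambda>a. (a, Stay)) (snd g)) else trans M (fst g) (snd g))"

text \<open>A head arrives from the neighbour opposite to its move; this is why a tile shows three
  positions.\<close>

definition out :: "(nat \<times> move) list \<Rightarrow> cell list \<Rightarrow> cell list \<Rightarrow> cell list \<Rightarrow> cell list" where
  "out acts l c r = map (\<lambda>j. (if snd (c ! j) then fst (acts ! j) else fst (c ! j),
     case snd (acts ! j) of Stay \<Rightarrow> snd (c ! j) | Go_Right \<Rightarrow> snd (l ! j) | Go_Left \<Rightarrow> snd (r ! j))) [0..<K]"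

text \<open>The scanned symbols of a tile are guessed; the last condition compares the guess with
  the tape wherever a head stands in the middle.\<close>

definition tile_set :: "tile set" where
  "tile_set = {d. fst (tG d) \<le> N \<and> snd (tG d) \<in> {xs. set xs \<subseteq> {..<S} \<and> length xs = K} \<and>
     {tL d, tC d, tR d} \<subseteq> {l. set l \<subseteq> {..<S} \<times> UNIV \<and> length l = K} \<and>
     (\<forall>j<K. snd (tC d ! j) \<longrightarrow> snd (tG d) ! j = fst (tC d ! j))}"

text \<open>Equality with \<open>west\<close> of the next tile makes the windows overlap in two
  positions and gives the whole row the same state and scanned symbols.\<close>

definition east :: "tile \<Rightarrow> (nat \<times> nat list) \<times> cell list \<times> cell list" where
  "east d = (tG d, tC d, tR d)"

definition west :: "tile \<Rightarrow> (nat \<times> nat list) \<times> cell list \<times> cell list" where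
  "west d = (tG d, tL d, tC d)"

definition north :: "tile \<Rightarrow> nat \<times> cell list" where
  "north d = (fst (nxt (tG d)), out (snd (nxt (tG d))) (tL d) (tC d) (tR d))"

text \<open>Scanned symbols are not passed on to the next row, where they are guessed and checked
  anew.\<close>

definition south :: "tile \<Rightarrow> nat \<times> cell list" where
  "south d = (fst (tG d), tC d)"

text \<open>Place \<open>i\<close> is tape position \<open>i - (T + 1)\<close>. Heads stay between
  \<open>- T\<close> and \<open>T\<close> for \<open>T\<close> steps, so
  \<open>2 * T + U + 3\<close> places contain them with a margin, together with a certificate of up
  to \<open>U\<close> cells. On tape 1 the initial row may show any word over the two bits followed
  by blanks. Sums, comparisons and bounded quantifiers replace subtraction, so that the condition
  becomes an arithmetic formula.\<close>

definition allowed :: "bool list \<Rightarrow> nat \<Rightarrow> nat \<Rightarrow> nat \<Rightarrow> nat \<Rightarrow> tile \<Rightarrow> bool" where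
  "allowed x U T t i d \<longleftrightarrow>
     (t = 0 \<longrightarrow> fst (tG d) = 0 \<and> (\<forall>j<K. snd (tC d ! j) \<longleftrightarrow> i = T + 1) \<and>
        (i < T + 1 \<longrightarrow> fst (tC d ! 0) = 0) \<and>
        (\<forall>y<2 * T + U + 3. i = T + 1 + y \<longrightarrow> fst (word_tape x) (int y) = fst (tC d ! 0)) \<and>
        (\<forall>j<K. 2 \<le> j \<longrightarrow> fst (tC d ! j) = 0) \<and>
        (i < T + 1 \<or> T + 1 + U < i + 1 \<longrightarrow> fst (tC d ! 1) = 0) \<and>
        fst (tC d ! 1) \<le> 2 \<and> (\<not> i < T + 1 \<longrightarrow> fst (tC d ! 1) = 0 \<longrightarrow> fst (tR d ! 1) = 0)) \<and>
     (t = T \<and> i = T + 1 \<longrightarrow> fst (tC d ! (K - 1)) = 2) \<and>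
     (i = 0 \<longrightarrow> (\<forall>j<K. \<not> snd (tL d ! j))) \<and>
     (i + 1 = 2 * T + U + 3 \<longrightarrow> (\<forall>j<K. \<not> snd (tR d ! j)))"

definition tile_run :: "bool list \<Rightarrow> nat \<Rightarrow> nat \<Rightarrow> (nat \<Rightarrow> nat \<Rightarrow> tile) \<Rightarrow> bool" where
  "tile_run x U T \<tau> \<longleftrightarrow> (\<forall>t<T + 1. \<forall>i<2 * T + U + 3. \<tau> t i \<in> tile_set \<and> allowed x U T t i (\<tau> t i) \<and>
     (Suc i < 2 * T + U + 3 \<longrightarrow> east (\<tau> t i) = west (\<tau> t (Suc i))) \<and>
     (Suc t < T + 1 \<longrightarrow> north (\<tau> t i) = south (\<tau> (Suc t) i)))"

definition run :: "bool list \<Rightarrow> bool list \<Rightarrow> nat \<Rightarrow> config" where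
  "run x u t = (tm_step M ^^ t) (init_config M [x, u])"

lemma finite_tile_set: "finite tile_set"
proof -
  have 1: "finite {xs. set xs \<subseteq> {..<S} \<and> length xs = K}"
    "finite {l :: cell list. set l \<subseteq> {..<S} \<times> UNIV \<and> length l = K}"
    by (rule finite_lists_length_eq; simp)+
  show ?thesis
    by (rule finite_subset[OF _ finite_cartesian_product[OF
      finite_cartesian_product[OF finite_atMost[of N] 1(1)]
      finite_cartesian_product[OF 1(2) finite_cartesian_product[OF 1(2) 1(2)]]]])
      (auto simp: tile_set_def)
qed

lemma length_cells [simp]: "length (cells ts p) = length ts"
  by (simp add: cells_def)

lemma length_reads [simp]: "length (reads ts) = length ts"
  by (simp add: reads_def)

lemma nth_cells [simp]: "j < length ts \<Longrightarrow> cells ts p ! j = (fst (ts ! j) p, snd (ts ! j) = p)"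
  by (simp add: cells_def)

lemma nth_reads [simp]: "j < length ts \<Longrightarrow> reads ts ! j = fst (ts ! j) (snd (ts ! j))"
  by (simp add: reads_def case_prod_beta)

lemma act_simps: "fst (act tp a) = (fst tp)(snd tp := fst a)" "snd (act tp a) = snd tp + shift (snd a)"
  by (cases tp; cases a; simp)+

lemma step_eq:
  "tm_step M (s, ts) = (fst (nxt (s, reads ts)), map2 act ts (snd (nxt (s, reads ts))))"
proof (cases "s = N")
  case True
  have "map2 act ts (map (\<lambda>a. (a, Stay)) (reads ts)) = ts"
    by (rule nth_equalityI) (auto simp: prod_eq_iff act_simps)
  then show ?thesis using True by (simp add: nxt_def)
next
  case False
  then show ?thesis by (simp add: nxt_def reads_def case_prod_beta)
qed

definition proper :: "nat \<Rightarrow> config \<Rightarrow> bool" where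
  "proper t cf \<longleftrightarrow> fst cf \<le> N \<and> length (snd cf) = K \<and>
     (\<forall>j<K. (\<forall>p. fst (snd cf ! j) p < S) \<and> \<bar>snd (snd cf ! j)\<bar> \<le> int t)"

lemma nxt_wf:
  assumes "proper t (s, ts)"
  shows "fst (nxt (s, reads ts)) \<le> N" "length (snd (nxt (s, reads ts))) = K"
    "j < K \<Longrightarrow> fst (snd (nxt (s, reads ts)) ! j) < S"
proof -
  have r: "length (reads ts) = K" "set (reads ts) \<subseteq> {..<S}"
    using assms by (auto simp: proper_def in_set_conv_nth)
  have "fst (nxt (s, reads ts)) \<le> N \<and> length (snd (nxt (s, reads ts))) = K \<and>
    (\<forall>j<K. fst (snd (nxt (s, reads ts)) ! j) < S)"
  proof (cases "s = N")
    case True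
    then show ?thesis using assms by (auto simp: nxt_def proper_def)
  next
    case False
    then have "s < N" using assms by (simp add: proper_def)
    have "\<forall>s<N. \<forall>xs. length xs = K \<and> set xs \<subseteq> {..<S} \<longrightarrow> (case trans M s xs of (s', acts) \<Rightarrow>
           s' \<le> N \<and> length acts = K \<and> (\<forall>(a, m)\<in>set acts. a < S))"
      using wf by (simp add: wf_tm_def)
    from this[THEN spec, THEN mp, OF \<open>s < N\<close>, THEN spec, THEN mp, OF conjI[OF r]]
    obtain s' acts where *: "trans M s (reads ts) = (s', acts)" "s' \<le> N" "length acts = K"
      "\<forall>(a, m)\<in>set acts. a < S" by (auto split: prod.splits)
    have "fst (acts ! j) < S" if "j < K" for j
      using bspec[OF *(4), of "acts ! j"] that *(3) by (simp add: case_prod_beta)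
    then show ?thesis using False *(1-3) by (simp add: nxt_def)
  qed
  then show "fst (nxt (s, reads ts)) \<le> N" "length (snd (nxt (s, reads ts))) = K"
    "j < K \<Longrightarrow> fst (snd (nxt (s, reads ts)) ! j) < S" by auto
qed

lemma proper_step:
  assumes "proper t (s, ts)"
  shows "proper (Suc t) (tm_step M (s, ts))"
proof -
  have "\<bar>p + shift m\<bar> \<le> int (Suc t)" if "\<bar>p\<bar> \<le> int t" for p m
    using that by (cases m) auto
  then show ?thesis
    using assms nxt_wf[OF assms] unfolding step_eq by (auto simp: proper_def act_simps)
qed

lemma proper_run: "proper t (run x u t)"
proof (induction t)
  case 0
  have S: "3 \<le> S" using wf by (simp add: wf_tm_def)
  have "fst (word_tape w) p < S" for w p
    using S by (auto simp: word_tape_def bit_symbol_def)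
  moreover have "snd (word_tape w) = 0" for w by (simp add: word_tape_def)
  ultimately show ?case by (simp add: run_def proper_def init_config_def)
next
  case (Suc t)
  have "run x u (Suc t) = tm_step M (run x u t)" by (simp add: run_def)
  then show ?case using proper_step[of t "fst (run x u t)" "snd (run x u t)"] Suc by simp
qed

lemma run_Suc:
  "run x u (Suc t) = (fst (nxt (fst (run x u t), reads (snd (run x u t)))),
     map2 act (snd (run x u t)) (snd (nxt (fst (run x u t), reads (snd (run x u t))))))"
  using step_eq[of "fst (run x u t)" "snd (run x u t)"] by (simp add: run_def)

lemma run_0:
  "fst (run x u 0) = 0" "j < K \<Longrightarrow> snd (run x u 0) ! j =
     word_tape (if j = 0 then x else if j = 1 then u else [])"
  by (auto simp: run_def init_config_def nth_Cons split: nat.splits)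

text \<open>Of the neighbouring positions only the head marks are used; at the border of the
  rectangle, where no further tile exists, \<open>allowed\<close> fixes these marks.\<close>

lemma out_cells:
  assumes "length ts = K" "length acts = K"
    "\<And>j. j < K \<Longrightarrow> snd (l ! j) = (snd (ts ! j) = p - 1)" "\<And>j. j < K \<Longrightarrow> snd (r ! j) = (snd (ts ! j) = p + 1)"
  shows "out acts l (cells ts p) r = cells (map2 act ts acts) p"
proof (rule nth_equalityI)
  fix j assume "j < length (out acts l (cells ts p) r)"
  then have j: "j < K" by (simp add: out_def)
  show "out acts l (cells ts p) r ! j = cells (map2 act ts acts) p ! j"
    using j assms by (cases "snd (acts ! j)") (auto simp: out_def act_simps)
qed (use assms in \<open>simp add: out_def\<close>)

lemma tile_run_of_run:
  assumes u: "length u \<le> U" and acc: "fst (last (snd (run x u T))) 0 = 2"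
  shows "\<exists>\<tau>. tile_run x U T \<tau>"
proof -
  define \<tau> where "\<tau> t i = (let ts = snd (run x u t); p = int i - int (T + 1) in
     ((fst (run x u t), reads ts), cells ts (p - 1), cells ts p, cells ts (p + 1)))" for t i
  have g: "fst (run x u t) \<le> N" "length (snd (run x u t)) = K"
    "j < K \<Longrightarrow> fst (snd (run x u t) ! j) p < S" "j < K \<Longrightarrow> \<bar>snd (snd (run x u t) ! j)\<bar> \<le> int t" for t j p
    using proper_run[of t x u] by (simp_all add: proper_def)
  have D: "\<tau> t i \<in> tile_set" for t i
    using g(1)[of t] g(2)[of t] g(3)[of _ t] by (auto simp: \<tau>_def tile_set_def Let_def in_set_conv_nth)
  have E: "east (\<tau> t i) = west (\<tau> t (Suc i))" for t i
    by (simp add: \<tau>_def east_def west_def Let_def algebra_simps)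
  have V: "north (\<tau> t i) = south (\<tau> (Suc t) i)" for t i
    unfolding north_def south_def \<tau>_def Let_def fst_conv snd_conv run_Suc[of x u t]
    by (subst out_cells) (use g[of t] nxt_wf[of t "fst (run x u t)"] proper_run[of t x u] in auto)
  have "K - 1 < K" using two_tapes by linarith
  then have l: "last (snd (run x u T)) = snd (run x u T) ! (K - 1)"
    using g(2)[of T] by (subst last_conv_nth) auto
  have W: "word_tape w = (\<lambda>p. if 0 \<le> p \<and> p < int (length w) then bit_symbol (w ! nat p) else 0, 0)" for w
    by (simp add: word_tape_def)
  have k: "0 < K" "Suc 0 < K" "K - 1 < K" using two_tapes by auto
  have A: "allowed x U T t i (\<tau> t i)" if "t < T + 1" for t i
  proof -
    have 0: "fst (tG (\<tau> 0 i)) = 0" by (simp add: \<tau>_def Let_def run_0)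
    have c: "tC (\<tau> 0 i) ! j = (fst (word_tape (if j = 0 then x else if j = 1 then u else []))
        (int i - int (T + 1)), i = T + 1)" if "j < K" for j
      using that g(2)[of 0] by (auto simp: \<tau>_def Let_def run_0 word_tape_def)
    have r: "fst (tR (\<tau> 0 i) ! 1) = fst (word_tape u) (int i - int (T + 1) + 1)"
      using k g(2)[of 0] by (simp add: \<tau>_def Let_def run_0)
    have "fst (word_tape w) p = 0" if "p < 0" for w p using that by (simp add: word_tape_def)
    moreover have "fst (word_tape u) p = 0" if "int U \<le> p" for p
      using that u by (simp add: word_tape_def)
    moreover have "fst (word_tape w) p \<le> 2" for w p by (simp add: word_tape_def bit_symbol_def)
    moreover have "fst (word_tape u) (int i - int (T + 1) + 1) = 0"
      if "\<not> i < T + 1" "fst (word_tape u) (int i - int (T + 1)) = 0"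
      using that by (auto simp: word_tape_def bit_symbol_def split: if_splits)
    moreover have "fst (word_tape []) p = 0" for p by (simp add: word_tape_def)
    ultimately have 1: "t = 0 \<longrightarrow> fst (tG (\<tau> t i)) = 0 \<and> (\<forall>j<K. snd (tC (\<tau> t i) ! j) \<longleftrightarrow> i = T + 1) \<and>
        (i < T + 1 \<longrightarrow> fst (tC (\<tau> t i) ! 0) = 0) \<and>
        (\<forall>y<2 * T + U + 3. i = T + 1 + y \<longrightarrow> fst (word_tape x) (int y) = fst (tC (\<tau> t i) ! 0)) \<and>
        (\<forall>j<K. 2 \<le> j \<longrightarrow> fst (tC (\<tau> t i) ! j) = 0) \<and>
        (i < T + 1 \<or> T + 1 + U < i + 1 \<longrightarrow> fst (tC (\<tau> t i) ! 1) = 0) \<and>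
        fst (tC (\<tau> t i) ! 1) \<le> 2 \<and>
        (\<not> i < T + 1 \<longrightarrow> fst (tC (\<tau> t i) ! 1) = 0 \<longrightarrow> fst (tR (\<tau> t i) ! 1) = 0)"
      using 0 c k r by auto
    have 2: "t = T \<and> i = T + 1 \<longrightarrow> fst (tC (\<tau> t i) ! (K - 1)) = 2"
      using acc k g(2)[of T] by (simp add: \<tau>_def Let_def l)
    have h: "\<bar>snd (snd (run x u t) ! j)\<bar> \<le> int T" if "j < K" for j
      using g(4)[of j t, OF that] \<open>t < T + 1\<close> by linarith
    have 3: "i = 0 \<longrightarrow> (\<forall>j<K. \<not> snd (tL (\<tau> t i) ! j))"
      using h g(2)[of t] by (fastforce simp: \<tau>_def Let_def)
    have 4: "i + 1 = 2 * T + U + 3 \<longrightarrow> (\<forall>j<K. \<not> snd (tR (\<tau> t i) ! j))"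
      using h g(2)[of t] by (fastforce simp: \<tau>_def Let_def)
    show ?thesis unfolding allowed_def using 1 2 3 4 by blast
  qed
  show ?thesis unfolding tile_run_def using A D E V by blast
qed

lemma run_of_tile_run:
  assumes "tile_run x U T \<tau>"
  shows "\<exists>u. length u \<le> U \<and> fst (last (snd (run x u T))) 0 = 2"
proof -
  let ?W = "2 * T + U + 3"
  have D: "\<tau> t i \<in> tile_set" and A: "allowed x U T t i (\<tau> t i)"
    and E: "Suc i < ?W \<Longrightarrow> tG (\<tau> t (Suc i)) = tG (\<tau> t i) \<and> tL (\<tau> t (Suc i)) = tC (\<tau> t i) \<and>
       tR (\<tau> t i) = tC (\<tau> t (Suc i))"
    and V: "Suc t < T + 1 \<Longrightarrow> north (\<tau> t i) = south (\<tau> (Suc t) i)"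
    if "t < T + 1" "i < ?W" for t i
    using assms that unfolding tile_run_def east_def west_def by (auto simp: prod_eq_iff)
  define v where "v y = fst (tC (\<tau> 0 (T + 1 + y)) ! 1)" for y
  \<comment> \<open>The guessed certificate ends at its first blank or after \<open>U\<close>
    cells.\<close>
  define m where "m = (LEAST y. y = U \<or> v y = 0)"
  define u where "u = map (\<lambda>y. v y = 2) [0..<m]"
  have m: "m \<le> U" "m = U \<or> v m = 0" "\<And>y. y < m \<Longrightarrow> v y \<noteq> 0"
    unfolding m_def by (rule Least_le, simp) (rule LeastI[of _ U], simp, metis (mono_tags) not_less_Least)
  have A0: "fst (tG (\<tau> 0 i)) = 0" "\<And>j. j < K \<Longrightarrow> snd (tC (\<tau> 0 i) ! j) \<longleftrightarrow> i = T + 1"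
    "i < T + 1 \<Longrightarrow> fst (tC (\<tau> 0 i) ! 0) = 0"
    "\<And>y. i = T + 1 + y \<Longrightarrow> fst (word_tape x) (int y) = fst (tC (\<tau> 0 i) ! 0)"
    "\<And>j. j < K \<Longrightarrow> 2 \<le> j \<Longrightarrow> fst (tC (\<tau> 0 i) ! j) = 0"
    "i < T + 1 \<or> T + 1 + U < i + 1 \<Longrightarrow> fst (tC (\<tau> 0 i) ! 1) = 0"
    "fst (tC (\<tau> 0 i) ! 1) \<le> 2"
    "\<not> i < T + 1 \<Longrightarrow> fst (tC (\<tau> 0 i) ! 1) = 0 \<Longrightarrow> fst (tR (\<tau> 0 i) ! 1) = 0" if "i < ?W" for i
    using A[of 0 i] that by (simp_all add: allowed_def)
  have v2: "v y \<le> 2" if "T + 1 + y < ?W" for y using A0(7)[OF that] by (simp add: v_def)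
  have vU: "v y = 0" if "U \<le> y" "T + 1 + y < ?W" for y
    using A0(6)[OF that(2)] that(1) by (simp add: v_def)
  have vS: "v (Suc y) = 0" if "v y = 0" "T + 1 + Suc y < ?W" for y
    using A0(8)[of "T + 1 + y"] E[of 0 "T + 1 + y"] that by (simp add: v_def)
  have v0: "v y = 0" if "m \<le> y" "T + 1 + y < ?W" for y
    using that
  proof (induction rule: dec_induct)
    case base
    then show ?case using m(2) vU[of m] by auto
  next
    case (step y)
    then show ?case using vS[of y] by simp
  qed
  have u1: "fst (word_tape u) (int y) = v y" if "T + 1 + y < ?W" for y
  proof (cases "y < m")
    case True
    then have "v y \<noteq> 0" "v y \<le> 2" using m(3) v2[OF that] by auto
    then have "v y = 1 \<or> v y = 2" by linarith
    then show ?thesis using True by (auto simp: word_tape_def u_def bit_symbol_def)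
  next
    case False
    then show ?thesis using v0[of y] that by (simp add: word_tape_def u_def)
  qed
  have len: "length (snd (run x u t)) = K" for t using proper_run[of t x u] by (simp add: proper_def)
  have inv: "\<forall>i<?W. fst (tG (\<tau> t i)) = fst (run x u t) \<and>
      tC (\<tau> t i) = cells (snd (run x u t)) (int i - int (T + 1))" if "t < T + 1" for t
    using that
  proof (induction t)
    case 0
    have "tC (\<tau> 0 i) = cells (snd (run x u 0)) (int i - int (T + 1))" if i: "i < ?W" for i
    proof (rule nth_equalityI)
      show l: "length (tC (\<tau> 0 i)) = length (cells (snd (run x u 0)) (int i - int (T + 1)))"
        using D[of 0 i] i len[of 0] by (simp add: tile_set_def)
      fix j assume "j < length (tC (\<tau> 0 i))"
      then have j: "j < K" using l len[of 0] by simp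
      have "fst (tC (\<tau> 0 i) ! j) = fst (word_tape (if j = 0 then x else if j = 1 then u else [])) (int i - int (T + 1))"
      proof (cases "i < T + 1")
        case True
        have "j = 0 \<or> j = 1 \<or> 2 \<le> j" by linarith
        moreover have "fst (word_tape w) (int i - int (T + 1)) = 0" for w
          using True by (simp add: word_tape_def)
        ultimately show ?thesis using A0(3,5,6)[OF i] True j by auto
      next
        case False
        then obtain y where y: "i = T + 1 + y" by (metis le_Suc_ex not_less)
        have "j = 0 \<or> j = 1 \<or> 2 \<le> j" by linarith
        moreover have "fst (word_tape []) p = 0" for p by (simp add: word_tape_def)
        moreover have "fst (word_tape u) (int y) = fst (tC (\<tau> 0 i) ! 1)"
          using u1[of y] i y by (simp add: v_def)
        ultimately show ?thesis using A0(4)[OF i y] A0(5)[OF i] j y by auto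
      qed
      moreover have "snd (word_tape w) = 0" for w by (simp add: word_tape_def)
      ultimately show "tC (\<tau> 0 i) ! j = cells (snd (run x u 0)) (int i - int (T + 1)) ! j"
        using A0(2)[OF i j] j len[of 0] by (auto simp: prod_eq_iff run_0)
    qed
    then show ?case using A0(1) by (simp add: run_0)
  next
    case (Suc t)
    let ?s = "fst (run x u t)" and ?ts = "snd (run x u t)"
    have t: "t < T + 1" using Suc.prems by simp
    have I: "fst (tG (\<tau> t i)) = ?s" "tC (\<tau> t i) = cells ?ts (int i - int (T + 1))" if "i < ?W" for i
      using Suc.IH[OF t] that by auto
    have h: "\<bar>snd (?ts ! j)\<bar> \<le> int T" if "j < K" for j
      using proper_run[of t x u] that t by (fastforce simp: proper_def)
    have G: "tG (\<tau> t i) = tG (\<tau> t 0)" if "i < ?W" for i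
      using that E[OF t] by (induction i) auto
    \<comment> \<open>Every head stands at a place inside the rectangle, the tile there verifies the
      guessed symbol, and the guess is common to the row.\<close>
    have x: "snd (tG (\<tau> t 0)) = reads ?ts"
    proof (rule nth_equalityI)
      show l: "length (snd (tG (\<tau> t 0))) = length (reads ?ts)"
        using D[OF t, of 0] len[of t] by (simp add: tile_set_def)
      fix j assume "j < length (snd (tG (\<tau> t 0)))"
      then have j: "j < K" using l len[of t] by simp
      define i where "i = nat (snd (?ts ! j) + int (T + 1))"
      have i: "int i = snd (?ts ! j) + int (T + 1)" "i < ?W" using h[OF j] by (auto simp: i_def)
      have c: "tC (\<tau> t i) ! j = (fst (?ts ! j) (snd (?ts ! j)), True)"
        using I(2)[OF i(2)] j len[of t] i(1) by simp
      have "snd (tC (\<tau> t i) ! j) \<longrightarrow> snd (tG (\<tau> t i)) ! j = fst (tC (\<tau> t i) ! j)"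
        using D[OF t i(2)] j unfolding tile_set_def by blast
      then show "snd (tG (\<tau> t 0)) ! j = reads ?ts ! j"
        using c G[OF i(2)] j len[of t] by simp
    qed
    have g: "tG (\<tau> t i) = (?s, reads ?ts)" if "i < ?W" for i
      using G[OF that] I(1)[of 0] x by (simp add: prod_eq_iff)
    let ?acts = "snd (nxt (?s, reads ?ts))"
    have a: "length ?acts = K" using nxt_wf(2)[of t ?s ?ts] proper_run[of t x u] by simp
    show ?case
    proof (intro allI impI)
      fix i assume i: "i < ?W"
      let ?p = "int i - int (T + 1)"
      have l: "snd (tL (\<tau> t i) ! j) = (snd (?ts ! j) = ?p - 1)" if j: "j < K" for j
      proof (cases i)
        case 0
        have "\<not> snd (tL (\<tau> t i) ! j)" using A[OF t i] 0 j unfolding allowed_def by blast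
        then show ?thesis using h[OF j] 0 by auto
      next
        case (Suc i')
        then have "tL (\<tau> t i) = cells ?ts (?p - 1)" using E[OF t, of i'] I(2)[of i'] i
          by (simp add: algebra_simps)
        then show ?thesis using j len[of t] by simp
      qed
      have r: "snd (tR (\<tau> t i) ! j) = (snd (?ts ! j) = ?p + 1)" if j: "j < K" for j
      proof (cases "i + 1 = ?W")
        case True
        have "\<not> snd (tR (\<tau> t i) ! j)" using A[OF t i] True j unfolding allowed_def by blast
        moreover have "int i + 1 = 2 * int T + int U + 3" using True by linarith
        ultimately show ?thesis using h[OF j] by auto
      next
        case False
        then have "tR (\<tau> t i) = cells ?ts (?p + 1)" using E[OF t i] I(2)[of "Suc i"] i
          by (simp add: algebra_simps)
        then show ?thesis using j len[of t] by simp
      qed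
      have "out ?acts (tL (\<tau> t i)) (tC (\<tau> t i)) (tR (\<tau> t i)) = cells (map2 act ?ts ?acts) ?p"
        unfolding I(2)[OF i] by (rule out_cells[OF len a l r])
      then have "north (\<tau> t i) = (fst (run x u (Suc t)), cells (snd (run x u (Suc t))) ?p)"
        unfolding north_def g[OF i] run_Suc[of x u t] by simp
      then show "fst (tG (\<tau> (Suc t) i)) = fst (run x u (Suc t)) \<and>
          tC (\<tau> (Suc t) i) = cells (snd (run x u (Suc t))) ?p"
        using V[OF t i] Suc.prems by (simp add: south_def)
    qed
  qed
  have k: "K - 1 < K" using two_tapes by linarith
  have "fst (tC (\<tau> T (T + 1)) ! (K - 1)) = 2"
    using A[of T "T + 1"] by (simp add: allowed_def)
  moreover have "tC (\<tau> T (T + 1)) = cells (snd (run x u T)) 0" using inv[of T] by simp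
  ultimately have "fst (snd (run x u T) ! (K - 1)) 0 = 2" using k len[of T] by simp
  moreover have "last (snd (run x u T)) = snd (run x u T) ! (K - 1)"
    using len[of T] k by (subst last_conv_nth) auto
  moreover have "length u \<le> U" using m(1) by (simp add: u_def)
  ultimately show ?thesis by auto
qed

lemma tile_run_iff:
  "(\<exists>\<tau>. tile_run x U T \<tau>) \<longleftrightarrow> (\<exists>u. length u \<le> U \<and> fst (last (snd (run x u T))) 0 = 2)"
  using tile_run_of_run run_of_tile_run by blast

lemma run_halted: "t \<le> t' \<Longrightarrow> fst (run x u t) = N \<Longrightarrow> run x u t' = run x u t"
proof (induction t' rule: dec_induct)
  case (step t')
  have "tm_step M cf = cf" if "fst cf = N" for cf using that by (cases cf) simp
  then show ?case using step by (simp add: run_def)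
qed simp

text \<open>Symbol 2 in cell 0 of the last tape codes the output bit true, and nothing changes after
  halting.\<close>

lemma accepts_iff:
  assumes "computes_within M [x, u] t [b]" "t \<le> T"
  shows "fst (last (snd (run x u T))) 0 = 2 \<longleftrightarrow> b"
proof -
  have *: "fst (run x u t) = N" "tape_holds (last (snd (run x u t))) [b]"
    using assms(1) by (simp_all add: computes_within_def run_def case_prod_beta)
  then show ?thesis using run_halted[OF assms(2) *(1)]
    by (auto simp: tape_holds_def bit_symbol_def)
qed

end

section \<open>Structured programs for Turing machines\<close>

datatype prog =
    Act "nat list \<Rightarrow> (nat \<times> move) list"
  | Seq prog prog
  | Cond "nat list \<Rightarrow> bool" prog prog
  | While "nat list \<Rightarrow> bool" prog

definition scan :: "tape list \<Rightarrow> nat list" where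
  "scan ts = map (\<lambda>(c, h). c h) ts"

inductive exec :: "prog \<Rightarrow> tape list \<Rightarrow> nat \<Rightarrow> tape list \<Rightarrow> bool" where
  exec_Act: "exec (Act f) ts 1 (map2 act ts (f (scan ts)))"
| exec_Seq: "exec p ts t ts' \<Longrightarrow> exec q ts' t' ts'' \<Longrightarrow> exec (Seq p q) ts (t + t') ts''"
| exec_CondT: "b (scan ts) \<Longrightarrow> exec p ts t ts' \<Longrightarrow> exec (Cond b p q) ts (Suc t) ts'"
| exec_CondF: "\<not> b (scan ts) \<Longrightarrow> exec q ts t ts' \<Longrightarrow> exec (Cond b p q) ts (Suc t) ts'"
| exec_WhileF: "\<not> b (scan ts) \<Longrightarrow> exec (While b p) ts 1 ts"
| exec_WhileT: "b (scan ts) \<Longrightarrow> exec p ts t ts' \<Longrightarrow> exec (While b p) ts' t' ts'' \<Longrightarrow>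
    exec (While b p) ts (Suc (t + t')) ts''"

fun psize :: "prog \<Rightarrow> nat" where
  "psize (Act f) = 1"
| "psize (Seq p q) = psize p + psize q"
| "psize (Cond b p q) = Suc (psize p + psize q)"
| "psize (While b p) = Suc (psize p)"

type_synonym instr = "nat list \<Rightarrow> nat \<times> (nat \<times> move) list"

definition jump :: "(nat list \<Rightarrow> nat) \<Rightarrow> instr" where
  "jump g xs = (g xs, map (\<lambda>a. (a, Stay)) xs)"

text \<open>\<open>s\<close> is the number of the first state of the block and \<open>e\<close> the
  state in which execution continues after it; the body of a loop therefore exits to the
  test.\<close>

fun code :: "prog \<Rightarrow> nat \<Rightarrow> nat \<Rightarrow> instr list" where
  "code (Act f) s e = [\<lambda>xs. (e, f xs)]"
| "code (Seq p q) s e = code p s (s + psize p) @ code q (s + psize p) e"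
| "code (Cond b p q) s e =
     jump (\<lambda>xs. if b xs then Suc s else Suc s + psize p) #
     code p (Suc s) e @ code q (Suc s + psize p) e"
| "code (While b p) s e = jump (\<lambda>xs. if b xs then Suc s else e) # code p (Suc s) s"

lemma length_code [simp]: "length (code p s e) = psize p"
  by (induction p arbitrary: s e) auto

lemma psize_pos [simp]: "psize p > 0"
  by (induction p) auto

definition machine :: "nat \<Rightarrow> nat \<Rightarrow> prog \<Rightarrow> tm" where
  "machine k S p = \<lparr>num_tapes = k, num_symbols = S, num_states = psize p,
     trans = \<lambda>s. code p 0 (psize p) ! s\<rparr>"

definition loaded :: "tm \<Rightarrow> nat \<Rightarrow> instr list \<Rightarrow> bool" where
  "loaded M s cs \<longleftrightarrow> (\<forall>i<length cs. s + i < num_states M \<and> trans M (s + i) = cs ! i)"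

lemma loaded_append [simp]:
  "loaded M s (cs @ ds) \<longleftrightarrow> loaded M s cs \<and> loaded M (s + length cs) ds"
proof -
  have *: "(\<forall>i<m + n. P i) \<longleftrightarrow> (\<forall>i<m. P i) \<and> (\<forall>i<n. P (m + i))" for P and m n :: nat
  proof safe
    fix i assume "\<forall>i<m. P i" "\<forall>i<n. P (m + i)" "i < m + n"
    then show "P i" by (cases "i < m") (auto dest: spec[of _ "i - m"])
  qed auto
  show ?thesis
    unfolding loaded_def length_append * by (auto simp: nth_append add.assoc)
qed

lemma loaded_Cons [simp]:
  "loaded M s (c # cs) \<longleftrightarrow> s < num_states M \<and> trans M s = c \<and> loaded M (Suc s) cs"
  using loaded_append[of M s "[c]" cs] by (auto simp: loaded_def)

lemma map2_act_stay [simp]: "map2 act ts (map (\<lambda>a. (a, Stay)) (scan ts)) = ts"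
  by (induction ts) (auto simp: scan_def)

lemma tm_step_jump:
  assumes "s < num_states M" "trans M s = jump g"
  shows "tm_step M (s, ts) = (g (scan ts), ts)"
  using assms by (simp add: jump_def scan_def[symmetric])

lemma exec_code:
  assumes "exec p ts t ts'" "loaded M s (code p s e)"
  shows "(tm_step M ^^ t) (s, ts) = (e, ts')"
  using assms
proof (induction arbitrary: s e)
  case (exec_Act f ts)
  then show ?case by (simp add: scan_def)
next
  case (exec_Seq p ts t ts' q t' ts'')
  have "(tm_step M ^^ (t' + t)) (s, ts) = (e, ts'')"
    using exec_Seq.IH(1)[of s "s + psize p"] exec_Seq.IH(2)[of "s + psize p" e] exec_Seq.prems
    by (simp add: funpow_add)
  then show ?case by (simp add: add.commute)
next
  case (exec_CondT b ts p t ts' q)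
  then show ?case using exec_CondT.IH[of "Suc s" e]
    by (simp add: tm_step_jump del: tm_step.simps funpow.simps add: funpow_Suc_right)
next
  case (exec_CondF b ts q t ts' p)
  then show ?case using exec_CondF.IH[of "Suc s + psize p" e]
    by (simp add: tm_step_jump del: tm_step.simps funpow.simps add: funpow_Suc_right)
next
  case (exec_WhileF b ts p)
  then show ?case by (simp add: tm_step_jump del: tm_step.simps)
next
  case (exec_WhileT b ts p t ts' t' ts'')
  have "(tm_step M ^^ (t' + t)) (Suc s, ts) = (e, ts'')"
    using exec_WhileT.IH(1)[of "Suc s" s] exec_WhileT.IH(2)[of s e] exec_WhileT.prems
    by (simp add: funpow_add)
  then show ?case using exec_WhileT.hyps exec_WhileT.prems
    by (simp add: tm_step_jump del: tm_step.simps funpow.simps add: funpow_Suc_right add.commute)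
qed

fun wf_prog :: "nat \<Rightarrow> nat \<Rightarrow> prog \<Rightarrow> bool" where
  "wf_prog k S (Act f) \<longleftrightarrow> (\<forall>xs. length xs = k \<and> set xs \<subseteq> {..<S} \<longrightarrow>
     length (f xs) = k \<and> (\<forall>(a, m)\<in>set (f xs). a < S))"
| "wf_prog k S (Seq p q) \<longleftrightarrow> wf_prog k S p \<and> wf_prog k S q"
| "wf_prog k S (Cond b p q) \<longleftrightarrow> wf_prog k S p \<and> wf_prog k S q"
| "wf_prog k S (While b p) \<longleftrightarrow> wf_prog k S p"

definition wf_instr :: "nat \<Rightarrow> nat \<Rightarrow> nat \<Rightarrow> instr \<Rightarrow> bool" where
  "wf_instr k S N c \<longleftrightarrow> (\<forall>xs. length xs = k \<and> set xs \<subseteq> {..<S} \<longrightarrow>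
     (case c xs of (s', acts) \<Rightarrow> s' \<le> N \<and> length acts = k \<and> (\<forall>(a, m)\<in>set acts. a < S)))"

lemma wf_instr_jump: "(\<And>xs. g xs \<le> N) \<Longrightarrow> wf_instr k S N (jump g)"
  by (auto simp: wf_instr_def jump_def)

lemma wf_code:
  assumes "wf_prog k S p" "s + psize p \<le> N" "e \<le> N" "c \<in> set (code p s e)"
  shows "wf_instr k S N c"
  using assms
proof (induction p arbitrary: s e)
  case (Act f)
  then show ?case by (auto simp: wf_instr_def)
next
  case (Seq p q)
  then show ?case
    using Seq.IH(1)[of s "s + psize p"] Seq.IH(2)[of "s + psize p" e] by auto
next
  case (Cond b p q)
  then show ?case
    using Cond.IH(1)[of "Suc s" e] Cond.IH(2)[of "Suc s + psize p" e]
    by (auto intro!: wf_instr_jump)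
next
  case (While b p)
  then show ?case
    using While.IH[of "Suc s" s] by (auto intro!: wf_instr_jump)
qed

lemma wf_machine: "wf_prog k S p \<Longrightarrow> k \<ge> 1 \<Longrightarrow> S \<ge> 3 \<Longrightarrow> wf_tm (machine k S p)"
  using wf_code[of k S p 0 "psize p" "psize p"]
  by (fastforce simp: wf_tm_def machine_def wf_instr_def)

lemma tm_step_halted: "(tm_step M ^^ t) (num_states M, ts) = (num_states M, ts)"
  by (induction t) auto

text \<open>Surplus time is spent in the halting state, so an upper bound on the running time is
  enough.\<close>

lemma machine_run:
  assumes "exec p ts t ts'" "t \<le> t'"
  shows "(tm_step (machine k S p) ^^ t') (0, ts) = (psize p, ts')"
proof -
  let ?M = "machine k S p"
  have "loaded ?M 0 (code p 0 (psize p))"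
    by (auto simp: loaded_def machine_def)
  from exec_code[OF assms(1) this] have "(tm_step ?M ^^ t) (0, ts) = (psize p, ts')" .
  moreover have "(tm_step ?M ^^ (t' - t)) (psize p, ts') = (psize p, ts')"
    using tm_step_halted[of "t' - t" ?M ts'] by (simp add: machine_def)
  moreover have "tm_step ?M ^^ t' = (tm_step ?M ^^ (t' - t)) \<circ> (tm_step ?M ^^ t)"
    using assms(2) by (simp flip: funpow_add)
  ultimately show ?thesis by simp
qed

section \<open>Counters as head positions\<close>

text \<open>A natural number is stored as the position of a head. Cell 0 of every tape but the
  output tape carries its original symbol plus 3, so that position 0 can be recognised.\<close>

datatype role = Inp nat | Flag | Acc1 | Acc2 | Var nat | Bnd nat | Cpy nat | Prd nat

fun word_of :: "(nat \<Rightarrow> bool list) \<Rightarrow> role \<Rightarrow> bool list" where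
  "word_of inp (Inp i) = inp i"
| "word_of inp _ = []"

definition marked :: "bool list \<Rightarrow> int \<Rightarrow> nat" where
  "marked x j = fst (word_tape x) j + (if j = 0 then 3 else 0)"

lemma word_tape_le: "fst (word_tape x) j \<le> 2"
  by (auto simp: word_tape_def bit_symbol_def)

lemma marked_mark: "3 \<le> marked x (int n) \<longleftrightarrow> n = 0"
  using word_tape_le[of x "int n"] by (auto simp: marked_def)

lemma marked_sym:
  "a \<le> 2 \<Longrightarrow> marked x j = a \<or> marked x j = a + 3 \<longleftrightarrow> fst (word_tape x) j = a"
  using word_tape_le[of x j] by (auto simp: marked_def)

locale roles =
  fixes rs :: "role list"
  assumes distinct_rs: "distinct rs"
begin

text \<open>The unmarked output tape comes last; its head waits on the blank behind the word written
  so far.\<close>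

definition conf :: "(nat \<Rightarrow> bool list) \<Rightarrow> (role \<Rightarrow> nat) \<Rightarrow> bool list \<Rightarrow> tape list" where
  "conf inp h out =
     map (\<lambda>r. (marked (word_of inp r), int (h r))) rs @ [(fst (word_tape out), int (length out))]"

definition runs ::
    "(nat \<Rightarrow> bool list) \<Rightarrow> prog \<Rightarrow> (role \<Rightarrow> nat) \<Rightarrow> bool list \<Rightarrow> nat \<Rightarrow> (role \<Rightarrow> nat) \<Rightarrow> bool list \<Rightarrow> bool"
where
  "runs inp p h out b h' out' \<longleftrightarrow> (\<exists>t\<le>b. exec p (conf inp h out) t (conf inp h' out'))"

abbreviation wfp :: "prog \<Rightarrow> bool" where
  "wfp p \<equiv> wf_prog (Suc (length rs)) 6 p"

definition look :: "role \<Rightarrow> nat list \<Rightarrow> nat" where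
  "look r xs = the (map_of (zip rs xs) r)"

definition at0 :: "role \<Rightarrow> nat list \<Rightarrow> bool" where
  "at0 r xs \<longleftrightarrow> 3 \<le> look r xs"

definition at_sym :: "role \<Rightarrow> nat \<Rightarrow> nat list \<Rightarrow> bool" where
  "at_sym r a xs \<longleftrightarrow> look r xs = a \<or> look r xs = a + 3"

lemma scan_conf:
  "scan (conf inp h out) = map (\<lambda>r. marked (word_of inp r) (int (h r))) rs @ [0]"
  by (simp add: scan_def conf_def word_tape_def)

lemma look_conf:
  "r \<in> set rs \<Longrightarrow> look r (scan (conf inp h out)) = marked (word_of inp r) (int (h r))"
proof -
  have "map_of (zip rs (map f rs @ [0])) r = Some (f r)" if "r \<in> set rs" for f :: "role \<Rightarrow> nat"
    using that by (simp add: zip_append2 map_of_zip_map)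
  then show "r \<in> set rs \<Longrightarrow> ?thesis" by (simp add: look_def scan_conf)
qed

lemma at0_conf [simp]: "r \<in> set rs \<Longrightarrow> at0 r (scan (conf inp h out)) \<longleftrightarrow> h r = 0"
  by (simp add: at0_def look_conf marked_mark)

lemma at_sym_conf [simp]:
  "Inp i \<in> set rs \<Longrightarrow> a \<le> 2 \<Longrightarrow> at_sym (Inp i) a (scan (conf inp h out)) \<longleftrightarrow>
     fst (word_tape (inp i)) (int (h (Inp i))) = a"
  by (simp add: at_sym_def look_conf marked_sym)

definition mvs :: "(role \<Rightarrow> move) \<Rightarrow> prog" where
  "mvs \<delta> = Act (\<lambda>xs. map2 (\<lambda>r a. (a, \<delta> r)) rs xs @ [(0, Stay)])"

definition emit :: "bool \<Rightarrow> prog" where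
  "emit b = Act (\<lambda>xs. map2 (\<lambda>r a. (a, Stay)) rs xs @ [(bit_symbol b, Go_Right)])"

lemma nth_lessI: "set xs \<subseteq> {..<S} \<Longrightarrow> i < length xs \<Longrightarrow> xs ! i < (S :: nat)"
  using nth_mem by blast

lemma wfp_mvs [simp]: "wfp (mvs \<delta>)"
  by (auto simp: mvs_def set_zip intro: nth_lessI)

lemma wfp_emit [simp]: "wfp (emit b)"
  by (auto simp: emit_def set_zip bit_symbol_def intro: nth_lessI)

lemma map2_map_same: "map2 f (map g ys) (map k ys) = map (\<lambda>y. f (g y) (k y)) ys"
  by (induction ys) auto

fun moved :: "move \<Rightarrow> nat \<Rightarrow> nat" where
  "moved Go_Left n = n - 1"
| "moved Stay n = n"
| "moved Go_Right n = Suc n"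

lemma act_scan:
  "map2 act (map g rs @ [t]) (map2 (\<lambda>r a. (a, \<delta> r)) rs (map k rs @ [0]) @ [u]) =
     map (\<lambda>r. act (g r) (k r, \<delta> r)) rs @ [act t u]"
proof -
  have "map2 (\<lambda>r a. (a, \<delta> r)) rs (map k rs @ [0]) = map (\<lambda>r. (k r, \<delta> r)) rs"
    by (simp add: zip_append2 zip_map2 zip_same_conv_map)
  then show ?thesis by (simp add: map2_map_same zip_append)
qed

lemma runs_mvs:
  assumes "\<And>r. \<delta> r = Go_Left \<Longrightarrow> 0 < h r" "\<And>r. h' r = moved (\<delta> r) (h r)"
  shows "runs inp (mvs \<delta>) h out 1 h' out"
proof -
  have 1: "act (marked x, int (h r)) (marked x (int (h r)), \<delta> r) = (marked x, int (h' r))" for x r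
    using assms(1)[of r] assms(2)[of r] by (cases "\<delta> r") auto
  \<comment> \<open>Writing the blank 0 under the output head is harmless, since a blank is already
    there.\<close>
  have 2: "(fst (word_tape out))(int (length out) := 0) = fst (word_tape out)"
    by (auto simp: word_tape_def)
  have "map2 act (conf inp h out) (map2 (\<lambda>r a. (a, \<delta> r)) rs (scan (conf inp h out)) @ [(0, Stay)])
      = conf inp h' out"
    unfolding scan_conf unfolding conf_def act_scan using 1 2 by simp
  then have "exec (mvs \<delta>) (conf inp h out) 1 (conf inp h' out)"
    unfolding mvs_def
    using exec_Act[of "\<lambda>xs. map2 (\<lambda>r a. (a, \<delta> r)) rs xs @ [(0, Stay)]" "conf inp h out"] by simp
  then show ?thesis by (auto simp: runs_def)
qed

lemma runs_emit: "runs inp (emit b) h out 1 h (out @ [b])"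
proof -
  have 1: "act (marked x, int (h r)) (marked x (int (h r)), Stay) = (marked x, int (h r))" for x r
    by simp
  have 2: "(fst (word_tape out))(int (length out) := bit_symbol b) = fst (word_tape (out @ [b]))"
    by (auto simp: word_tape_def nth_append fun_eq_iff nat_eq_iff)
  have "map2 act (conf inp h out)
      (map2 (\<lambda>r a. (a, Stay)) rs (scan (conf inp h out)) @ [(bit_symbol b, Go_Right)])
      = conf inp h (out @ [b])"
    unfolding scan_conf unfolding conf_def
    using act_scan[where \<delta> = "\<lambda>_. Stay"] 1 2 by simp
  then have "exec (emit b) (conf inp h out) 1 (conf inp h (out @ [b]))"
    unfolding emit_def
    using exec_Act[of "\<lambda>xs. map2 (\<lambda>r a. (a, Stay)) rs xs @ [(bit_symbol b, Go_Right)]"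
        "conf inp h out"] by simp
  then show ?thesis by (auto simp: runs_def)
qed

lemma runs_mono: "runs inp p h out b h' out' \<Longrightarrow> b \<le> b' \<Longrightarrow> runs inp p h out b' h' out'"
  unfolding runs_def using order_trans by blast

lemma runs_Seq:
  assumes "runs inp p h out b h' out'" "runs inp q h' out' b' h'' out''"
  shows "runs inp (Seq p q) h out (b + b') h'' out''"
  using assms unfolding runs_def by (meson add_mono exec_Seq)

lemma runs_Cond:
  assumes "c (scan (conf inp h out)) \<Longrightarrow> runs inp p h out b h' out'"
    "\<not> c (scan (conf inp h out)) \<Longrightarrow> runs inp q h out b h' out'"
  shows "runs inp (Cond c p q) h out (Suc b) h' out'"
  using assms unfolding runs_def by (meson Suc_le_mono exec_CondT exec_CondF)

text \<open>\<open>H\<close> and \<open>G\<close> give the counters and the output after each round,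
  \<open>n\<close> is the number of rounds, and every round costs one extra step for the
  test.\<close>

lemma runs_While:
  assumes "\<And>j. j < n \<Longrightarrow> c (scan (conf inp (H j) (G j)))"
    "\<And>j. j < n \<Longrightarrow> runs inp p (H j) (G j) b (H (Suc j)) (G (Suc j))"
    "\<not> c (scan (conf inp (H n) (G n)))"
  shows "runs inp (While c p) (H 0) (G 0) (n * Suc b + 1) (H n) (G n)"
  using assms
proof (induction n arbitrary: H G)
  case 0
  then have "exec (While c p) (conf inp (H 0) (G 0)) 1 (conf inp (H 0) (G 0))"
    using exec_WhileF by blast
  then show ?case by (auto simp: runs_def)
next
  case (Suc n)
  obtain t where t: "t \<le> b" "exec p (conf inp (H 0) (G 0)) t (conf inp (H 1) (G 1))"
    using Suc.prems(2)[of 0] by (auto simp: runs_def)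
  have "runs inp (While c p) (H (Suc 0)) (G (Suc 0)) (n * Suc b + 1) (H (Suc n)) (G (Suc n))"
    by (rule Suc.IH[of "\<lambda>j. H (Suc j)" "\<lambda>j. G (Suc j)"]) (use Suc.prems in auto)
  then obtain t' where t': "t' \<le> n * Suc b + 1"
    "exec (While c p) (conf inp (H 1) (G 1)) t' (conf inp (H (Suc n)) (G (Suc n)))"
    by (auto simp: runs_def)
  have "exec (While c p) (conf inp (H 0) (G 0)) (Suc (t + t')) (conf inp (H (Suc n)) (G (Suc n)))"
    by (rule exec_WhileT[OF Suc.prems(1) t(2) t'(2)]) simp
  then show ?case unfolding runs_def using t(1) t'(1) by (intro exI conjI) auto
qed

definition inc :: "role \<Rightarrow> prog" where
  "inc r = mvs ((\<lambda>_. Stay)(r := Go_Right))"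

definition dec :: "role \<Rightarrow> prog" where
  "dec r = mvs ((\<lambda>_. Stay)(r := Go_Left))"

definition skip :: prog where
  "skip = mvs (\<lambda>_. Stay)"

definition clear :: "role \<Rightarrow> prog" where
  "clear r = While (\<lambda>xs. \<not> at0 r xs) (dec r)"

lemma wfp_simps [simp]: "wfp (inc r)" "wfp (dec r)" "wfp skip" "wfp (clear r)"
  by (simp_all add: inc_def dec_def skip_def clear_def)

lemma runs_inc: "runs inp (inc r) h out 1 (h(r := Suc (h r))) out"
  unfolding inc_def by (rule runs_mvs) (auto split: if_splits)

lemma runs_dec: "0 < h r \<Longrightarrow> runs inp (dec r) h out 1 (h(r := h r - 1)) out"
  unfolding dec_def by (rule runs_mvs) (auto split: if_splits)

lemma runs_skip: "runs inp skip h out 1 h out"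
  unfolding skip_def by (rule runs_mvs) auto

lemma runs_clear:
  assumes "r \<in> set rs"
  shows "runs inp (clear r) h out (2 * h r + 1) (h(r := 0)) out"
proof -
  have "runs inp (clear r) (h(r := h r - 0)) out (h r * Suc 1 + 1) (h(r := h r - h r)) out"
    unfolding clear_def
  proof (rule runs_While[where H = "\<lambda>j. h(r := h r - j)" and G = "\<lambda>_. out"])
    fix j assume "j < h r"
    then show "runs inp (dec r) (h(r := h r - j)) out 1 (h(r := h r - Suc j)) out"
      using runs_dec[of "h(r := h r - j)" r inp out] by simp
  qed (use assms in auto)
  from runs_mono[OF this, of "2 * h r + 1"] show ?thesis by simp
qed

end

section \<open>Bounded arithmetic formulas\<close>

datatype trm = Cst nat | V nat | Add trm trm | Mul trm trm

fun tval :: "trm \<Rightarrow> (nat \<Rightarrow> nat) \<Rightarrow> nat" where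
  "tval (Cst c) e = c"
| "tval (V v) e = e v"
| "tval (Add s t) e = tval s e + tval t e"
| "tval (Mul s t) e = tval s e * tval t e"

text \<open>The quantifier \<open>Ex t \<phi>\<close> at level \<open>n\<close> binds variable \<open>n\<close>, which ranges over the
  numbers below \<open>t\<close>; \<open>Sym i a t\<close> says that cell \<open>t\<close> of input tape \<open>i\<close> carries symbol \<open>a\<close>.\<close>

datatype fm = Less trm trm | Sym nat nat trm | Neg fm | Conj fm fm | Ex trm fm

fun sat :: "(nat \<Rightarrow> bool list) \<Rightarrow> nat \<Rightarrow> fm \<Rightarrow> (nat \<Rightarrow> nat) \<Rightarrow> bool" where
  "sat inp n (Less s t) e \<longleftrightarrow> tval s e < tval t e"
| "sat inp n (Sym i a t) e \<longleftrightarrow> fst (word_tape (inp i)) (int (tval t e)) = a"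
| "sat inp n (Neg \<phi>) e \<longleftrightarrow> \<not> sat inp n \<phi> e"
| "sat inp n (Conj \<phi> \<psi>) e \<longleftrightarrow> sat inp n \<phi> e \<and> sat inp n \<psi> e"
| "sat inp n (Ex t \<phi>) e \<longleftrightarrow> (\<exists>x<tval t e. sat inp (Suc n) \<phi> (e(n := x)))"

datatype outp = Emit fm | For trm outp

fun gen :: "(nat \<Rightarrow> bool list) \<Rightarrow> nat \<Rightarrow> outp \<Rightarrow> (nat \<Rightarrow> nat) \<Rightarrow> bool list" where
  "gen inp n (Emit \<phi>) e = [sat inp n \<phi> e]"
| "gen inp n (For t p) e = concat (map (\<lambda>x. gen inp (Suc n) p (e(n := x))) [0..<tval t e])"

fun wft :: "nat \<Rightarrow> trm \<Rightarrow> bool" where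
  "wft n (Cst c) \<longleftrightarrow> True"
| "wft n (V v) \<longleftrightarrow> v < n"
| "wft n (Add s t) \<longleftrightarrow> wft n s \<and> wft n t"
| "wft n (Mul s t) \<longleftrightarrow> wft n s \<and> wft n t"

fun wff :: "nat \<Rightarrow> nat \<Rightarrow> fm \<Rightarrow> bool" where
  "wff m n (Less s t) \<longleftrightarrow> wft n s \<and> wft n t"
| "wff m n (Sym i a t) \<longleftrightarrow> i < m \<and> a \<le> 2 \<and> wft n t"
| "wff m n (Neg \<phi>) \<longleftrightarrow> wff m n \<phi>"
| "wff m n (Conj \<phi> \<psi>) \<longleftrightarrow> wff m n \<phi> \<and> wff m n \<psi>"
| "wff m n (Ex t \<phi>) \<longleftrightarrow> wft n t \<and> wff m (Suc n) \<phi>"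

fun wfo :: "nat \<Rightarrow> nat \<Rightarrow> outp \<Rightarrow> bool" where
  "wfo m n (Emit \<phi>) \<longleftrightarrow> wff m n \<phi>"
| "wfo m n (For t p) \<longleftrightarrow> wft n t \<and> wfo m (Suc n) p"

text \<open>Number of levels of scratch counters: one per nested product, and one for copying a
  variable at the innermost level.\<close>

fun tdep :: "trm \<Rightarrow> nat" where
  "tdep (Cst c) = 0"
| "tdep (V v) = 1"
| "tdep (Add s t) = max (tdep s) (tdep t)"
| "tdep (Mul s t) = Suc (max (tdep s) (tdep t))"

fun fdep :: "nat \<Rightarrow> fm \<Rightarrow> nat" where
  "fdep n (Less s t) = max n (max (tdep s) (tdep t))"
| "fdep n (Sym i a t) = max n (tdep t)"
| "fdep n (Neg \<phi>) = fdep n \<phi>"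
| "fdep n (Conj \<phi> \<psi>) = max (fdep n \<phi>) (fdep n \<psi>)"
| "fdep n (Ex t \<phi>) = max (tdep t) (max (Suc n) (fdep (Suc n) \<phi>))"

fun odep :: "nat \<Rightarrow> outp \<Rightarrow> nat" where
  "odep n (Emit \<phi>) = fdep n \<phi>"
| "odep n (For t p) = max (tdep t) (max (Suc n) (odep (Suc n) p))"

lemma tval_mono: "wft n t \<Longrightarrow> (\<And>v. v < n \<Longrightarrow> e v \<le> e' v) \<Longrightarrow> tval t e \<le> tval t e'"
  by (induction t) (auto intro: add_mono mult_mono)

subsection \<open>Time bounds\<close>

abbreviation bnd :: "trm \<Rightarrow> nat \<Rightarrow> nat" where
  "bnd t M \<equiv> tval t (\<lambda>_. M)"

fun ttime :: "trm \<Rightarrow> nat \<Rightarrow> nat" where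
  "ttime (Cst c) M = Suc c"
| "ttime (V v) M = 4 * M + 2"
| "ttime (Add s t) M = ttime s M + ttime t M"
| "ttime (Mul s t) M = ttime s M + bnd s M * Suc (Suc (ttime t M)) + 1"

text \<open>\<open>M\<close> bounds all variables. Below a quantifier it is raised by the bound of
  the new variable; a composition of polynomials is again a polynomial, so the formula being fixed
  keeps the time polynomial.\<close>

fun ftime :: "fm \<Rightarrow> nat \<Rightarrow> nat" where
  "ftime (Less s t) M = ttime s M + ttime t M + 4 * bnd s M + 2 * bnd t M + 5"
| "ftime (Sym i a t) M = ttime t M + 2 * bnd t M + 3"
| "ftime (Neg \<phi>) M = ftime \<phi> M + 2"
| "ftime (Conj \<phi> \<psi>) M = ftime \<phi> M + ftime \<psi> M + 3"
| "ftime (Ex t \<phi>) M =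
     ttime t M + bnd t M * (ftime \<phi> (M + bnd t M) + 4) + 4 * bnd t M + 3"

fun otime :: "outp \<Rightarrow> nat \<Rightarrow> nat" where
  "otime (Emit \<phi>) M = ftime \<phi> M + 3"
| "otime (For t p) M = ttime t M + bnd t M * (otime p (M + bnd t M) + 3) + 2 * bnd t M + 2"

definition polynomial :: "(nat \<Rightarrow> nat) \<Rightarrow> bool" where
  "polynomial f \<longleftrightarrow> (\<exists>p. \<forall>x. f x = poly p x)"

lemma polynomial_const: "polynomial (\<lambda>_. c)"
  unfolding polynomial_def by (rule exI[of _ "[:c:]"]) simp

lemma polynomial_id: "polynomial (\<lambda>x. x)"
  unfolding polynomial_def by (rule exI[of _ "[:0, 1:]"]) simp

lemma polynomial_add: "polynomial f \<Longrightarrow> polynomial g \<Longrightarrow> polynomial (\<lambda>x. f x + g x)"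
  unfolding polynomial_def by (metis poly_add)

lemma polynomial_mult: "polynomial f \<Longrightarrow> polynomial g \<Longrightarrow> polynomial (\<lambda>x. f x * g x)"
  unfolding polynomial_def by (metis poly_mult)

lemma polynomial_Suc: "polynomial f \<Longrightarrow> polynomial (\<lambda>x. Suc (f x))"
  using polynomial_add[of f "\<lambda>_. 1"] polynomial_const by auto

lemma polynomial_compose: "polynomial f \<Longrightarrow> polynomial g \<Longrightarrow> polynomial (\<lambda>x. f (g x))"
  unfolding polynomial_def by (metis poly_pcompose)

lemma poly_nat_mono: "x \<le> y \<Longrightarrow> poly p x \<le> poly p (y :: nat)"
  by (induction p) (auto intro: add_mono mult_mono)

lemmas polynomial_intros =
  polynomial_const polynomial_id polynomial_add polynomial_mult polynomial_Suc

lemma polynomial_bnd: "polynomial (bnd t)"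
  by (induction t) (auto intro!: polynomial_intros)

lemma polynomial_ttime: "polynomial (ttime t)"
  by (induction t) (auto intro!: polynomial_intros polynomial_bnd)

lemma polynomial_ftime: "polynomial (ftime \<phi>)"
proof (induction \<phi>)
  case (Ex t \<phi>)
  have "polynomial (\<lambda>M. ftime \<phi> (M + bnd t M))"
    by (rule polynomial_compose[OF Ex]) (intro polynomial_intros polynomial_bnd)
  then show ?case by (auto intro!: polynomial_intros polynomial_bnd polynomial_ttime)
qed (auto intro!: polynomial_intros polynomial_bnd polynomial_ttime)

lemma polynomial_otime: "polynomial (otime p)"
proof (induction p)
  case (For t p)
  have "polynomial (\<lambda>M. otime p (M + bnd t M))"
    by (rule polynomial_compose[OF For]) (intro polynomial_intros polynomial_bnd)
  then show ?case by (auto intro!: polynomial_intros polynomial_bnd polynomial_ttime)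
qed (auto intro!: polynomial_intros polynomial_ftime)

subsection \<open>Evaluation by programs\<close>

locale machine_roles = roles +
  fixes m N :: nat
  assumes set_rs: "set rs = Inp ` {..<m} \<union> {Flag, Acc1, Acc2} \<union> Var ` {..<N} \<union> Bnd ` {..<N} \<union>
    Cpy ` {..<N} \<union> Prd ` {..<N}"
begin

lemma in_rs [simp]:
  "Inp i \<in> set rs \<longleftrightarrow> i < m" "Flag \<in> set rs" "Acc1 \<in> set rs" "Acc2 \<in> set rs"
  "Var v \<in> set rs \<longleftrightarrow> v < N" "Bnd v \<in> set rs \<longleftrightarrow> v < N"
  "Cpy v \<in> set rs \<longleftrightarrow> v < N" "Prd v \<in> set rs \<longleftrightarrow> v < N"
  by (auto simp: set_rs)

fun incs :: "nat \<Rightarrow> role \<Rightarrow> prog" where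
  "incs 0 r = skip"
| "incs (Suc c) r = Seq (inc r) (incs c r)"

text \<open>Reading a head position destroys it, so a variable is emptied into the target and a copy
  at once and restored from the copy. In a product one factor counts the rounds that add the other.
  The depth \<open>d\<close> keeps scratch counters of nested products apart.\<close>

fun addt :: "nat \<Rightarrow> trm \<Rightarrow> role \<Rightarrow> prog" where
  "addt d (Cst c) r = incs c r"
| "addt d (V v) r =
     Seq (While (\<lambda>xs. \<not> at0 (Var v) xs)
           (mvs ((\<lambda>_. Stay)(Var v := Go_Left, Cpy d := Go_Right, r := Go_Right))))
         (While (\<lambda>xs. \<not> at0 (Cpy d) xs) (mvs ((\<lambda>_. Stay)(Cpy d := Go_Left, Var v := Go_Right))))"
| "addt d (Add s t) r = Seq (addt d s r) (addt d t r)"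
| "addt d (Mul s t) r = Seq (addt (Suc d) s (Prd d))
     (While (\<lambda>xs. \<not> at0 (Prd d) xs) (Seq (dec (Prd d)) (addt (Suc d) t r)))"

definition target :: "nat \<Rightarrow> role \<Rightarrow> bool" where
  "target d r \<longleftrightarrow> (\<forall>v. r \<noteq> Var v) \<and> (\<forall>e\<ge>d. r \<noteq> Cpy e \<and> r \<noteq> Prd e)"

lemma runs_eq:
  "runs inp p h out b h' out' \<Longrightarrow> h' = h'' \<Longrightarrow> b \<le> b' \<Longrightarrow> runs inp p h out b' h'' out'"
  using runs_mono by simp

lemma runs_incs: "runs inp (incs c r) h out (Suc c) (h(r := h r + c)) out"
proof (induction c arbitrary: h)
  case 0
  then show ?case using runs_skip by simp
next
  case (Suc c)
  show ?case unfolding incs.simps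
    by (rule runs_eq[OF runs_Seq[OF runs_inc Suc]]) auto
qed

lemma wfp_incs [simp]: "wfp (incs c r)"
  by (induction c) auto

lemma wfp_addt [simp]: "wfp (addt d t r)"
  by (induction t arbitrary: d r) auto

text \<open>Only \<open>r\<close> changes in the end, so scratch counters from depth
  \<open>d\<close> on are empty again and can be reused in the next round of a product.\<close>

lemma runs_addt:
  assumes "wft n t" "n \<le> N" "d + tdep t \<le> N" "target d r"
    "\<And>e. e \<ge> d \<Longrightarrow> h (Cpy e) = 0 \<and> h (Prd e) = 0" "\<And>v. v < n \<Longrightarrow> h (Var v) \<le> M"
  shows "runs inp (addt d t r) h out (ttime t M) (h(r := h r + tval t (\<lambda>v. h (Var v)))) out"
  using assms
proof (induction t arbitrary: d r h)
  case (Cst c)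
  show ?case unfolding addt.simps tval.simps ttime.simps by (rule runs_incs)
next
  case (V v)
  have rv: "r \<noteq> Var v" "r \<noteq> Cpy d" using V.prems(4) by (auto simp: target_def)
  let ?k = "h (Var v)"
  have kM: "?k \<le> M" using V.prems(1,6) by simp
  let ?h = "h(Var v := 0, Cpy d := ?k, r := h r + ?k)"
  let ?w1 = "While (\<lambda>xs. \<not> at0 (Var v) xs)
    (mvs ((\<lambda>_. Stay)(Var v := Go_Left, Cpy d := Go_Right, r := Go_Right)))"
  let ?w2 = "While (\<lambda>xs. \<not> at0 (Cpy d) xs) (mvs ((\<lambda>_. Stay)(Cpy d := Go_Left, Var v := Go_Right)))"
  have "runs inp ?w1 (h(Var v := ?k - 0, Cpy d := 0, r := h r + 0)) out (?k * Suc 1 + 1)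
      (h(Var v := ?k - ?k, Cpy d := ?k, r := h r + ?k)) out"
  proof (rule runs_While[where H = "\<lambda>j. h(Var v := ?k - j, Cpy d := j, r := h r + j)"
        and G = "\<lambda>_. out"])
    fix j assume "j < ?k"
    then show "runs inp (mvs ((\<lambda>_. Stay)(Var v := Go_Left, Cpy d := Go_Right, r := Go_Right)))
        (h(Var v := ?k - j, Cpy d := j, r := h r + j)) out 1
        (h(Var v := ?k - Suc j, Cpy d := Suc j, r := h r + Suc j)) out"
      using rv by (intro runs_mvs) (auto split: if_splits)
  qed (use V.prems rv in auto)
  moreover have "h(Var v := ?k - 0, Cpy d := 0, r := h r + 0) = h"
    using V.prems(5)[of d] by auto
  ultimately have 1: "runs inp ?w1 h out (2 * M + 1) ?h out"
    using kM by (auto elim!: runs_mono)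
  have "runs inp ?w2 (?h(Cpy d := ?k - 0, Var v := 0)) out (?k * Suc 1 + 1)
      (?h(Cpy d := ?k - ?k, Var v := ?k)) out"
  proof (rule runs_While[where H = "\<lambda>j. ?h(Cpy d := ?k - j, Var v := j)" and G = "\<lambda>_. out"])
    fix j assume "j < ?k"
    then show "runs inp (mvs ((\<lambda>_. Stay)(Cpy d := Go_Left, Var v := Go_Right)))
        (?h(Cpy d := ?k - j, Var v := j)) out 1 (?h(Cpy d := ?k - Suc j, Var v := Suc j)) out"
      using rv by (intro runs_mvs) (auto split: if_splits)
  qed (use V.prems rv in auto)
  moreover have "?h(Cpy d := ?k - 0, Var v := 0) = ?h"
    using rv by auto
  moreover have "?h(Cpy d := ?k - ?k, Var v := ?k) = h(r := h r + ?k)"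
    using rv V.prems(5)[of d] by auto
  ultimately have 2: "runs inp ?w2 ?h out (2 * M + 1) (h(r := h r + ?k)) out"
    using kM by (auto elim!: runs_mono)
  show ?case unfolding addt.simps by (rule runs_eq[OF runs_Seq[OF 1 2]]) auto
next
  case (Add s t)
  let ?h = "h(r := h r + tval s (\<lambda>v. h (Var v)))"
  have *: "(\<lambda>v. ?h (Var v)) = (\<lambda>v. h (Var v))"
    using Add.prems(4) by (auto simp: target_def fun_eq_iff)
  have "runs inp (addt d s r) h out (ttime s M) ?h out"
    by (rule Add.IH(1)) (use Add.prems in auto)
  moreover have "runs inp (addt d t r) ?h out (ttime t M)
      (?h(r := ?h r + tval t (\<lambda>v. ?h (Var v)))) out"
    by (rule Add.IH(2)) (use Add.prems in \<open>auto simp: target_def\<close>)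
  ultimately show ?case
    unfolding * addt.simps ttime.simps by (rule runs_eq[OF runs_Seq]) auto
next
  case (Mul s t)
  let ?e = "\<lambda>v. h (Var v)"
  let ?k = "tval s ?e"
  have r: "r \<noteq> Prd d" "\<And>v. r \<noteq> Var v" using Mul.prems(4) by (auto simp: target_def)
  have r': "r \<noteq> Cpy e" "r \<noteq> Prd e" if "Suc d \<le> e" for e
    using Mul.prems(4) that by (auto simp: target_def)
  have "runs inp (addt (Suc d) s (Prd d)) h out (ttime s M) (h(Prd d := h (Prd d) + ?k)) out"
    by (rule Mul.IH(1)) (use Mul.prems in \<open>auto simp: target_def\<close>)
  then have 1: "runs inp (addt (Suc d) s (Prd d)) h out (ttime s M) (h(Prd d := ?k)) out"
    using Mul.prems(5)[of d] by simp
  let ?w = "While (\<lambda>xs. \<not> at0 (Prd d) xs) (Seq (dec (Prd d)) (addt (Suc d) t r))"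
  let ?H = "\<lambda>j. h(Prd d := ?k - j, r := h r + j * tval t ?e)"
  have "runs inp ?w (?H 0) out (?k * Suc (Suc (ttime t M)) + 1) (?H ?k) out"
  proof (rule runs_While[where H = ?H and G = "\<lambda>_. out"])
    fix j assume j: "j < ?k"
    let ?h = "h(Prd d := ?k - Suc j, r := h r + j * tval t ?e)"
    have "runs inp (dec (Prd d)) (?H j) out 1 ?h out"
      using runs_dec[of "?H j" "Prd d" inp out] j r by (auto simp: fun_upd_twist)
    moreover have "runs inp (addt (Suc d) t r) ?h out (ttime t M)
        (?h(r := ?h r + tval t (\<lambda>v. ?h (Var v)))) out"
    proof (rule Mul.IH(2))
      fix e assume "Suc d \<le> e"
      then show "?h (Cpy e) = 0 \<and> ?h (Prd e) = 0"
        using r'[of e] Mul.prems(5)[of e] by auto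
    qed (use Mul.prems r in \<open>auto simp: target_def\<close>)
    moreover have *: "(\<lambda>v. ?h (Var v)) = ?e" using r by (auto simp: fun_eq_iff)
    have "?h(r := ?h r + tval t (\<lambda>v. ?h (Var v))) = ?H (Suc j)"
      unfolding * using r by (auto simp: fun_eq_iff)
    ultimately show "runs inp (Seq (dec (Prd d)) (addt (Suc d) t r)) (?H j) out
        (Suc (ttime t M)) (?H (Suc j)) out"
      using runs_Seq by fastforce
  qed (use Mul.prems r in auto)
  moreover have "?k \<le> bnd s M" using tval_mono[of n s ?e "\<lambda>_. M"] Mul.prems by auto
  then have "?k * Suc (Suc (ttime t M)) + 1 \<le> bnd s M * Suc (Suc (ttime t M)) + 1"
    by (intro add_mono mult_mono) auto
  moreover have "?H 0 = h(Prd d := ?k)" using r by auto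
  moreover have "?H ?k = h(r := h r + ?k * tval t ?e)"
    using Mul.prems(5)[of d] r by auto
  ultimately have 2: "runs inp ?w (h(Prd d := ?k)) out (bnd s M * Suc (Suc (ttime t M)) + 1)
      (h(r := h r + ?k * tval t ?e)) out"
    by (auto elim!: runs_mono)
  show ?case unfolding addt.simps by (rule runs_eq[OF runs_Seq[OF 1 2]]) auto
qed

end

section \<open>Programs for formulas and for printed words\<close>

context machine_roles begin

text \<open>The truth value appears as 0 or 1 in \<open>Flag\<close>, and all other counters return
  to their former values. A quantifier tries its values in increasing order and stops at the first
  witness, which keeps \<open>Flag\<close> from being overwritten.\<close>

fun ev :: "nat \<Rightarrow> fm \<Rightarrow> prog" where
  "ev n (Less s t) = Seq (addt 0 s Acc1) (Seq (addt 0 t Acc2)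
     (Seq (While (\<lambda>xs. \<not> at0 Acc1 xs \<and> \<not> at0 Acc2 xs)
            (mvs ((\<lambda>_. Stay)(Acc1 := Go_Left, Acc2 := Go_Left))))
       (Seq (Cond (at0 Acc2) skip (inc Flag)) (Seq (clear Acc1) (clear Acc2)))))"
| "ev n (Sym i a t) = Seq (addt 0 t (Inp i))
     (Seq (Cond (at_sym (Inp i) a) (inc Flag) skip) (clear (Inp i)))"
| "ev n (Neg \<phi>) = Seq (ev n \<phi>) (Cond (at0 Flag) (inc Flag) (dec Flag))"
| "ev n (Conj \<phi> \<psi>) = Seq (ev n \<phi>) (Cond (at0 Flag) skip (Seq (dec Flag) (ev n \<psi>)))"
| "ev n (Ex t \<phi>) = Seq (addt 0 t (Bnd n))
     (Seq (While (\<lambda>xs. at0 Flag xs \<and> \<not> at0 (Bnd n) xs)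
            (Seq (dec (Bnd n)) (Seq (ev (Suc n) \<phi>) (Cond (at0 Flag) (inc (Var n)) skip))))
       (Seq (clear (Bnd n)) (clear (Var n))))"

fun evo :: "nat \<Rightarrow> outp \<Rightarrow> prog" where
  "evo n (Emit \<phi>) = Seq (ev n \<phi>) (Cond (at0 Flag) (emit False) (Seq (dec Flag) (emit True)))"
| "evo n (For t p) = Seq (addt 0 t (Bnd n))
     (Seq (While (\<lambda>xs. \<not> at0 (Bnd n) xs) (Seq (dec (Bnd n)) (Seq (evo (Suc n) p) (inc (Var n)))))
       (clear (Var n)))"

lemma wfp_ev [simp]: "wfp (ev n \<phi>)"
  by (induction \<phi> arbitrary: n) auto

lemma wfp_evo [simp]: "wfp (evo n p)"
  by (induction p arbitrary: n) auto

definition ready :: "nat \<Rightarrow> (role \<Rightarrow> nat) \<Rightarrow> bool" where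
  "ready n h \<longleftrightarrow> h Flag = 0 \<and> h Acc1 = 0 \<and> h Acc2 = 0 \<and> (\<forall>i. h (Inp i) = 0) \<and>
     (\<forall>d. h (Cpy d) = 0 \<and> h (Prd d) = 0) \<and> (\<forall>v\<ge>n. h (Var v) = 0 \<and> h (Bnd v) = 0)"

definition env :: "(role \<Rightarrow> nat) \<Rightarrow> nat \<Rightarrow> nat" where
  "env h = (\<lambda>v. h (Var v))"

lemma env_simps [simp]:
  "env (h(Flag := x)) = env h" "env (h(Acc1 := x)) = env h" "env (h(Acc2 := x)) = env h"
  "env (h(Inp i := x)) = env h" "env (h(Cpy d := x)) = env h" "env (h(Prd d := x)) = env h"
  "env (h(Bnd v := x)) = env h" "env (h(Var v := x)) = (env h)(v := x)"
  by (auto simp: env_def fun_eq_iff)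

lemma ready_simps:
  "ready n h \<Longrightarrow> h Flag = 0" "ready n h \<Longrightarrow> h Acc1 = 0" "ready n h \<Longrightarrow> h Acc2 = 0"
  "ready n h \<Longrightarrow> h (Inp i) = 0" "ready n h \<Longrightarrow> h (Cpy d) = 0" "ready n h \<Longrightarrow> h (Prd d) = 0"
  "ready n h \<Longrightarrow> h (Var n) = 0" "ready n h \<Longrightarrow> h (Bnd n) = 0"
  by (auto simp: ready_def)

lemma ready_Suc: "ready n h \<Longrightarrow> ready (Suc n) (h(Var n := x, Bnd n := y))"
  by (auto simp: ready_def)

lemma runs_addt0:
  assumes "wft n t" "n \<le> N" "tdep t \<le> N" "target 0 r" "ready n h" "h r = 0"
    "\<And>v. v < n \<Longrightarrow> env h v \<le> M"
  shows "runs inp (addt 0 t r) h out (ttime t M) (h(r := tval t (env h))) out"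
  using runs_addt[of n t 0 r h M inp out] assms by (auto simp: ready_def env_def)

lemma targets [simp]:
  "target d Acc1" "target d Acc2" "target d Flag" "target d (Inp i)" "target d (Bnd n)"
  by (auto simp: target_def)

lemma runs_ev:
  assumes "wff m n \<phi>" "fdep n \<phi> \<le> N" "ready n h" "\<And>v. v < n \<Longrightarrow> env h v \<le> M"
  shows "runs inp (ev n \<phi>) h out (ftime \<phi> M) (h(Flag := of_bool (sat inp n \<phi> (env h)))) out"
  using assms
proof (induction \<phi> arbitrary: n h M)
  case (Less s t)
  let ?a = "tval s (env h)" and ?b = "tval t (env h)"
  have ab: "?a \<le> bnd s M" "?b \<le> bnd t M"
    using Less.prems by (auto intro!: tval_mono)
  note r = ready_simps[OF Less.prems(3)]
  have 1: "runs inp (addt 0 s Acc1) h out (ttime s M) (h(Acc1 := ?a)) out"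
    by (rule runs_addt0) (use Less.prems r in auto)
  have 2: "runs inp (addt 0 t Acc2) (h(Acc1 := ?a)) out (ttime t M) (h(Acc1 := ?a, Acc2 := ?b)) out"
    using runs_addt[of n t 0 Acc2 "h(Acc1 := ?a)" M inp out] Less.prems
    by (auto simp: ready_def env_def)
  \<comment> \<open>Both numbers are run down together until one is exhausted; the first was smaller
    iff something is left of the second.\<close>
  let ?k = "min ?a ?b"
  let ?H = "\<lambda>j. h(Acc1 := ?a - j, Acc2 := ?b - j)"
  let ?w = "While (\<lambda>xs. \<not> at0 Acc1 xs \<and> \<not> at0 Acc2 xs)
            (mvs ((\<lambda>_. Stay)(Acc1 := Go_Left, Acc2 := Go_Left)))"
  have "runs inp ?w (?H 0) out (?k * Suc 1 + 1) (?H ?k) out"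
  proof (rule runs_While[where H = ?H and G = "\<lambda>_. out"])
    fix j assume "j < ?k"
    then show "runs inp (mvs ((\<lambda>_. Stay)(Acc1 := Go_Left, Acc2 := Go_Left))) (?H j) out 1
        (?H (Suc j)) out"
      by (intro runs_mvs) (auto split: if_splits)
  qed auto
  then have 3: "runs inp ?w (h(Acc1 := ?a, Acc2 := ?b)) out (2 * bnd s M + 1) (?H ?k) out"
    using ab by (auto elim!: runs_mono)
  let ?f = "of_bool (?a < ?b) :: nat"
  let ?h = "(?H ?k)(Flag := ?f)"
  have 4: "runs inp (Cond (at0 Acc2) skip (inc Flag)) (?H ?k) out 2 ?h out"
    unfolding numeral_2_eq_2
  proof (rule runs_Cond)
    assume "at0 Acc2 (scan (conf inp (?H ?k) out))"
    then show "runs inp skip (?H ?k) out (Suc 0) ?h out"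
      by (intro runs_eq[OF runs_skip]) (auto simp: r)
  next
    assume "\<not> at0 Acc2 (scan (conf inp (?H ?k) out))"
    then show "runs inp (inc Flag) (?H ?k) out (Suc 0) ?h out"
      by (intro runs_eq[OF runs_inc]) (auto simp: r)
  qed
  have 5: "runs inp (clear Acc1) ?h out (2 * bnd s M + 1) (?h(Acc1 := 0)) out"
    by (rule runs_eq[OF runs_clear]) (use ab in auto)
  have 6: "runs inp (clear Acc2) (?h(Acc1 := 0)) out (2 * bnd t M + 1) (h(Flag := ?f)) out"
    by (rule runs_eq[OF runs_clear]) (use ab r in \<open>auto simp: fun_eq_iff\<close>)
  show ?case unfolding ev.simps
    by (rule runs_eq[OF runs_Seq[OF 1 runs_Seq[OF 2 runs_Seq[OF 3 runs_Seq[OF 4 runs_Seq[OF 5 6]]]]]])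
      auto
next
  case (Sym i a t)
  let ?k = "tval t (env h)"
  let ?f = "of_bool (fst (word_tape (inp i)) (int ?k) = a) :: nat"
  have k: "?k \<le> bnd t M" using Sym.prems by (auto intro!: tval_mono)
  note r = ready_simps[OF Sym.prems(3)]
  have 1: "runs inp (addt 0 t (Inp i)) h out (ttime t M) (h(Inp i := ?k)) out"
    by (rule runs_addt0) (use Sym.prems r in auto)
  let ?h = "h(Inp i := ?k, Flag := ?f)"
  have 2: "runs inp (Cond (at_sym (Inp i) a) (inc Flag) skip) (h(Inp i := ?k)) out 2 ?h out"
    unfolding numeral_2_eq_2
  proof (rule runs_Cond)
    assume "at_sym (Inp i) a (scan (conf inp (h(Inp i := ?k)) out))"
    then show "runs inp (inc Flag) (h(Inp i := ?k)) out (Suc 0) ?h out"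
      using Sym.prems(1) by (intro runs_eq[OF runs_inc]) (auto simp: r)
  next
    assume "\<not> at_sym (Inp i) a (scan (conf inp (h(Inp i := ?k)) out))"
    then show "runs inp skip (h(Inp i := ?k)) out (Suc 0) ?h out"
      using Sym.prems(1) by (intro runs_eq[OF runs_skip]) (auto simp: r)
  qed
  have 3: "runs inp (clear (Inp i)) ?h out (2 * bnd t M + 1) (h(Flag := ?f)) out"
    by (rule runs_eq[OF runs_clear]) (use Sym.prems(1) k r in \<open>auto simp: fun_eq_iff\<close>)
  show ?case unfolding ev.simps
    by (rule runs_eq[OF runs_Seq[OF 1 runs_Seq[OF 2 3]]]) auto
next
  case (Neg \<phi>)
  let ?s = "sat inp n \<phi> (env h)"
  note r = ready_simps[OF Neg.prems(3)]
  have 1: "runs inp (ev n \<phi>) h out (ftime \<phi> M) (h(Flag := of_bool ?s)) out"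
    by (rule Neg.IH) (use Neg.prems in auto)
  have 2: "runs inp (Cond (at0 Flag) (inc Flag) (dec Flag)) (h(Flag := of_bool ?s)) out 2
      (h(Flag := of_bool (\<not> ?s))) out"
    unfolding numeral_2_eq_2
  proof (rule runs_Cond)
    assume "at0 Flag (scan (conf inp (h(Flag := of_bool ?s)) out))"
    then show "runs inp (inc Flag) (h(Flag := of_bool ?s)) out (Suc 0) (h(Flag := of_bool (\<not> ?s))) out"
      by (intro runs_eq[OF runs_inc]) auto
  next
    assume "\<not> at0 Flag (scan (conf inp (h(Flag := of_bool ?s)) out))"
    then show "runs inp (dec Flag) (h(Flag := of_bool ?s)) out (Suc 0) (h(Flag := of_bool (\<not> ?s))) out"
      by (intro runs_eq[OF runs_dec]) auto
  qed
  show ?case unfolding ev.simps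
    by (rule runs_eq[OF runs_Seq[OF 1 2]]) auto
next
  case (Conj \<phi> \<psi>)
  let ?s = "sat inp n \<phi> (env h)" and ?s' = "sat inp n \<psi> (env h)"
  note r = ready_simps[OF Conj.prems(3)]
  have 1: "runs inp (ev n \<phi>) h out (ftime \<phi> M) (h(Flag := of_bool ?s)) out"
    by (rule Conj.IH(1)) (use Conj.prems in auto)
  have 2: "runs inp (ev n \<psi>) h out (ftime \<psi> M) (h(Flag := of_bool ?s')) out"
    by (rule Conj.IH(2)) (use Conj.prems in auto)
  let ?h = "h(Flag := of_bool (?s \<and> ?s'))"
  have 3: "runs inp (Cond (at0 Flag) skip (Seq (dec Flag) (ev n \<psi>))) (h(Flag := of_bool ?s)) out
      (Suc (1 + ftime \<psi> M)) ?h out"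
  proof (rule runs_Cond)
    assume "at0 Flag (scan (conf inp (h(Flag := of_bool ?s)) out))"
    then show "runs inp skip (h(Flag := of_bool ?s)) out (1 + ftime \<psi> M) ?h out"
      by (intro runs_eq[OF runs_skip]) auto
  next
    assume "\<not> at0 Flag (scan (conf inp (h(Flag := of_bool ?s)) out))"
    then have s: ?s by (auto split: if_splits)
    have "runs inp (dec Flag) (h(Flag := of_bool ?s)) out 1 h out"
      by (rule runs_eq[OF runs_dec]) (use s r in \<open>auto simp: fun_eq_iff\<close>)
    from runs_Seq[OF this 2] s
    show "runs inp (Seq (dec Flag) (ev n \<psi>)) (h(Flag := of_bool ?s)) out (1 + ftime \<psi> M) ?h out"
      by simp
  qed
  show ?case unfolding ev.simps
    by (rule runs_eq[OF runs_Seq[OF 1 3]]) auto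
next
  case (Ex t \<phi>)
  let ?T = "tval t (env h)"
  let ?P = "\<lambda>x. sat inp (Suc n) \<phi> ((env h)(n := x))"
  have T: "?T \<le> bnd t M" using Ex.prems by (auto intro!: tval_mono)
  note r = ready_simps[OF Ex.prems(3)]
  have nN: "n < N" "tdep t \<le> N" using Ex.prems(2) by auto
  have 1: "runs inp (addt 0 t (Bnd n)) h out (ttime t M) (h(Bnd n := ?T)) out"
    by (rule runs_addt0) (use Ex.prems r nN in auto)
  \<comment> \<open>The least witness, or the bound itself if there is none.\<close>
  define k where "k = (LEAST x. ?P x \<or> x = ?T)"
  have k1: "?P k \<or> k = ?T" unfolding k_def by (rule LeastI[of _ ?T]) simp
  have k2: "k \<le> ?T" unfolding k_def by (rule Least_le) simp
  have k3: "\<not> ?P x" if "x < k" for x using not_less_Least[OF that[unfolded k_def]] by auto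
  have ex: "(\<exists>x<?T. ?P x) \<longleftrightarrow> k < ?T"
    using k1 k2 k3 by (metis le_neq_implies_less linorder_neqE_nat order_less_imp_not_less
        order_less_le_trans)
  let ?M = "M + bnd t M"
  let ?b = "Seq (dec (Bnd n)) (Seq (ev (Suc n) \<phi>) (Cond (at0 Flag) (inc (Var n)) skip))"
  \<comment> \<open>Beyond \<open>k\<close> the search has succeeded: the variable keeps the witness
    and the flag is set.\<close>
  let ?H = "\<lambda>j. if j \<le> k then h(Var n := j, Bnd n := ?T - j)
      else h(Var n := k, Bnd n := ?T - Suc k, Flag := 1)"
  have step: "runs inp ?b (h(Var n := j, Bnd n := ?T - j)) out (ftime \<phi> ?M + 3)
      (if ?P j then h(Var n := j, Bnd n := ?T - Suc j, Flag := 1)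
       else h(Var n := Suc j, Bnd n := ?T - Suc j)) out" if j: "j < ?T" for j
  proof -
    let ?h = "h(Var n := j, Bnd n := ?T - Suc j)"
    have a: "runs inp (dec (Bnd n)) (h(Var n := j, Bnd n := ?T - j)) out 1 ?h out"
      by (rule runs_eq[OF runs_dec]) (use j in auto)
    have e: "env ?h = (env h)(n := j)" by simp
    have "runs inp (ev (Suc n) \<phi>) ?h out (ftime \<phi> ?M)
        (?h(Flag := of_bool (sat inp (Suc n) \<phi> (env ?h)))) out"
    proof (rule Ex.IH)
      show "ready (Suc n) ?h" using Ex.prems(3) by (rule ready_Suc)
      show "env ?h v \<le> ?M" if "v < Suc n" for v
        using that Ex.prems(4)[of v] j T by (cases "v = n") auto
    qed (use Ex.prems in auto)
    note b = this[unfolded e]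
    have c: "runs inp (Cond (at0 Flag) (inc (Var n)) skip) (?h(Flag := of_bool (?P j))) out (Suc 1)
      (if ?P j then ?h(Flag := 1) else h(Var n := Suc j, Bnd n := ?T - Suc j)) out"
    proof (rule runs_Cond)
      assume "at0 Flag (scan (conf inp (?h(Flag := of_bool (?P j))) out))"
      then show "runs inp (inc (Var n)) (?h(Flag := of_bool (?P j))) out 1
        (if ?P j then ?h(Flag := 1) else h(Var n := Suc j, Bnd n := ?T - Suc j)) out"
        by (intro runs_eq[OF runs_inc]) (auto simp: fun_eq_iff r)
    next
      assume "\<not> at0 Flag (scan (conf inp (?h(Flag := of_bool (?P j))) out))"
      then show "runs inp skip (?h(Flag := of_bool (?P j))) out 1
        (if ?P j then ?h(Flag := 1) else h(Var n := Suc j, Bnd n := ?T - Suc j)) out"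
        by (intro runs_eq[OF runs_skip]) (auto simp: fun_eq_iff r)
    qed
    show ?thesis by (rule runs_eq[OF runs_Seq[OF a runs_Seq[OF b c]]]) auto
  qed
  \<comment> \<open>The number of rounds, where a successful round counts as well.\<close>
  define K where "K = (if k < ?T then Suc k else ?T)"
  have w0: "runs inp (While (\<lambda>xs. at0 Flag xs \<and> \<not> at0 (Bnd n) xs) ?b) (?H 0) out
      (K * Suc (ftime \<phi> ?M + 3) + 1) (?H K) out"
  proof (rule runs_While[where H = ?H and G = "\<lambda>_. out"])
    fix j assume j: "j < K"
    then have jk: "j \<le> k" "j < ?T" using k2 by (auto simp: K_def split: if_splits)
    show "at0 Flag (scan (conf inp (?H j) out)) \<and> \<not> at0 (Bnd n) (scan (conf inp (?H j) out))"
      using jk r nN by auto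
    show "runs inp ?b (?H j) out (ftime \<phi> ?M + 3) (?H (Suc j)) out"
    proof (cases "j = k")
      case True
      then have "?P j" using k1 jk by auto
      then show ?thesis using step[OF jk(2)] True by simp
    next
      case False
      then have "j < k" "\<not> ?P j" using jk k3 by auto
      then show ?thesis using step[OF jk(2)] by simp
    qed
  next
    show "\<not> (at0 Flag (scan (conf inp (?H K) out)) \<and> \<not> at0 (Bnd n) (scan (conf inp (?H K) out)))"
      using k2 r nN by (auto simp: K_def)
  qed
  have w1: "?H 0 = h(Bnd n := ?T)" using r by (auto simp: fun_eq_iff)
  have "K \<le> bnd t M" using T k2 by (auto simp: K_def)
  then have w2: "K * Suc (ftime \<phi> ?M + 3) + 1 \<le> bnd t M * Suc (ftime \<phi> ?M + 3) + 1"
    by (intro add_mono mult_mono) auto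
  have 2: "runs inp (While (\<lambda>xs. at0 Flag xs \<and> \<not> at0 (Bnd n) xs) ?b)
      (h(Bnd n := ?T)) out (bnd t M * Suc (ftime \<phi> ?M + 3) + 1) (?H K) out"
    using runs_mono[OF w0 w2] unfolding w1 .
  have 3: "runs inp (clear (Bnd n)) (?H K) out (2 * bnd t M + 1) ((?H K)(Bnd n := 0)) out"
    by (rule runs_eq[OF runs_clear]) (use T nN in \<open>auto split: if_splits\<close>)
  have 4: "runs inp (clear (Var n)) ((?H K)(Bnd n := 0)) out (2 * bnd t M + 1)
      ((?H K)(Bnd n := 0, Var n := 0)) out"
    by (rule runs_eq[OF runs_clear]) (use T k2 nN in \<open>auto simp: K_def split: if_splits\<close>)
  have 5: "(?H K)(Bnd n := 0, Var n := 0) = h(Flag := of_bool (\<exists>x<?T. ?P x))"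
    unfolding ex K_def using r by (auto simp: fun_eq_iff)
  show ?case unfolding ev.simps
    by (rule runs_eq[OF runs_Seq[OF 1 runs_Seq[OF 2 runs_Seq[OF 3 4]]]])
      (use 5 in \<open>auto simp: algebra_simps\<close>)
qed

lemma runs_evo:
  assumes "wfo m n p" "odep n p \<le> N" "ready n h" "\<And>v. v < n \<Longrightarrow> env h v \<le> M"
  shows "runs inp (evo n p) h out (otime p M) h (out @ gen inp n p (env h))"
  using assms
proof (induction p arbitrary: n h M out)
  case (Emit \<phi>)
  let ?s = "sat inp n \<phi> (env h)"
  have f: "h Flag = 0" using Emit.prems(3) by (simp add: ready_def)
  have 1: "runs inp (ev n \<phi>) h out (ftime \<phi> M) (h(Flag := of_bool ?s)) out"
    by (rule runs_ev) (use Emit.prems in auto)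
  have 2: "runs inp (Cond (at0 Flag) (emit False) (Seq (dec Flag) (emit True)))
      (h(Flag := of_bool ?s)) out (Suc (1 + 1)) h (out @ [?s])"
  proof (rule runs_Cond)
    assume "at0 Flag (scan (conf inp (h(Flag := of_bool ?s)) out))"
    then have s: "\<not> ?s" by (auto split: if_splits)
    then have "h(Flag := of_bool ?s) = h" using f by auto
    then show "runs inp (emit False) (h(Flag := of_bool ?s)) out (1 + 1) h (out @ [?s])"
      using s runs_mono[OF runs_emit] by simp
  next
    assume "\<not> at0 Flag (scan (conf inp (h(Flag := of_bool ?s)) out))"
    then have s: ?s by (auto split: if_splits)
    have "runs inp (dec Flag) (h(Flag := of_bool ?s)) out 1 h out"
      by (rule runs_eq[OF runs_dec]) (use s f in auto)
    then show "runs inp (Seq (dec Flag) (emit True)) (h(Flag := of_bool ?s)) out (1 + 1) h (out @ [?s])"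
      using s runs_Seq[OF _ runs_emit] by simp
  qed
  show ?case using runs_mono[OF runs_Seq[OF 1 2], of "otime (Emit \<phi>) M"] by simp
next
  case (For t p)
  let ?T = "tval t (env h)"
  have T: "?T \<le> bnd t M" using For.prems by (auto intro!: tval_mono)
  note r = ready_simps[OF For.prems(3)]
  have nN: "n < N" "tdep t \<le> N" using For.prems(2) by auto
  have 1: "runs inp (addt 0 t (Bnd n)) h out (ttime t M) (h(Bnd n := ?T)) out"
    by (rule runs_addt0) (use For.prems r nN in auto)
  let ?M = "M + bnd t M"
  let ?b = "Seq (dec (Bnd n)) (Seq (evo (Suc n) p) (inc (Var n)))"
  let ?H = "\<lambda>j. h(Var n := j, Bnd n := ?T - j)"
  let ?G = "\<lambda>j. out @ concat (map (\<lambda>x. gen inp (Suc n) p ((env h)(n := x))) [0..<j])"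
  have "runs inp (While (\<lambda>xs. \<not> at0 (Bnd n) xs) ?b) (?H 0) (?G 0)
      (?T * Suc (otime p ?M + 2) + 1) (?H ?T) (?G ?T)"
  proof (rule runs_While[where H = ?H and G = ?G])
    fix j assume j: "j < ?T"
    show "\<not> at0 (Bnd n) (scan (conf inp (?H j) (?G j)))" using j nN by auto
    let ?h = "h(Var n := j, Bnd n := ?T - Suc j)"
    have a: "runs inp (dec (Bnd n)) (?H j) (?G j) 1 ?h (?G j)"
      by (rule runs_eq[OF runs_dec]) (use j in auto)
    have b: "runs inp (evo (Suc n) p) ?h (?G j) (otime p ?M) ?h
        (?G j @ gen inp (Suc n) p (env ?h))"
    proof (rule For.IH)
      show "ready (Suc n) ?h" using For.prems(3) by (rule ready_Suc)
      show "env ?h v \<le> ?M" if "v < Suc n" for v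
        using that For.prems(4)[of v] j T by (cases "v = n") auto
    qed (use For.prems in auto)
    have c: "runs inp (inc (Var n)) ?h (?G (Suc j)) 1 (?H (Suc j)) (?G (Suc j))"
      by (rule runs_eq[OF runs_inc]) auto
    have "?G j @ gen inp (Suc n) p (env ?h) = ?G (Suc j)" by simp
    then show "runs inp ?b (?H j) (?G j) (otime p ?M + 2) (?H (Suc j)) (?G (Suc j))"
      using runs_mono[OF runs_Seq[OF a runs_Seq[OF b]], of _ _ _ _ "otime p ?M + 2"] c by simp
  qed (use nN in auto)
  moreover have "?H 0 = h(Bnd n := ?T)" using r by (auto simp: fun_eq_iff)
  moreover have "?T * Suc (otime p ?M + 2) + 1 \<le> bnd t M * Suc (otime p ?M + 2) + 1"
    using T by (intro add_mono mult_mono) auto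
  ultimately have 2: "runs inp (While (\<lambda>xs. \<not> at0 (Bnd n) xs) ?b) (h(Bnd n := ?T)) out
      (bnd t M * Suc (otime p ?M + 2) + 1) (?H ?T) (?G ?T)"
    by (auto elim!: runs_mono)
  have 3: "runs inp (clear (Var n)) (?H ?T) (?G ?T) (2 * bnd t M + 1) h (?G ?T)"
    by (rule runs_eq[OF runs_clear]) (use T nN r in \<open>auto simp: fun_eq_iff\<close>)
  have "?G ?T = out @ gen inp n (For t p) (env h)" by simp
  then show ?case unfolding evo.simps
    using runs_mono[OF runs_Seq[OF 1 runs_Seq[OF 2 3]], of "otime (For t p) M"]
    by (auto simp: algebra_simps)
qed

end

section \<open>Polynomial time for words defined by formulas\<close>

definition role_list :: "nat \<Rightarrow> nat \<Rightarrow> role list" where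
  "role_list m N = map Inp [0..<m] @ [Flag, Acc1, Acc2] @ map Var [0..<N] @ map Bnd [0..<N] @
     map Cpy [0..<N] @ map Prd [0..<N]"

interpretation machine_roles "role_list m N" m N for m N
  by unfold_locales (auto simp: role_list_def distinct_map inj_on_def)

definition inputs :: "bool list list \<Rightarrow> nat \<Rightarrow> bool list" where
  "inputs xs i = (if i < length xs then xs ! i else [])"

lemma inputs_simps [simp]:
  "inputs (x # xs) 0 = x" "inputs (x # xs) (Suc i) = inputs xs i"
  by (auto simp: inputs_def)

definition mark :: prog where
  "mark = Act (\<lambda>xs. map (\<lambda>a. (if a < 3 then a + 3 else a, Stay)) (butlast xs) @ [(0, Stay)])"

lemma wfp_mark [simp]: "wf_prog (Suc k) 6 mark"
  by (auto simp: mark_def dest: in_set_butlastD)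

lemma word_of_role_list:
  "i < length (role_list (length xs) N) \<Longrightarrow>
     word_of (inputs xs) (role_list (length xs) N ! i) = inputs xs i"
  by (auto simp: role_list_def nth_append nth_Cons' inputs_def)

lemma exec_mark:
  fixes xs N
  defines "rs \<equiv> role_list (length xs) N"
  assumes k: "num_tapes M = Suc (length rs)"
  shows "exec mark (snd (init_config M xs)) 1 (conf (length xs) N (inputs xs) (\<lambda>_. 0) [])"
proof -
  let ?ts = "snd (init_config M xs)"
  have ts: "?ts = map (\<lambda>i. word_tape (inputs xs i)) [0..<length rs] @ [word_tape []]"
    using k by (auto simp: init_config_def inputs_def rs_def role_list_def)
  have w: "word_tape x = (fst (word_tape x), 0)" for x
    by (simp add: word_tape_def)
  have a: "act (word_tape x)
      (let a = fst (word_tape x) 0 in if a < 3 then a + 3 else a, Stay) = (marked x, 0)" for x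
    using word_tape_le[of x 0] by (subst w) (auto simp: marked_def fun_eq_iff)
  have s: "scan ?ts = map (\<lambda>i. fst (word_tape (inputs xs i)) 0) [0..<length rs] @ [0]"
    unfolding ts scan_def by (simp add: word_tape_def)
  have "map2 act ?ts (map (\<lambda>a. (if a < 3 then a + 3 else a, Stay)) (butlast (scan ?ts)) @ [(0, Stay)])
     = map (\<lambda>i. (marked (inputs xs i), 0)) [0..<length rs] @ [word_tape []]"
    unfolding s unfolding ts
    using a by (auto simp: map2_map_same zip_append Let_def comp_def word_tape_def fun_eq_iff)
  also have "\<dots> = conf (length xs) N (inputs xs) (\<lambda>_. 0) []"
    unfolding conf_def
    by (auto simp: rs_def word_of_role_list word_tape_def intro!: nth_equalityI)
  finally show ?thesis
    using exec_Act[of "\<lambda>xs. map (\<lambda>a. (if a < 3 then a + 3 else a, Stay)) (butlast xs) @ [(0, Stay)]" ?ts]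
    unfolding mark_def by simp
qed

text \<open>The length of the first input is measured by moving \<open>Var 0\<close> along with the
  input head up to the first blank; for an empty input this blank is the marked cell 0.\<close>

definition start :: "nat \<Rightarrow> nat \<Rightarrow> prog" where
  "start m N = Seq (While (\<lambda>xs. \<not> at_sym m N (Inp 0) 0 xs)
       (mvs m N ((\<lambda>_. Stay)(Inp 0 := Go_Right, Var 0 := Go_Right)))) (clear m N (Inp 0))"

lemma runs_start:
  assumes "0 < m" "0 < N"
  shows "runs m N inp (start m N) (\<lambda>_. 0) [] (4 * length (inp 0) + 2)
    ((\<lambda>_. 0)(Var 0 := length (inp 0))) []"
proof -
  let ?L = "length (inp 0)"
  let ?H = "\<lambda>j. (\<lambda>_. 0)(Inp 0 := j, Var 0 := j)"
  let ?b = "mvs m N ((\<lambda>_. Stay)(Inp 0 := Go_Right, Var 0 := Go_Right))"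
  have w0: "runs m N inp (While (\<lambda>xs. \<not> at_sym m N (Inp 0) 0 xs) ?b) (?H 0) []
      (?L * Suc 1 + 1) (?H ?L) []"
  proof (rule runs_While[where H = ?H and G = "\<lambda>_. []"])
    show "runs m N inp ?b (?H j) [] 1 (?H (Suc j)) []" for j
      by (rule runs_mvs) (auto split: if_splits)
  qed (use assms in \<open>auto simp: word_tape_def bit_symbol_def\<close>)
  have w1: "?H 0 = (\<lambda>_. 0)" by auto
  have 1: "runs m N inp (While (\<lambda>xs. \<not> at_sym m N (Inp 0) 0 xs) ?b) (\<lambda>_. 0) []
      (2 * ?L + 1) (?H ?L) []"
    by (rule runs_mono[OF w0[unfolded w1]]) simp
  have 2: "runs m N inp (clear m N (Inp 0)) (?H ?L) [] (2 * ?L + 1)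
      ((\<lambda>_. 0)(Var 0 := ?L)) []"
    by (rule runs_eq[OF runs_clear]) (use assms in \<open>auto simp: fun_eq_iff\<close>)
  show ?thesis unfolding start_def by (rule runs_eq[OF runs_Seq[OF 1 2]]) auto
qed

text \<open>Variable 0 is preset to the length of the first input and is the only free variable, so
  the time is a polynomial in this length, which is at most the total length.\<close>

theorem poly_time_gen:
  assumes "wfo m 1 p" "0 < m"
  shows "poly_time m (\<lambda>xs. gen (inputs xs) 1 p ((\<lambda>_. 0)(0 := length (xs ! 0))))"
proof -
  define N where "N = Suc (odep 1 p)"
  let ?rs = "role_list m N"
  let ?P = "Seq mark (Seq (start m N) (evo m N 1 p))"
  let ?M = "machine (Suc (length ?rs)) 6 ?P"
  have "polynomial (\<lambda>n. Suc (4 * n + 2 + otime p n))"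
    using polynomial_otime[of p] by (intro polynomial_intros)
  then obtain q where q: "\<And>n. Suc (4 * n + 2 + otime p n) = poly q n"
    by (auto simp: polynomial_def)
  have wf: "wf_tm ?M"
    by (rule wf_machine) (auto simp: start_def)
  have m: "m \<le> num_tapes ?M" by (simp add: machine_def role_list_def)
  have "computes_within ?M xs (poly q (sum_list (map length xs)))
      (gen (inputs xs) 1 p ((\<lambda>_. 0)(0 := length (xs ! 0))))" if xs: "length xs = m" for xs
  proof -
    let ?L = "length (xs ! 0)"
    let ?h = "(\<lambda>_. 0)(Var 0 := ?L)"
    have i0: "inputs xs 0 = xs ! 0" using xs assms(2) by (simp add: inputs_def)
    have e: "env ?h = (\<lambda>_. 0)(0 := ?L)" by (auto simp: env_def)
    have "runs m N (inputs xs) (start m N) (\<lambda>_. 0) [] (4 * ?L + 2) ?h []"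
      using runs_start[of m N "inputs xs"] assms(2) by (simp add: i0 N_def)
    moreover have "runs m N (inputs xs) (evo m N 1 p) ?h [] (otime p ?L) ?h
        ([] @ gen (inputs xs) 1 p (env ?h))"
      by (rule runs_evo) (use assms(1) in \<open>auto simp: N_def ready_def env_def\<close>)
    ultimately have "runs m N (inputs xs) (Seq (start m N) (evo m N 1 p)) (\<lambda>_. 0) []
        (4 * ?L + 2 + otime p ?L) ?h (gen (inputs xs) 1 p (env ?h))"
      using runs_Seq by fastforce
    then obtain t where t: "t \<le> 4 * ?L + 2 + otime p ?L"
      "exec (Seq (start m N) (evo m N 1 p)) (conf m N (inputs xs) (\<lambda>_. 0) []) t
         (conf m N (inputs xs) ?h (gen (inputs xs) 1 p (env ?h)))"
      by (auto simp: runs_def)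
    have "exec mark (snd (init_config ?M xs)) 1 (conf m N (inputs xs) (\<lambda>_. 0) [])"
      using exec_mark[of ?M xs N] xs by (simp add: machine_def)
    from exec_Seq[OF this t(2)]
    have ex: "exec ?P (snd (init_config ?M xs)) (1 + t)
        (conf m N (inputs xs) ?h (gen (inputs xs) 1 p (env ?h)))" .
    have "xs ! 0 \<in> set xs" using xs assms(2) by auto
    then have "?L \<le> sum_list (map length xs)"
      by (simp add: member_le_sum_list)
    then have "poly q ?L \<le> poly q (sum_list (map length xs))"
      by (rule poly_nat_mono)
    then have "1 + t \<le> poly q (sum_list (map length xs))"
      using t(1) q[of ?L] by linarith
    from machine_run[OF ex this] have
      "(tm_step ?M ^^ poly q (sum_list (map length xs))) (init_config ?M xs) =
        (psize ?P, conf m N (inputs xs) ?h (gen (inputs xs) 1 p (env ?h)))"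
      by (simp add: init_config_def)
    then show ?thesis unfolding computes_within_def e
      by (simp add: machine_def conf_def tape_holds_def) (simp add: word_tape_def)
  qed
  then show ?thesis unfolding poly_time_def using wf m by blast
qed

section \<open>Definable functions and predicates\<close>

definition deft :: "nat \<Rightarrow> ((nat \<Rightarrow> nat) \<Rightarrow> nat) \<Rightarrow> bool" where
  "deft n f \<longleftrightarrow> (\<exists>t. wft n t \<and> (\<forall>e. tval t e = f e))"

text \<open>Stated for predicates instead of formulas, so that a formula need not be written out:
  closure rules follow the shape of the predicate.\<close>

definition deff :: "nat \<Rightarrow> nat \<Rightarrow> ((nat \<Rightarrow> bool list) \<Rightarrow> (nat \<Rightarrow> nat) \<Rightarrow> bool) \<Rightarrow> bool" where
  "deff m n P \<longleftrightarrow> (\<exists>\<phi>. wff m n \<phi> \<and> (\<forall>inp e. sat inp n \<phi> e \<longleftrightarrow> P inp e))"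

lemma deftI: "wft n t \<Longrightarrow> (\<And>e. tval t e = f e) \<Longrightarrow> deft n f"
  by (auto simp: deft_def)

lemma deffI: "wff m n \<phi> \<Longrightarrow> (\<And>inp e. sat inp n \<phi> e \<longleftrightarrow> P inp e) \<Longrightarrow> deff m n P"
  by (auto simp: deff_def)

lemma deft_const: "deft n (\<lambda>e. c)"
  by (rule deftI[of _ "Cst c"]) auto

lemma deft_var: "v < n \<Longrightarrow> deft n (\<lambda>e. e v)"
  by (rule deftI[of _ "V v"]) auto

lemma deft_add: "deft n f \<Longrightarrow> deft n g \<Longrightarrow> deft n (\<lambda>e. f e + g e)"
proof -
  assume "deft n f" "deft n g"
  then obtain s t where "wft n s" "wft n t" "\<forall>e. tval s e = f e" "\<forall>e. tval t e = g e" by (auto simp: deft_def)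
  then show ?thesis by (intro deftI[of _ "Add s t"]) auto
qed

lemma deft_mult: "deft n f \<Longrightarrow> deft n g \<Longrightarrow> deft n (\<lambda>e. f e * g e)"
proof -
  assume "deft n f" "deft n g"
  then obtain s t where "wft n s" "wft n t" "\<forall>e. tval s e = f e" "\<forall>e. tval t e = g e" by (auto simp: deft_def)
  then show ?thesis by (intro deftI[of _ "Mul s t"]) auto
qed

lemma deft_Suc: "deft n f \<Longrightarrow> deft n (\<lambda>e. Suc (f e))"
  using deft_add[OF deft_const[of n 1]] by simp

lemma deft_poly: "deft n f \<Longrightarrow> deft n (\<lambda>e. poly p (f e))"
proof (induction p)
  case 0
  then show ?case using deft_const[of n 0] by simp
next
  case (pCons a p)
  then show ?case by (simp add: deft_add deft_const deft_mult)
qed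

lemma deff_const: "deff m n (\<lambda>inp e. b)"
  by (rule deffI[of _ _ "if b then Less (Cst 0) (Cst 1) else Less (Cst 0) (Cst 0)"]) auto

lemma deff_less: "deft n f \<Longrightarrow> deft n g \<Longrightarrow> deff m n (\<lambda>inp e. f e < g e)"
proof -
  assume "deft n f" "deft n g"
  then obtain s t where "wft n s" "wft n t" "\<forall>e. tval s e = f e" "\<forall>e. tval t e = g e" by (auto simp: deft_def)
  then show ?thesis by (intro deffI[of _ _ "Less s t"]) auto
qed

lemma deff_sym:
  assumes "i < m" "deft n f"
  shows "deff m n (\<lambda>inp e. fst (word_tape (inp i)) (int (f e)) = a)"
proof (cases "a \<le> 2")
  case True
  obtain t where "wft n t" "\<forall>e. tval t e = f e" using assms by (auto simp: deft_def)
  then show ?thesis using assms True by (intro deffI[of _ _ "Sym i a t"]) auto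
next
  case False
  have "fst (word_tape w) p \<le> 2" for w p by (simp add: word_tape_def bit_symbol_def)
  then have "fst (word_tape w) p \<noteq> a" for w p using False by metis
  then show ?thesis using deff_const[of m n False] by simp
qed

lemma deff_neg: "deff m n P \<Longrightarrow> deff m n (\<lambda>inp e. \<not> P inp e)"
proof -
  assume "deff m n P"
  then obtain \<phi> where "wff m n \<phi>" "\<forall>inp e. sat inp n \<phi> e = P inp e" by (auto simp: deff_def)
  then show ?thesis by (intro deffI[of _ _ "Neg \<phi>"]) auto
qed

lemma deff_conj: "deff m n P \<Longrightarrow> deff m n Q \<Longrightarrow> deff m n (\<lambda>inp e. P inp e \<and> Q inp e)"
proof -
  assume "deff m n P" "deff m n Q"
  then obtain \<phi> \<psi> where "wff m n \<phi>" "\<forall>inp e. sat inp n \<phi> e = P inp e" "wff m n \<psi>"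
    "\<forall>inp e. sat inp n \<psi> e = Q inp e" by (auto simp: deff_def)
  then show ?thesis by (intro deffI[of _ _ "Conj \<phi> \<psi>"]) auto
qed

lemma deff_disj: "deff m n P \<Longrightarrow> deff m n Q \<Longrightarrow> deff m n (\<lambda>inp e. P inp e \<or> Q inp e)"
  using deff_neg[OF deff_conj[OF deff_neg deff_neg], of m n P Q] by simp

lemma deff_imp: "deff m n P \<Longrightarrow> deff m n Q \<Longrightarrow> deff m n (\<lambda>inp e. P inp e \<longrightarrow> Q inp e)"
  using deff_disj[OF deff_neg, of m n P Q] by (simp only: imp_conv_disj)

lemma deff_iff: "deff m n P \<Longrightarrow> deff m n Q \<Longrightarrow> deff m n (\<lambda>inp e. P inp e = Q inp e)"
  using deff_conj[OF deff_imp deff_imp, of m n P Q Q P] by (simp only: iff_conv_conj_imp)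

lemma deff_eq: "deft n f \<Longrightarrow> deft n g \<Longrightarrow> deff m n (\<lambda>inp e. f e = g e)"
  using deff_conj[OF deff_neg[OF deff_less[of n f g m]] deff_neg[OF deff_less[of n g f m]]]
  by (simp add: not_less antisym_conv[symmetric] eq_iff conj_commute)

lemma deff_le: "deft n f \<Longrightarrow> deft n g \<Longrightarrow> deff m n (\<lambda>inp e. f e \<le> g e)"
  using deff_neg[OF deff_less[of n g f m]] by (simp add: not_less)

text \<open>Here \<open>d\<close> is a constant of the formula and not one of its variables, so
  \<open>P d\<close> may depend on it in any way. Finite tables of tiles and colours enter through
  this rule.\<close>

lemma deff_ex_const:
  "(\<And>d. d < N \<Longrightarrow> deff m n (\<lambda>inp e. P d inp e)) \<Longrightarrow> deff m n (\<lambda>inp e. \<exists>d<(N :: nat). P d inp e)"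
proof (induction N)
  case 0
  then show ?case using deff_const[of m n False] by simp
next
  case (Suc N)
  have "deff m n (\<lambda>inp e. P N inp e \<or> (\<exists>d<N. P d inp e))"
    using Suc by (intro deff_disj) auto
  then show ?case by (simp only: Ex_less_Suc)
qed

lemma deff_all_const:
  assumes "\<And>d. d < (N :: nat) \<Longrightarrow> deff m n (\<lambda>inp e. P d inp e)"
  shows "deff m n (\<lambda>inp e. \<forall>d<N. P d inp e)"
proof -
  have "deff m n (\<lambda>inp e. \<not> (\<exists>d<N. \<not> P d inp e))"
    using assms by (intro deff_neg deff_ex_const) auto
  then show ?thesis by simp
qed

text \<open>The bound value is stored in slot \<open>n\<close>. The third hypothesis says that
  \<open>P\<close> does not consult this slot by itself, so storing there changes nothing
  else.\<close>

lemma deff_ex: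
  assumes "deft n f" "deff m (Suc n) (\<lambda>inp e. P inp e (e n))"
    "\<And>inp e x y. P inp (e(n := x)) y = P inp e y"
  shows "deff m n (\<lambda>inp e. \<exists>x<f e. P inp e x)"
proof -
  obtain t \<phi> where *: "wft n t" "\<forall>e. tval t e = f e" "wff m (Suc n) \<phi>"
    "\<forall>inp e. sat inp (Suc n) \<phi> e = P inp e (e n)" using assms by (auto simp: deft_def deff_def)
  show ?thesis
    by (rule deffI[of _ _ "Ex t \<phi>"]) (use * assms(3) in auto)
qed

lemma deff_all:
  assumes "deft n f" "deff m (Suc n) (\<lambda>inp e. P inp e (e n))"
    "\<And>inp e x y. P inp (e(n := x)) y = P inp e y"
  shows "deff m n (\<lambda>inp e. \<forall>x<f e. P inp e x)"
proof -
  have "deff m n (\<lambda>inp e. \<not> (\<exists>x<f e. \<not> P inp e x))"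
    using assms by (intro deff_neg deff_ex) auto
  then show ?thesis by simp
qed

lemma deff_bex:
  "(\<And>d. d \<in> set ds \<Longrightarrow> deff m n (\<lambda>inp e. P d inp e)) \<Longrightarrow> deff m n (\<lambda>inp e. \<exists>d\<in>set ds. P d inp e)"
proof (induction ds)
  case Nil
  then show ?case using deff_const[of m n False] by simp
next
  case (Cons d ds)
  have "deff m n (\<lambda>inp e. P d inp e \<or> (\<exists>d\<in>set ds. P d inp e))"
    using Cons by (intro deff_disj) auto
  then show ?case by simp
qed

lemmas definable_intros =
  deft_const deft_var deft_add deft_mult deft_Suc deft_poly deff_const deff_ex_const deff_all_const
  deff_neg deff_conj deff_disj deff_imp deff_sym deff_eq deff_iff deff_less deff_le deff_ex deff_all

lemma wft_mono: "wft n t \<Longrightarrow> n \<le> n' \<Longrightarrow> wft n' t"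
  by (induction t) auto

lemma poly_time_cong:
  assumes "poly_time m f" "\<And>xs. length xs = m \<Longrightarrow> f xs = g xs"
  shows "poly_time m g"
  using assms unfolding poly_time_def by metis

lemma concat_rows:
  "concat (map (\<lambda>i. map (g i) [0..<n]) [0..<m]) = map (\<lambda>k. g (k div n) (k mod n)) [0..<m * n]"
proof (induction m)
  case (Suc m)
  have "map (\<lambda>k. g (k div n) (k mod n)) [m * n..<m * n + n] = map (g m) [0..<n]"
    by (rule nth_equalityI) auto
  moreover have "[0..<Suc m * n] = [0..<m * n] @ [m * n..<m * n + n]"
    by (subst upt_add_eq_append[symmetric]) (auto simp: add.commute)
  ultimately show ?case using Suc by simp
qed simp

lemma deft_mono: "deft n f \<Longrightarrow> n \<le> n' \<Longrightarrow> deft n' f"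
  unfolding deft_def using wft_mono by blast

section \<open>The reduction\<close>

lemma numbering:
  assumes "finite A"
  obtains f :: "'a \<Rightarrow> nat" and g n where "\<And>a. a \<in> A \<Longrightarrow> f a < n \<and> g (f a) = a" "\<And>k. k < n \<Longrightarrow> g k \<in> A"
proof -
  obtain f :: "'a \<Rightarrow> nat" and n where f: "f ` A = {i. i < n}" "inj_on f A"
    using finite_imp_inj_to_nat_seg[OF assms] by auto
  show ?thesis
  proof (rule that[of f n "inv_into A f"])
    show "f a < n \<and> inv_into A f (f a) = a" if "a \<in> A" for a using f that by auto
    show "inv_into A f k \<in> A" if "k < n" for k using f that by (metis inv_into_into mem_Collect_eq)
  qed
qed

text \<open>All tables are obtained before \<open>x\<close>, \<open>U\<close> and \<open>T\<close>
  are given, hence they are constants of the reduction. A positive \<open>nd\<close> ensures later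
  that the matrix has a row.\<close>

lemma (in verifier) tile_numbers:
  obtains nd nh nv tile hE hW vN vS where "tiling nd nh nv hE vN" "0 < nd"
    "\<And>x U T. (\<exists>\<tau>. tiling.tiles (T + 1) (2 * T + U + 3) nd (\<lambda>t i d. allowed x U T t i (tile d)) hE hW vN vS \<tau>)
       \<longleftrightarrow> (\<exists>\<tau>. tile_run x U T \<tau>)"
proof -
  obtain f tile and nd :: nat where f: "\<And>d. d \<in> tile_set \<Longrightarrow> f d < nd \<and> tile (f d) = d"
    "\<And>k. k < nd \<Longrightarrow> tile k \<in> tile_set" using numbering[OF finite_tile_set] by metis
  have fin: "finite (east ` tile_set \<union> west ` tile_set)" "finite (north ` tile_set \<union> south ` tile_set)"
    using finite_tile_set by auto
  obtain h h' and nh :: nat where h: "\<And>a. a \<in> east ` tile_set \<union> west ` tile_set \<Longrightarrow> h a < nh \<and> h' (h a) = a"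
    using numbering[OF fin(1)] by metis
  obtain v v' and nv :: nat where v: "\<And>a. a \<in> north ` tile_set \<union> south ` tile_set \<Longrightarrow> v a < nv \<and> v' (v a) = a"
    using numbering[OF fin(2)] by metis
  let ?hE = "\<lambda>d. h (east (tile d))" and ?hW = "\<lambda>d. h (west (tile d))"
  let ?vN = "\<lambda>d. v (north (tile d))" and ?vS = "\<lambda>d. v (south (tile d))"
  have tl: "tiling nd nh nv ?hE ?vN"
    by unfold_locales (use f(2) h v in auto)
  have heq: "h (east d) = h (west d') \<longleftrightarrow> east d = west d'" if "d \<in> tile_set" "d' \<in> tile_set" for d d'
    using h[of "east d"] h[of "west d'"] that by (metis UnI1 UnI2 imageI)
  have veq: "v (north d) = v (south d') \<longleftrightarrow> north d = south d'" if "d \<in> tile_set" "d' \<in> tile_set" for d d'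
    using v[of "north d"] v[of "south d'"] that by (metis UnI1 UnI2 imageI)
  have "3 \<le> S" using wf by (simp add: wf_tm_def)
  then have "((0, replicate K 0), replicate K (0, False), replicate K (0, False), replicate K (0, False)) \<in> tile_set"
    by (auto simp: tile_set_def)
  from f(1)[OF this] have "0 < nd" by auto
  moreover have "(\<exists>\<tau>. tiling.tiles (T + 1) (2 * T + U + 3) nd (\<lambda>t i d. allowed x U T t i (tile d)) ?hE ?hW ?vN ?vS \<tau>)
       \<longleftrightarrow> (\<exists>\<tau>. tile_run x U T \<tau>)" (is "?lhs \<longleftrightarrow> _") for x U T
  proof
    assume ?lhs
    then obtain \<tau> where t: "\<forall>t<T + 1. \<forall>i<2 * T + U + 3. \<tau> t i < nd \<and> allowed x U T t i (tile (\<tau> t i)) \<and>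
        (Suc i < 2 * T + U + 3 \<longrightarrow> ?hE (\<tau> t i) = ?hW (\<tau> t (Suc i))) \<and>
        (Suc t < T + 1 \<longrightarrow> ?vN (\<tau> t i) = ?vS (\<tau> (Suc t) i))"
      unfolding tiling.tiles_def[OF tl] by blast
    have "tile_run x U T (\<lambda>t i. tile (\<tau> t i))"
      unfolding tile_run_def
    proof (intro allI impI)
      fix t i assume a: "t < T + 1" "i < 2 * T + U + 3"
      have d: "tile (\<tau> t i) \<in> tile_set" if "t < T + 1" "i < 2 * T + U + 3" for t i
        using t that f(2) by blast
      show "tile (\<tau> t i) \<in> tile_set \<and> allowed x U T t i (tile (\<tau> t i)) \<and>
          (Suc i < 2 * T + U + 3 \<longrightarrow> east (tile (\<tau> t i)) = west (tile (\<tau> t (Suc i)))) \<and>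
          (Suc t < T + 1 \<longrightarrow> north (tile (\<tau> t i)) = south (tile (\<tau> (Suc t) i)))"
        using t[rule_format, OF a] d[OF a] d[of t "Suc i"] d[of "Suc t" i] a heq veq by simp
    qed
    then show "\<exists>\<tau>. tile_run x U T \<tau>" by blast
  next
    assume "\<exists>\<tau>. tile_run x U T \<tau>"
    then obtain \<tau> where t: "\<forall>t<T + 1. \<forall>i<2 * T + U + 3. \<tau> t i \<in> tile_set \<and> allowed x U T t i (\<tau> t i) \<and>
        (Suc i < 2 * T + U + 3 \<longrightarrow> east (\<tau> t i) = west (\<tau> t (Suc i))) \<and>
        (Suc t < T + 1 \<longrightarrow> north (\<tau> t i) = south (\<tau> (Suc t) i))"
      unfolding tile_run_def by blast
    have "tiling.tiles (T + 1) (2 * T + U + 3) nd (\<lambda>t i d. allowed x U T t i (tile d)) ?hE ?hW ?vN ?vS (\<lambda>t i. f (\<tau> t i))"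
      unfolding tiling.tiles_def[OF tl]
    proof (intro allI impI)
      fix t i assume a: "t < T + 1" "i < 2 * T + U + 3"
      have d: "f (\<tau> t i) < nd" "tile (f (\<tau> t i)) = \<tau> t i" if "t < T + 1" "i < 2 * T + U + 3" for t i
        using t that f(1) by blast+
      show "f (\<tau> t i) < nd \<and> allowed x U T t i (tile (f (\<tau> t i))) \<and>
          (Suc i < 2 * T + U + 3 \<longrightarrow> h (east (tile (f (\<tau> t i)))) = h (west (tile (f (\<tau> t (Suc i)))))) \<and>
          (Suc t < T + 1 \<longrightarrow> v (north (tile (f (\<tau> t i)))) = v (south (tile (f (\<tau> (Suc t) i)))))"
        using t[rule_format, OF a] d[OF a] d[of t "Suc i"] d[of "Suc t" i] a by simp
    qed
    then show ?lhs by blast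
  qed
  ultimately show ?thesis using that[OF tl] by blast
qed

section \<open>The adjacency matrix as a formula\<close>

definition link :: "nat \<Rightarrow> kind \<Rightarrow> nat \<Rightarrow> nat \<Rightarrow> nat \<Rightarrow> nat \<Rightarrow> bool" where
  "link C k r c u v \<longleftrightarrow> (\<exists>d\<in>set (cell_edges k).
     u = grid.pos C r c (fst d) \<and> v = grid.pos C r c (snd d) \<or>
     v = grid.pos C r c (fst d) \<and> u = grid.pos C r c (snd d))"

lemma link_Void: "\<not> link C Void r c u v"
  by (simp add: link_def)

text \<open>Splitting by kind makes the edge list a constant in each case. The matrix entry always
  occurs together with \<open>0 < r\<close>, which allows the index \<open>r - 1\<close> to be
  removed.\<close>

lemma edge_iff:
  "{u, v} \<in> grid.edges R C M \<longleftrightarrow> (\<exists>r<R + 2. \<exists>c<C + 1.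
     c < C \<and> r = 0 \<and> link C Top r c u v \<or>
     c < C \<and> r \<le> R \<and> (0 < r \<and> M (r - 1) c) \<and> link C Join r c u v \<or>
     c < C \<and> r \<le> R \<and> 0 < r \<and> \<not> (0 < r \<and> M (r - 1) c) \<and> link C Cross r c u v \<or>
     c < C \<and> r = Suc R \<and> link C Bottom r c u v \<or>
     c = C \<and> r \<le> R \<and> 0 < r \<and> link C End r c u v)" (is "_ \<longleftrightarrow> ?rhs")
proof -
  have l: "link C k r c u v \<longleftrightarrow> (\<exists>p q. (p, q) \<in> set (cell_edges k) \<and> {u, v} = {grid.pos C r c p, grid.pos C r c q})"
    for k r c by (simp only: link_def doubleton_eq_iff Bex_def split_paired_Ex fst_conv snd_conv) blast
  have "{u, v} \<in> grid.edges R C M \<longleftrightarrow> (\<exists>r<R + 2. \<exists>c<C + 1. link C (grid.kd R C M r c) r c u v)"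
    unfolding grid.edges_def l mem_Collect_eq by blast
  also have "\<dots> \<longleftrightarrow> ?rhs"
  proof (intro ex_cong conj_cong refl)
    fix r c assume "r < R + 2" "c < C + 1"
    then show "link C (grid.kd R C M r c) r c u v \<longleftrightarrow>
     c < C \<and> r = 0 \<and> link C Top r c u v \<or>
     c < C \<and> r \<le> R \<and> (0 < r \<and> M (r - 1) c) \<and> link C Join r c u v \<or>
     c < C \<and> r \<le> R \<and> 0 < r \<and> \<not> (0 < r \<and> M (r - 1) c) \<and> link C Cross r c u v \<or>
     c < C \<and> r = Suc R \<and> link C Bottom r c u v \<or>
     c = C \<and> r \<le> R \<and> 0 < r \<and> link C End r c u v"
      by (cases "c < C"; cases "r = 0"; cases "r \<le> R"; cases "M (r - 1) c")
        (auto simp: grid.kd_def link_Void)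
  qed
  finally show ?thesis .
qed

lemma deff_link:
  assumes "deft n C" "deft n r" "deft n c" "deft n u" "deft n v"
  shows "deff m n (\<lambda>inp e. link (C e) k (r e) (c e) (u e) (v e))"
  unfolding link_def grid.pos_def grid.width_def
  by (rule deff_bex assms definable_intros)+

text \<open>Variable 0 is the input length, 1 and 2 are the vertices, 3 and 4 the row and column of
  the cell. Indices are iterated successors, the form in which the rules for quantifiers produce
  them.\<close>

lemma deff_edges:
  assumes "deft 1 (\<lambda>e. R (e 0))" "deft 1 (\<lambda>e. C (e 0))"
    "deff m (Suc (Suc (Suc (Suc (Suc 0)))))
       (\<lambda>inp e. 0 < e (Suc (Suc (Suc 0))) \<and> M inp (e 0) (e (Suc (Suc (Suc 0))) - 1) (e (Suc (Suc (Suc (Suc 0))))))"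
  shows "deff m (Suc (Suc (Suc 0)))
    (\<lambda>inp e. {e (Suc 0), e (Suc (Suc 0))} \<in> grid.edges (R (e 0)) (C (e 0)) (M inp (e 0)))"
proof -
  have R: "deft (Suc n) (\<lambda>e. R (e 0))" "deft (Suc n) (\<lambda>e. C (e 0))" for n
    using assms(1,2) by (auto intro: deft_mono)
  show ?thesis unfolding edge_iff
    by (rule assms(3) R deff_link definable_intros | simp; fail)+
qed

text \<open>Terms have no subtraction, so \<open>r - 1 = a\<close> for positive \<open>r\<close> is
  replaced by \<open>r = Suc a\<close>.\<close>

lemma tiling_mat_pred:
  assumes "tiling nd nh nv hE vN"
  shows "0 < r \<and> tiling.mat T W nd nh nv al hE hW vN vS (r - 1) c \<longleftrightarrow>
    (\<exists>t<T. \<exists>i<W. \<exists>t'<T. \<exists>i'<W. \<exists>d<nd. \<exists>k<Suc (nh + nv). r = Suc ((t * W + i) * nd + d) \<and>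
       c = (t' * W + i') * Suc (nh + nv) + k \<and> al t i d \<and>
       (t = t' \<and> i = i' \<and> (k = 0 \<or> 0 < k \<and> k \<le> nh \<and> (Suc i' = W \<or> k = Suc (hE d)) \<or>
          nh < k \<and> (Suc t' = T \<or> k = Suc (nh + vN d))) \<or>
        t = t' \<and> i = Suc i' \<and> 0 < k \<and> k \<le> nh \<and> k \<noteq> Suc (hW d) \<or>
        t = Suc t' \<and> i = i' \<and> nh < k \<and> k \<noteq> Suc (nh + vS d)))"
proof -
  have p: "0 < r \<and> r - 1 = a \<longleftrightarrow> r = Suc a" for a by auto
  have *: "0 < r \<and> (\<exists>t<T. \<exists>i<W. \<exists>d<nd. \<exists>t'<T. \<exists>i'<W. \<exists>k<Suc (nh + nv). r - 1 = A t i d \<and> B t i d t' i' k) \<longleftrightarrow>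
    (\<exists>t<T. \<exists>i<W. \<exists>t'<T. \<exists>i'<W. \<exists>d<nd. \<exists>k<Suc (nh + nv). r = Suc (A t i d) \<and> B t i d t' i' k)"
    for A and B :: "nat \<Rightarrow> nat \<Rightarrow> nat \<Rightarrow> nat \<Rightarrow> nat \<Rightarrow> nat \<Rightarrow> bool"
    unfolding p[symmetric] by blast
  show ?thesis
    unfolding tiling.mat_def[OF assms] tiling.row_def[OF assms] tiling.column_def[OF assms]
      tiling.inc_def[OF assms] tiling.own_def[OF assms] tiling.right_def[OF assms] tiling.up_def[OF assms]
      tiling.nk_def[OF assms] by (rule *)
qed

lemma (in verifier) deff_mat:
  assumes "tiling nd nh nv hE vN" "\<And>n. deft (Suc n) (\<lambda>e. T (e 0))" "\<And>n. deft (Suc n) (\<lambda>e. U (e 0))"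
  shows "deff 1 (Suc (Suc (Suc (Suc (Suc 0))))) (\<lambda>inp e. 0 < e (Suc (Suc (Suc 0))) \<and>
     tiling.mat (T (e 0) + 1) (2 * T (e 0) + U (e 0) + 3) nd nh nv
       (\<lambda>t i d. allowed (inp 0) (U (e 0)) (T (e 0)) t i (tile d)) hE hW vN vS
     (e (Suc (Suc (Suc 0))) - 1) (e (Suc (Suc (Suc (Suc 0))))))"
  unfolding tiling_mat_pred[OF assms(1)] allowed_def
  by (rule assms(2,3) definable_intros | simp only: fun_upd_apply nat.inject nat.distinct if_False; fail | simp; fail)+

lemma poly_time_matrix:
  assumes "deft 1 (\<lambda>e. g (e 0))"
    "deff 1 (Suc (Suc (Suc 0))) (\<lambda>inp e. P (inp 0) (e 0) (e (Suc 0)) (e (Suc (Suc 0))))"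
  shows "poly_time_function (\<lambda>x. map (\<lambda>k. P x (length x) (k div g (length x)) (k mod g (length x)))
           [0..<g (length x) * g (length x)])"
proof -
  obtain t where t: "wft 1 t" "\<And>e. tval t e = g (e 0)" using assms(1) by (auto simp: deft_def)
  obtain \<phi> where \<phi>: "wff 1 (Suc (Suc (Suc 0))) \<phi>" "\<And>inp e. sat inp (Suc (Suc (Suc 0))) \<phi> e \<longleftrightarrow>
      P (inp 0) (e 0) (e (Suc 0)) (e (Suc (Suc 0)))" using assms(2) by (auto simp: deff_def)
  let ?p = "For t (For t (Emit \<phi>))"
  have wf: "wfo 1 1 ?p" using t(1) wft_mono[OF t(1), of "Suc 1"] \<phi>(1) by simp
  have gen: "gen inp 1 ?p e = map (\<lambda>k. P (inp 0) (e 0) (k div g (e 0)) (k mod g (e 0))) [0..<g (e 0) * g (e 0)]"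
    for inp e
    unfolding concat_rows[of "\<lambda>i j. P (inp 0) (e 0) i j", symmetric] by (simp add: t(2) \<phi>(2))
  show ?thesis unfolding poly_time_function_def
  proof (rule poly_time_cong[OF poly_time_gen[OF wf]])
    fix xs :: "bool list list" assume "length xs = 1"
    then show "gen (inputs xs) 1 ?p ((\<lambda>_. 0)(0 := length (xs ! 0))) =
      map (\<lambda>k. P (xs ! 0) (length (xs ! 0)) (k div g (length (xs ! 0))) (k mod g (length (xs ! 0))))
        [0..<g (length (xs ! 0)) * g (length (xs ! 0))]"
      unfolding gen by (simp add: inputs_def)
  qed simp
qed

lemma poly_time_predicate:
  assumes "deff 2 1 (\<lambda>inp e. P (inp 0) (inp 1) (e 0))"
  shows "poly_time_relation (\<lambda>x u. P x u (length x))"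
proof -
  obtain \<phi> where \<phi>: "wff 2 1 \<phi>" "\<And>inp e. sat inp 1 \<phi> e \<longleftrightarrow> P (inp 0) (inp 1) (e 0)"
    using assms by (auto simp: deff_def)
  have wf: "wfo 2 1 (Emit \<phi>)" using \<phi>(1) by simp
  show ?thesis unfolding poly_time_relation_def
  proof (rule poly_time_cong[OF poly_time_gen[OF wf]])
    fix xs :: "bool list list" assume "length xs = 2"
    then show "gen (inputs xs) 1 (Emit \<phi>) ((\<lambda>_. 0)(0 := length (xs ! 0))) =
        [P (xs ! 0) (xs ! 1) (length (xs ! 0))]"
      by (simp only: gen.simps \<phi>(2)) (simp add: inputs_def)
  qed simp
qed

theorem NP_hard_unweighted: "NP_hard yes_instances no_instances"
  unfolding NP_hard_def
proof (intro allI impI)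
  fix L assume "in_NP L (- L)"
  then obtain V q where V: "poly_time_relation V" "\<forall>x\<in>L. \<exists>u. length u \<le> poly q (length x) \<and> V x u"
    "\<forall>x\<in>- L. \<not> (\<exists>u. length u \<le> poly q (length x) \<and> V x u)" unfolding in_NP_def by blast
  obtain M p where M: "wf_tm M" "2 \<le> num_tapes M"
    "\<forall>xs. length xs = 2 \<longrightarrow> computes_within M xs (poly p (sum_list (map length xs))) [V (xs ! 0) (xs ! 1)]"
    using V(1) unfolding poly_time_relation_def poly_time_def by blast
  interpret verifier M using M(1,2) by unfold_locales
  obtain nd nh nv tile hE hW vN vS where tl: "tiling nd nh nv hE vN" and nd: "0 < nd" and
    tiles: "\<And>x U T. (\<exists>\<tau>. tiling.tiles (T + 1) (2 * T + U + 3) nd (\<lambda>t i d. allowed x U T t i (tile d)) hE hW vN vS \<tau>)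
       \<longleftrightarrow> (\<exists>\<tau>. tile_run x U T \<tau>)" by (rule tile_numbers) blast
  \<comment> \<open>Input and certificate together have at most \<open>n + poly q n\<close> bits, so
    by monotonicity \<open>T n\<close> steps suffice for every certificate.\<close>
  define T where "T n = poly p (n + poly q n)" for n
  define U where "U n = poly q n" for n
  define A where "A x n = tiling.mat (T n + 1) (2 * T n + U n + 3) nd nh nv
    (\<lambda>t i d. allowed x (U n) (T n) t i (tile d)) hE hW vN vS" for x n
  define R where "R n = (T n + 1) * (2 * T n + U n + 3) * nd" for n
  define C where "C n = (T n + 1) * (2 * T n + U n + 3) * Suc (nh + nv)" for n
  define g where "g n = 9 * (R n + 2) * (9 * (C n + 1))" for n
  define f where "f x = map (\<lambda>k. {k div g (length x), k mod g (length x)} \<in>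
      grid.edges (R (length x)) (C (length x)) (A x (length x))) [0..<g (length x) * g (length x)]" for x
  have dT: "deft (Suc n) (\<lambda>e. T (e 0))" "deft (Suc n) (\<lambda>e. U (e 0))" for n
    unfolding T_def U_def by (rule definable_intros | simp; fail)+
  have d: "deft 1 (\<lambda>e. T (e 0))" "deft 1 (\<lambda>e. U (e 0))" using dT[of 0] by simp_all
  have dR: "deft 1 (\<lambda>e. R (e 0))" "deft 1 (\<lambda>e. C (e 0))"
    unfolding R_def C_def by (rule d deft_const deft_add deft_mult)+
  have "poly_time_function f"
    unfolding f_def
  proof (rule poly_time_matrix[where P = "\<lambda>x n u v. {u, v} \<in> grid.edges (R n) (C n) (A x n)"])
    show "deft 1 (\<lambda>e. g (e 0))" unfolding g_def by (rule dR deft_const deft_add deft_mult)+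
    show "deff 1 (Suc (Suc (Suc 0))) (\<lambda>inp e. {e (Suc 0), e (Suc (Suc 0))} \<in>
        grid.edges (R (e 0)) (C (e 0)) (A (inp 0) (e 0)))"
      by (rule deff_edges[OF dR, where M = "\<lambda>inp. A (inp 0)"])
        (unfold A_def, rule deff_mat[OF tl dT])
  qed
  moreover have "f x \<in> (if x \<in> L then yes_instances else no_instances)" for x
  proof -
    let ?n = "length x"
    let ?E = "grid.edges (R ?n) (C ?n) (A x ?n)"
    have "has_cover (R ?n) (C ?n) (A x ?n) \<longleftrightarrow> (\<exists>\<tau>. tile_run x (U ?n) (T ?n) \<tau>)"
      using tiling.cover_iff_tiling[OF tl, of "T ?n + 1" "2 * T ?n + U ?n + 3"
        "\<lambda>t i d. allowed x (U ?n) (T ?n) t i (tile d)" hW vS] tiles[of "T ?n" "U ?n" x]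
      by (simp only: A_def R_def C_def tiling.nk_def[OF tl])
    also have "\<dots> \<longleftrightarrow> (\<exists>u. length u \<le> U ?n \<and> fst (last (snd (run x u (T ?n)))) 0 = 2)"
      by (rule tile_run_iff)
    also have "\<dots> \<longleftrightarrow> (\<exists>u. length u \<le> U ?n \<and> V x u)"
    proof (intro ex_cong1 conj_cong refl)
      fix u :: "bool list" assume "length u \<le> U ?n"
      then have "poly p (?n + length u) \<le> T ?n"
        unfolding T_def U_def by (intro poly_nat_mono) simp
      moreover have "computes_within M [x, u] (poly p (?n + length u)) [V x u]"
        using M(3)[rule_format, of "[x, u]"] by simp
      ultimately show "fst (last (snd (run x u (T ?n)))) 0 = 2 \<longleftrightarrow> V x u"
        by (intro accepts_iff)
    qed
    also have "\<dots> \<longleftrightarrow> x \<in> L" using V(2,3) unfolding U_def by blast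
    finally have cov: "has_cover (R ?n) (C ?n) (A x ?n) \<longleftrightarrow> x \<in> L" .
    have R: "0 < R ?n" using nd by (simp add: R_def)
    have g: "g ?n = grid.height (R ?n) * grid.width (C ?n)"
      by (simp only: g_def grid.height_def grid.width_def)
    have f: "f x = encode_graph (g ?n) ?E" by (simp only: f_def encode_graph_def)
    have adm: "admissible {..<g ?n} ?E" unfolding g by (rule grid.admissible[OF R])
    have iff: "has_unweighted_optimum {..<g ?n} ?E \<longleftrightarrow> x \<in> L"
      unfolding g cov[symmetric] by (rule grid.unweighted_iff_cover[OF R])
    show ?thesis
    proof (cases "x \<in> L")
      case True
      have "f x \<in> yes_instances" unfolding yes_instances_def f using adm iff True by blast
      then show ?thesis using True by (simp only: if_True)
    next
      case False
      have "f x \<in> no_instances" unfolding no_instances_def f using adm iff False by blast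
      then show ?thesis using False by (simp only: if_False)
    qed
  qed
  then have "\<forall>x\<in>L. f x \<in> yes_instances" "\<forall>x\<in>- L. f x \<in> no_instances"
    by (metis, metis ComplD)
  ultimately show "\<exists>f. poly_time_function f \<and> (\<forall>x\<in>L. f x \<in> yes_instances) \<and> (\<forall>x\<in>- L. f x \<in> no_instances)"
    by blast
qed

section \<open>Membership in NP\<close>

lemma word_tape_nth: "k < length w \<Longrightarrow> fst (word_tape w) (int k) = 2 \<longleftrightarrow> w ! k"
  by (simp add: word_tape_def bit_symbol_def)

lemma encode_nth:
  assumes "i < n" "j < n"
  shows "map (\<lambda>k. P (k div n) (k mod n)) [0..<n * n] ! (i * n + j) = P i j"
    "fst (word_tape (map (\<lambda>k. P (k div n) (k mod n)) [0..<n * n])) (int (i * n + j)) = 2 \<longleftrightarrow> P i j"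
proof -
  have "i * n + j < Suc i * n" using assms by simp
  also have "\<dots> \<le> n * n" using assms by (intro mult_right_mono) auto
  finally have l: "i * n + j < n * n" .
  have d: "(i * n + j) div n = i" "(i * n + j) mod n = j" using assms by auto
  show 1: "map (\<lambda>k. P (k div n) (k mod n)) [0..<n * n] ! (i * n + j) = P i j"
    using l d by simp
  show "fst (word_tape (map (\<lambda>k. P (k div n) (k mod n)) [0..<n * n])) (int (i * n + j)) = 2 \<longleftrightarrow> P i j"
    by (subst word_tape_nth) (use l 1 in simp_all)
qed

lemma square_eq: "n * n = m * m \<Longrightarrow> n = (m :: nat)"
  by (metis power2_eq_square power2_eq_imp_eq zero_le)

lemma encode_graph_inj:
  assumes "simple_graph {..<n} E" "simple_graph {..<m} F" "encode_graph n E = encode_graph m F"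
  shows "n = m \<and> E = F"
proof -
  have "length (encode_graph n E) = length (encode_graph m F)" using assms(3) by simp
  then have n: "n = m" using square_eq[of n m] by (simp add: encode_graph_def)
  have *: "{u, v} \<in> E \<longleftrightarrow> {u, v} \<in> F" if "u < n" "v < n" for u v
    using encode_nth(1)[OF that, of "\<lambda>u v. {u, v} \<in> E"] encode_nth(1)[OF that, of "\<lambda>u v. {u, v} \<in> F"] assms(3)
    unfolding encode_graph_def n by simp
  have iff: "e \<in> E \<longleftrightarrow> e \<in> F" if e: "e \<subseteq> {..<n} \<and> card e = 2" for e
  proof -
    obtain u v where "e = {u, v}" using e by (auto simp: card_2_iff)
    then show ?thesis using * e by simp
  qed
  have E: "e \<subseteq> {..<n} \<and> card e = 2" if "e \<in> E" for e using assms(1) that by (simp add: simple_graph_def)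
  have F: "e \<subseteq> {..<n} \<and> card e = 2" if "e \<in> F" for e
    using assms(2) that n by (simp add: simple_graph_def)
  have "E = F"
  proof (intro set_eqI iffI)
    show "e \<in> F" if "e \<in> E" for e using iff[OF E[OF that]] that by simp
    show "e \<in> E" if "e \<in> F" for e using iff[OF F[OF that]] that by simp
  qed
  then show ?thesis using n by simp
qed

lemma disjoint_instances: "yes_instances \<inter> no_instances = {}"
proof -
  have False if a: "x \<in> yes_instances" "x \<in> no_instances" for x
  proof -
    obtain n E where 1: "x = encode_graph n E" "admissible {..<n} E" "has_unweighted_optimum {..<n} E"
      using a(1) unfolding yes_instances_def by blast
    obtain m F where 2: "x = encode_graph m F" "admissible {..<m} F" "\<not> has_unweighted_optimum {..<m} F"
      using a(2) unfolding no_instances_def by blast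
    have "n = m \<and> E = F" using encode_graph_inj[of n E m F] 1(1,2) 2(1,2) by (simp add: admissible_def)
    then show False using 1(3) 2(3) by simp
  qed
  then show ?thesis by blast
qed

text \<open>In-degrees are compared without counting: at most 2 means that no three in-neighbours
  are distinct, and two such degrees are equal iff they agree on being at least 1 and on being at
  least 2.\<close>

definition certifies :: "nat \<Rightarrow> (nat \<Rightarrow> nat \<Rightarrow> bool) \<Rightarrow> (nat \<Rightarrow> nat \<Rightarrow> bool) \<Rightarrow> bool" where
  "certifies n E D \<longleftrightarrow>
     (\<forall>u<n. \<forall>v<n. D u v \<longrightarrow> E u v) \<and>
     (\<forall>u<n. \<forall>v<n. E u v \<longrightarrow> \<not> (D u v = D v u)) \<and>
     (\<forall>v<n. \<forall>a<n. \<forall>b<n. \<forall>c<n. D a v \<and> D b v \<and> D c v \<longrightarrow> a = b \<or> a = c \<or> b = c) \<and>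
     (\<forall>u<n. \<forall>v<n. E u v \<longrightarrow>
        \<not> ((\<exists>a<n. D a u) = (\<exists>a<n. D a v) \<and>
          (\<exists>a<n. \<exists>b<n. \<not> a = b \<and> D a u \<and> D b u) = (\<exists>a<n. \<exists>b<n. \<not> a = b \<and> D a v \<and> D b v)))"

lemma card_le_2_iff:
  assumes "finite X"
  shows "card X \<le> 2 \<longleftrightarrow> (\<forall>a\<in>X. \<forall>b\<in>X. \<forall>c\<in>X. a = b \<or> a = c \<or> b = c)" (is "_ \<longleftrightarrow> ?rhs")
proof (cases "card X \<le> 2")
  case True
  have "a = b \<or> a = c \<or> b = c" if "a \<in> X" "b \<in> X" "c \<in> X" for a b c
  proof (rule ccontr)
    assume "\<not> (a = b \<or> a = c \<or> b = c)"
    then have "card {a, b, c} = 3" by simp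
    moreover have "card {a, b, c} \<le> card X" using assms that by (intro card_mono) auto
    ultimately show False using True by simp
  qed
  then show ?thesis using True by blast
next
  case False
  then have "3 \<le> card X" by simp
  then obtain Y where "Y \<subseteq> X" "card Y = 3" by (rule obtain_subset_with_card_n) blast
  then obtain a b c where "{a, b, c} \<subseteq> X" "a \<noteq> b" "a \<noteq> c" "b \<noteq> c" by (auto simp: card_3_iff)
  then have "\<not> ?rhs" by blast
  then show ?thesis using False by blast
qed

lemma card_eq_iff:
  fixes X Y :: "'a set"
  assumes "finite X" "finite Y" "card X \<le> 2" "card Y \<le> 2"
  shows "card X = card Y \<longleftrightarrow> ((\<exists>a. a \<in> X) = (\<exists>a. a \<in> Y) \<and>
    (\<exists>a\<in>X. \<exists>b\<in>X. a \<noteq> b) = (\<exists>a\<in>Y. \<exists>b\<in>Y. a \<noteq> b))"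
proof -
  have "(\<exists>a. a \<in> Z) \<longleftrightarrow> card Z \<noteq> 0" "(\<exists>a\<in>Z. \<exists>b\<in>Z. a \<noteq> b) \<longleftrightarrow> \<not> card Z \<le> Suc 0"
    if "finite Z" for Z :: "'a set" using that by (auto simp: card_le_Suc0_iff_eq)
  from this[OF assms(1)] this[OF assms(2)] show ?thesis
    using assms(3,4) by (cases "card X = 0"; cases "card X = 1"; cases "card Y = 0"; cases "card Y = 1") auto
qed

lemma certifies_iff:
  assumes "D \<subseteq> {..<n} \<times> {..<n}" "simple_graph {..<n} E"
  shows "certifies n (\<lambda>u v. {u, v} \<in> E) (\<lambda>u v. (u, v) \<in> D) \<longleftrightarrow> orientation E D \<and>
    (\<forall>v. card {z. (z, v) \<in> D} \<le> 2) \<and>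
    (\<forall>u v. {u, v} \<in> E \<longrightarrow> card {z. (z, u) \<in> D} \<noteq> card {z. (z, v) \<in> D})"
proof -
  have D: "u < n \<and> v < n" if "(u, v) \<in> D" for u v using assms(1) that by auto
  have E: "u < n \<and> v < n" if "{u, v} \<in> E" for u v using assms(2) that unfolding simple_graph_def by auto
  have fin: "finite {z. (z, v) \<in> D}" for v
    by (rule finite_subset[of _ "{..<n}"]) (use D in auto)
  let ?c = "\<lambda>v. card {z. (z, v) \<in> D}"
  have 1: "(\<forall>v<n. \<forall>a<n. \<forall>b<n. \<forall>c<n. (a, v) \<in> D \<and> (b, v) \<in> D \<and> (c, v) \<in> D \<longrightarrow> a = b \<or> a = c \<or> b = c)
      \<longleftrightarrow> (\<forall>v. ?c v \<le> 2)"
    unfolding card_le_2_iff[OF fin] mem_Collect_eq using D by blast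
  have 2: "((\<exists>a<n. (a, u) \<in> D) = (\<exists>a<n. (a, v) \<in> D) \<and>
      (\<exists>a<n. \<exists>b<n. \<not> a = b \<and> (a, u) \<in> D \<and> (b, u) \<in> D) = (\<exists>a<n. \<exists>b<n. \<not> a = b \<and> (a, v) \<in> D \<and> (b, v) \<in> D))
      \<longleftrightarrow> ?c u = ?c v" if "\<forall>v. ?c v \<le> 2" for u v
  proof -
    have s: "(\<exists>a<n. (a, v) \<in> D) \<longleftrightarrow> (\<exists>a. a \<in> {z. (z, v) \<in> D})"
      "(\<exists>a<n. \<exists>b<n. \<not> a = b \<and> (a, v) \<in> D \<and> (b, v) \<in> D) \<longleftrightarrow>
        (\<exists>a\<in>{z. (z, v) \<in> D}. \<exists>b\<in>{z. (z, v) \<in> D}. a \<noteq> b)" for v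
      using D by blast+
    show ?thesis unfolding s by (rule card_eq_iff[OF fin fin, symmetric]) (use that in blast)+
  qed
  have gen: "(\<forall>u<n. \<forall>v<n. Q u v \<longrightarrow> P u v) \<longleftrightarrow> (\<forall>u v. Q u v \<longrightarrow> P u v)"
    if "\<And>u v. Q u v \<Longrightarrow> u < n \<and> v < n" for P Q :: "nat \<Rightarrow> nat \<Rightarrow> bool"
    using that by blast
  have a: "(\<forall>u<n. \<forall>v<n. (u, v) \<in> D \<longrightarrow> {u, v} \<in> E) \<longleftrightarrow> (\<forall>u v. (u, v) \<in> D \<longrightarrow> {u, v} \<in> E)"
    by (rule gen) (rule D)
  have 4: "(\<forall>u<n. \<forall>v<n. {u, v} \<in> E \<longrightarrow> \<not> Q u v) \<longleftrightarrow> (\<forall>u v. {u, v} \<in> E \<longrightarrow> \<not> Q u v)" for Q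
    by (rule gen) (rule E)
  have 3: "(\<forall>u<n. \<forall>v<n. (u, v) \<in> D \<longrightarrow> {u, v} \<in> E) \<and>
      (\<forall>u<n. \<forall>v<n. {u, v} \<in> E \<longrightarrow> \<not> ((u, v) \<in> D) = ((v, u) \<in> D)) \<longleftrightarrow> orientation E D"
    unfolding orientation_def a 4[of "\<lambda>u v. ((u, v) \<in> D) = ((v, u) \<in> D)"] by auto
  show ?thesis unfolding certifies_def 1 4 3[symmetric]
    by (cases "\<forall>v. ?c v \<le> 2") (simp_all only: 2 not_False_eq_True simp_thms conj_assoc)
qed

text \<open>Since the number of an admissible graph is 2, unit weights with in-degrees at most 2 are
  automatically optimal.\<close>

lemma unweighted_iff:
  fixes n :: nat
  assumes "admissible {..<n} E"
  shows "has_unweighted_optimum {..<n} E \<longleftrightarrow> (\<exists>D. D \<subseteq> {..<n} \<times> {..<n} \<and> orientation E D \<and>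
    (\<forall>v. card {z. (z, v) \<in> D} \<le> 2) \<and>
    (\<forall>u v. {u, v} \<in> E \<longrightarrow> card {z. (z, u) \<in> D} \<noteq> card {z. (z, v) \<in> D}))" (is "_ \<longleftrightarrow> ?rhs")
proof -
  have sg: "simple_graph {..<n} E" and number: "semi_proper_number {..<n} E = 2"
    using assms by (simp_all add: admissible_def)
  have E: "u < n \<and> v < n" if "{u, v} \<in> E" for u v using sg that unfolding simple_graph_def by auto
  have sub: "D \<subseteq> {..<n} \<times> {..<n}" if "orientation E D" for D
    using that E unfolding orientation_def by auto
  have weight: "in_weight D w v = card {z. (z, v) \<in> D}" if "orientation E D" "\<forall>e\<in>E. w e = 1" for D w v
  proof -
    have "{u, v} \<in> E" if "(u, v) \<in> D" for u v using \<open>orientation E D\<close> that by (auto simp: orientation_def)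
    then show ?thesis unfolding in_weight_def using that(2) by (subst card_eq_sum) (auto intro!: sum.cong)
  qed
  show ?thesis
  proof
    assume "has_unweighted_optimum {..<n} E"
    then obtain D w where *: "semi_proper E D w" "max_in_weight {..<n} D w = 2" "\<forall>e\<in>E. w e = 1"
      using number by (auto simp: has_unweighted_optimum_def optimal_semi_proper_def)
    have o: "orientation E D" using *(1) by (simp add: semi_proper_def)
    have "card {z. (z, v) \<in> D} \<le> 2" for v
    proof (cases "v < n")
      case True
      then have "in_weight D w v \<le> max_in_weight {..<n} D w"
        unfolding max_in_weight_def by (intro cSUP_upper bdd_above_finite) auto
      then show ?thesis using *(2) weight[OF o *(3)] by simp
    next
      case False
      then have "{z. (z, v) \<in> D} = {}" using sub[OF o] by auto
      then show ?thesis by (simp only: card.empty)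
    qed
    moreover have "card {z. (z, u) \<in> D} \<noteq> card {z. (z, v) \<in> D}" if "{u, v} \<in> E" for u v
      using *(1) that unfolding semi_proper_def weight[OF o *(3)] by blast
    ultimately show ?rhs using o sub[OF o] by blast
  next
    assume ?rhs
    then obtain D where o: "orientation E D" and c: "\<And>v. card {z. (z, v) \<in> D} \<le> 2"
      and p: "\<And>u v. {u, v} \<in> E \<Longrightarrow> card {z. (z, u) \<in> D} \<noteq> card {z. (z, v) \<in> D}" by blast
    define w :: "nat set \<Rightarrow> nat" where "w = (\<lambda>_. 1)"
    have w: "in_weight D w v = card {z. (z, v) \<in> D}" for v
      by (rule weight[OF o]) (simp add: w_def)
    have sp: "semi_proper E D w"
      unfolding semi_proper_def w using o p by (simp add: w_def)
    have "semi_proper_number {..<n} E \<le> (case (D, w) of (D, w) \<Rightarrow> max_in_weight {..<n} D w)"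
      unfolding semi_proper_number_def by (rule cINF_lower) (use sp in auto)
    moreover have "max_in_weight {..<n} D w \<le> 2"
    proof (cases "n = 0")
      case True
      then show ?thesis by (simp add: max_in_weight_def)
    next
      case False
      then show ?thesis unfolding max_in_weight_def w by (intro cSUP_least c) auto
    qed
    ultimately have "max_in_weight {..<n} D w = semi_proper_number {..<n} E" using number by simp
    then have "optimal_semi_proper {..<n} E D w" using sp by (simp add: optimal_semi_proper_def)
    then show "has_unweighted_optimum {..<n} E"
      unfolding has_unweighted_optimum_def by (intro exI[of _ D] exI[of _ w]) (simp add: w_def)
  qed
qed

theorem in_NP_unweighted: "in_NP yes_instances no_instances"
proof -
  \<comment> \<open>The number of vertices is found by searching for the square root of the length
    of the code.\<close>
  define P where "P x u l \<longleftrightarrow> (\<exists>n<Suc l. n * n = l \<and> certifies n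
    (\<lambda>i j. fst (word_tape x) (int (i * n + j)) = 2) (\<lambda>i j. fst (word_tape u) (int (i * n + j)) = 2))"
    for x u :: "bool list" and l
  have rel: "poly_time_relation (\<lambda>x u. P x u (length x))"
  proof (rule poly_time_predicate)
    show "deff 2 1 (\<lambda>inp e. P (inp 0) (inp 1) (e 0))"
      unfolding P_def certifies_def
      by (rule definable_intros | simp only: fun_upd_apply nat.inject nat.distinct if_False; fail | simp; fail)+
  qed
  have code: "P (encode_graph n E) u (length (encode_graph n E)) \<longleftrightarrow>
      certifies n (\<lambda>i j. {i, j} \<in> E) (\<lambda>i j. (i, j) \<in> {(i, j). i < n \<and> j < n \<and> fst (word_tape u) (int (i * n + j)) = 2})"
    for n E u
  proof -
    let ?D = "{(i, j). i < n \<and> j < n \<and> fst (word_tape u) (int (i * n + j)) = 2}"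
    have E: "fst (word_tape (encode_graph n E)) (int (i * n + j)) = 2 \<longleftrightarrow> {i, j} \<in> E"
      if "i < n" "j < n" for i j
      unfolding encode_graph_def by (rule encode_nth(2)[OF that, of "\<lambda>i j. {i, j} \<in> E"])
    have D: "fst (word_tape u) (int (i * n + j)) = 2 \<longleftrightarrow> (i, j) \<in> ?D" if "i < n" "j < n" for i j
      using that by simp
    have cong: "certifies n A B \<longleftrightarrow> certifies n A' B'"
      if "\<And>i j. i < n \<Longrightarrow> j < n \<Longrightarrow> A i j = A' i j" "\<And>i j. i < n \<Longrightarrow> j < n \<Longrightarrow> B i j = B' i j" for A A' B B'
      unfolding certifies_def using that by (simp cong: conj_cong)
    have "n < Suc (n * n)" by (simp add: less_Suc_eq_le)
    then have "P (encode_graph n E) u (length (encode_graph n E)) \<longleftrightarrow> certifies n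
        (\<lambda>i j. fst (word_tape (encode_graph n E)) (int (i * n + j)) = 2) (\<lambda>i j. fst (word_tape u) (int (i * n + j)) = 2)"
      unfolding P_def encode_graph_def length_map length_upt diff_zero using square_eq by blast
    also have "\<dots> \<longleftrightarrow> certifies n (\<lambda>i j. {i, j} \<in> E) (\<lambda>i j. (i, j) \<in> ?D)"
      by (rule cong) (use E D in blast)+
    finally show ?thesis .
  qed
  show ?thesis unfolding in_NP_def
  \<comment> \<open>A certificate is the matrix of an orientation and exactly as long as the input,
    hence the identity polynomial.\<close>
  proof (intro exI[of _ "\<lambda>x u. P x u (length x)"] exI[of _ "[:0, 1:]"] conjI ballI rel)
    fix x assume "x \<in> yes_instances"
    then obtain n E where x: "x = encode_graph n E" "admissible {..<n} E" "has_unweighted_optimum {..<n} E"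
      unfolding yes_instances_def by blast
    have sg: "simple_graph {..<n} E" using x(2) by (simp add: admissible_def)
    obtain D where D: "D \<subseteq> {..<n} \<times> {..<n}" "certifies n (\<lambda>u v. {u, v} \<in> E) (\<lambda>u v. (u, v) \<in> D)"
      using x(3) certifies_iff[OF _ sg] unfolding unweighted_iff[OF x(2)] by blast
    define u where "u = map (\<lambda>k. (k div n, k mod n) \<in> D) [0..<n * n]"
    have "fst (word_tape u) (int (i * n + j)) = 2 \<longleftrightarrow> (i, j) \<in> D" if "i < n" "j < n" for i j
      unfolding u_def by (rule encode_nth(2)[OF that, of "\<lambda>i j. (i, j) \<in> D"])
    then have "{(i, j). i < n \<and> j < n \<and> fst (word_tape u) (int (i * n + j)) = 2} = D" using D(1) by auto
    then have "P x u (length x)" unfolding x(1) code using D(2) by (simp only:)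
    moreover have "length u \<le> poly [:0, 1:] (length x)" by (simp add: u_def x(1) encode_graph_def)
    ultimately show "\<exists>u. length u \<le> poly [:0, 1:] (length x) \<and> P x u (length x)" by blast
  next
    fix x assume "x \<in> no_instances"
    then obtain n E where x: "x = encode_graph n E" "admissible {..<n} E" "\<not> has_unweighted_optimum {..<n} E"
      unfolding no_instances_def by blast
    have sg: "simple_graph {..<n} E" using x(2) by (simp add: admissible_def)
    have "\<not> P x u (length x)" for u
    proof
      let ?D = "{(i, j). i < n \<and> j < n \<and> fst (word_tape u) (int (i * n + j)) = 2}"
      assume "P x u (length x)"
      then have c: "certifies n (\<lambda>i j. {i, j} \<in> E) (\<lambda>i j. (i, j) \<in> ?D)" unfolding x(1) code .
      have s: "?D \<subseteq> {..<n} \<times> {..<n}" by auto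
      show False using x(3) c s unfolding certifies_iff[OF s sg] unweighted_iff[OF x(2)] by blast
    qed
    then show "\<not> (\<exists>u. length u \<le> poly [:0, 1:] (length x) \<and> P x u (length x))" by blast
  qed
qed

theorem theorem2:
  shows "NP_complete yes_instances no_instances"
  unfolding NP_complete_def
  using disjoint_instances in_NP_unweighted NP_hard_unweighted by blast

end
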